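(* Let $\mathbf{T}=(T_t\colon t\ge 0)$ be a subordinator with the Laplace exponent $\phi$. Suppose that $\phi\in\mathrm{WLSC}(\alpha,c,x_0)\cap\mathrm{WUSC}(\beta,C,x_0)$ for some $c\in(0,1]$, $C\ge 1$, $x_0\ge 0$, and $0<\alpha\le\beta<1$. Assume that one of the following conditions holds: (i) the Lévy measure $\nu(\mathrm{d}x)$ is absolutely continuous with respect to the Lebesgue measure with monotone density $\nu(x)$; or (ii) $\alpha>\tfrac12$. Then for each $A>0$ there is $C_1\ge 1$ such that for all $0<x<A/x_0$, $$C_1^{-1}\frac{1}{x\phi(1/x)}\le G(x)\le C_1\frac{1}{x\phi(1/x)}.$$
   Context: A subordinator is a one-dimensional Lévy process $\mathbf{T}=(T_t\colon t\ge 0)$ with $T_0=0$ and nondecreasing paths. Its Laplace exponent $\phi\colon[0,\infty)\to[0,\infty)$ is defined by $\mathbb{E}\,e^{-\lambda T_t}=e^{-t\phi(\lambda)}$, and $\phi(\lambda)=b\lambda+\int_{(0,\infty)}(1-e^{-\lambda s})\,\nu(\mathrm{d}s)$, where $b\ge 0$ and $\nu$ (the Lévy measure) satisfies $\int_{(0,\infty)}\min\{1,s\}\,\nu(\mathrm{d}s)<\infty$. It is assumed that $\phi''\not\equiv 0$. Under the hypotheses of the claim $T_t$ has a density for every $t>0$; $p(t,\cdot)$ denotes its continuous version, and the Green function is $G(x)=\int_0^\infty p(t,x)\,\mathrm{d}t$, $x>0$. For $\tau\in\mathbb{R}$, $x_0\ge 0$, a nonnegative function $f$ on $(0,\infty)$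 belongs to $\mathrm{WLSC}(\tau,c,x_0)$, $c\in(0,1]$, if $f(\lambda x)\ge c\lambda^{\tau}f(x)$ for all $\lambda\ge 1$ and $x>x_0$; it belongs to $\mathrm{WUSC}(\tau,C,x_0)$, $C\ge1$, if $f(\lambda x)\le C\lambda^{\tau}f(x)$ for all $\lambda\ge1$ and $x>x_0$. Convention: $A/x_0=\infty$ when $x_0=0$. *)

theory Defs
  imports "HOL-Probability.Probability"
begin

text \<open>The time parameter ranges over the reals; only the values at times \<open>t \<ge> 0\<close> matter.\<close>

locale levy_process = prob_space M for M :: "'a measure" +
  fixes T :: "real \<Rightarrow> 'a \<Rightarrow> real"
  assumes random_variable: "\<And>t. 0 \<le> t \<Longrightarrow> T t \<in> borel_measurable M"
    and start_zero: "AE \<omega> in M. T 0 \<omega> = 0"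
    and indep_increments:
      "\<And>(n::nat) t. 0 \<le> t 0 \<Longrightarrow> (\<And>i. i < n \<Longrightarrow> t i < t (Suc i)) \<Longrightarrow>
         indep_vars (\<lambda>_. borel) (\<lambda>i \<omega>. T (t (Suc i)) \<omega> - T (t i) \<omega>) {..<n}"
    and stationary_increments:
      "\<And>s t. 0 \<le> s \<Longrightarrow> 0 \<le> t \<Longrightarrow>
         distr M borel (\<lambda>\<omega>. T (s + t) \<omega> - T s \<omega>) = distr M borel (\<lambda>\<omega>. T t \<omega> - T 0 \<omega>)"
    and cadlag:
      "AE \<omega> in M.
         (\<forall>t\<ge>0. ((\<lambda>s. T s \<omega>) \<longlongrightarrow> T t \<omega>) (at_right t)) \<and>
         (\<forall>t>0. \<exists>l. ((\<lambda>s. T s \<omega>) \<longlongrightarrow> l) (at_left t))"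

locale subordinator = levy_process +
  assumes nondecreasing_paths: "AE \<omega> in M. mono_on {0..} (\<lambda>t. T t \<omega>)"

text \<open>A function on \<open>[0,\<infinity>)\<close> is represented by a function on the reals whose values at negative
  arguments are irrelevant.\<close>

definition is_laplace_exponent :: "'a measure \<Rightarrow> (real \<Rightarrow> 'a \<Rightarrow> real) \<Rightarrow> (real \<Rightarrow> real) \<Rightarrow> bool" where
  "is_laplace_exponent M T \<phi> \<longleftrightarrow>
     (\<forall>u\<ge>0. 0 \<le> \<phi> u) \<and>
     (\<forall>t\<ge>0. \<forall>u\<ge>0. (\<integral>\<omega>. exp (- u * T t \<omega>) \<partial>M) = exp (- t * \<phi> u))"

text \<open>A measure on \<open>(0,\<infinity>)\<close> is represented by a Borel measure on the reals that does not charge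
  \<open>(-\<infinity>,0]\<close>.\<close>

definition subordinator_levy_measure :: "real measure \<Rightarrow> bool" where
  "subordinator_levy_measure \<nu> \<longleftrightarrow>
     sets \<nu> = sets borel \<and> emeasure \<nu> {..0} = 0 \<and>
     (\<integral>\<^sup>+s\<in>{0<..}. ennreal (min 1 s) \<partial>\<nu>) < \<infinity>"

definition levy_khintchine_repr :: "(real \<Rightarrow> real) \<Rightarrow> real \<Rightarrow> real measure \<Rightarrow> bool" where
  "levy_khintchine_repr \<phi> b \<nu> \<longleftrightarrow>
     0 \<le> b \<and> subordinator_levy_measure \<nu> \<and>
     (\<forall>u\<ge>0. \<phi> u = b * u + (LINT s:{0<..}|\<nu>. 1 - exp (- u * s)))"

definition has_monotone_density :: "real measure \<Rightarrow> bool" where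
  "has_monotone_density \<nu> \<longleftrightarrow>
     (\<exists>f :: real \<Rightarrow> real.
        f \<in> borel_measurable borel \<and> (\<forall>s>0. 0 \<le> f s) \<and>
        (mono_on {0<..} f \<or> antimono_on {0<..} f) \<and>
        \<nu> = density lborel (\<lambda>s. ennreal (f s) * indicator {0<..} s))"

definition WLSC :: "real \<Rightarrow> real \<Rightarrow> real \<Rightarrow> (real \<Rightarrow> real) set" where
  "WLSC \<tau> c x0 = {f. (\<forall>x>0. 0 \<le> f x) \<and>
     (\<forall>u\<ge>1. \<forall>x>x0. c * u powr \<tau> * f x \<le> f (u * x))}"

definition WUSC :: "real \<Rightarrow> real \<Rightarrow> real \<Rightarrow> (real \<Rightarrow> real) set" where
  "WUSC \<tau> C x0 = {f. (\<forall>x>0. 0 \<le> f x) \<and>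
     (\<forall>u\<ge>1. \<forall>x>x0. f (u * x) \<le> C * u powr \<tau> * f x)}"

definition is_continuous_density ::
    "'a measure \<Rightarrow> ('a \<Rightarrow> real) \<Rightarrow> (real \<Rightarrow> real) \<Rightarrow> bool" where
  "is_continuous_density M X f \<longleftrightarrow>
     continuous_on UNIV f \<and> (\<forall>x. 0 \<le> f x) \<and> distributed M lborel X (\<lambda>x. ennreal (f x))"

text \<open>Two continuous densities agree almost everywhere, hence everywhere, so the description below
  is determined as soon as a continuous density exists.\<close>

definition transition_density ::
    "'a measure \<Rightarrow> (real \<Rightarrow> 'a \<Rightarrow> real) \<Rightarrow> real \<Rightarrow> real \<Rightarrow> real" where
  "transition_density M T t = (THE f. is_continuous_density M (T t) f)"

text \<open>The Green function takes values in \<open>[0,\<infinity>]\<close>, so that its finiteness is not presupposed.\<close>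

definition green_function :: "'a measure \<Rightarrow> (real \<Rightarrow> 'a \<Rightarrow> real) \<Rightarrow> real \<Rightarrow> ennreal" where
  "green_function M T x = (\<integral>\<^sup>+t\<in>{0<..}. ennreal (transition_density M T t x) \<partial>lborel)"

end

theory Submission
  imports Defs "HOL-Complex_Analysis.Conformal_Mappings" "HOL-Real_Asymp.Real_Asymp"
begin

text \<open>
  Only the marginal laws enter: \<open>T\<^sub>t\<close> is nonnegative and has the Laplace transform
  \<open>exp (- t \<phi>)\<close>. The upper scaling condition with \<open>\<beta> < 1\<close> forces \<open>b = 0\<close>, so
  \<open>\<phi> (u) = \<integral> (1 - e\<^sup>-\<^sup>u\<^sup>s) \<nu>(ds)\<close>; this formula extends \<open>\<phi>\<close> to the half-plane \<open>Re z > 0\<close>,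
  and so does the formula for the Laplace transform of \<open>T\<^sub>t\<close>.

  The two scaling conditions together imply that \<open>u\<^sup>2 \<integral>\<^bsub>s \<le> 1/u\<^esub> s\<^sup>2 \<nu>(ds)\<close> is bounded
  below by a multiple of \<open>\<phi> (u)\<close> (\<open>trunc_ge\<close>). Hence \<open>Re \<phi> (u + i\<xi>)\<close> is at least
  \<open>\<phi> (u)\<close> plus a multiple of \<open>(\<xi>/v)\<^sup>2 \<phi> (v)\<close> with \<open>v = max u \<bar>\<xi>\<bar>\<close> (\<open>Re_cphi_ge\<close>), and
  \<open>exp (- t \<phi>)\<close> is integrable along vertical lines. Fourier inversion of the law of \<open>T\<^sub>t\<close>
  tilted by \<open>e\<^sup>-\<^sup>u\<^sup>y\<close>, and of the same law weighted by \<open>y e\<^sup>-\<^sup>u\<^sup>y\<close>, gives the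
  continuous density \<open>p\<close> in two forms, with \<open>z = u - i\<xi>\<close>:
  \<open>2\<pi> p(t,x) = e\<^sup>u\<^sup>x \<integral> e\<^sup>-\<^sup>i\<^sup>\<xi>\<^sup>x exp (- t \<phi> (z)) d\<xi>\<close> and
  \<open>2\<pi> x p(t,x) = e\<^sup>u\<^sup>x \<integral> e\<^sup>-\<^sup>i\<^sup>\<xi>\<^sup>x t \<phi>'(z) exp (- t \<phi> (z)) d\<xi>\<close>.

  \<^emph>\<open>Upper bound.\<close> Put \<open>u = 1/x\<close> in the second form, take absolute values and integrate over \<open>t\<close>
  first: \<open>x G(x)\<close> is at most a multiple of \<open>\<integral> \<bar>\<phi>'(z)\<bar> / (Re \<phi> (z))\<^sup>2 d\<xi>\<close>. The part
  \<open>\<bar>\<xi>\<bar> < u\<close> contributes at most \<open>2 / \<phi> (u)\<close>. For \<open>\<bar>\<xi>\<bar> \<ge> u\<close> the denominator is at least a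
  multiple of \<open>\<phi> (\<bar>\<xi>\<bar>)\<^sup>2\<close>. If \<open>\<alpha> > 1/2\<close>, then the trivial estimate \<open>\<bar>\<phi>'(z)\<bar> \<le> \<phi> (u) / u\<close> makes the
  integral converge; if \<open>\<nu>\<close> has a monotone density, then cancellation between half-periods
  improves this to \<open>\<bar>\<phi>'(z)\<bar> \<le> 2\<pi> \<phi> (\<bar>\<xi>\<bar>) / \<bar>\<xi>\<bar>\<close>
  (\<open>norm_cphi'_le_of_antimono_density\<close>), and every \<open>\<alpha> > 0\<close> will do. In both cases the
  result is a multiple of \<open>1 / \<phi> (1/x)\<close>.

  \<^emph>\<open>Lower bound\<close> (\<open>dens_ge\<close>). Put \<open>w = M\<^sub>0 / x\<close> with a large constant \<open>M\<^sub>0\<close> and let \<open>t\<^sub>0\<close> be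
  the saddle-point time \<open>x / \<phi>'(w)\<close>. For \<open>t\<close> in \<open>[t\<^sub>0, (1 + \<epsilon>) t\<^sub>0]\<close> the first form with
  \<open>u = w\<close> is close to a Gaussian integral whose width in \<open>\<xi>\<close> is of order \<open>w / sqrt (t\<^sub>0 \<phi> (w))\<close>,
  and \<open>t\<^sub>0 \<phi> (w)\<close> is comparable to \<open>M\<^sub>0\<close>; hence \<open>p(t,x) \<ge> \<kappa> / x\<close> there. As
  \<open>t\<^sub>0 \<ge> 1 / \<phi> (1/x)\<close>, integration over this time interval gives the lower bound of \<open>G(x)\<close>.
\<close>

section \<open>Inversion of integrable characteristic functions\<close>

text \<open>The inverse Fourier transform, normalised so that it recovers a density from its
  characteristic function.\<close>

definition fourier_inv :: "(real \<Rightarrow> complex) \<Rightarrow> real \<Rightarrow> complex" where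
  "fourier_inv h x = (1 / (2 * pi)) * (CLINT t|lborel. iexp (- (t * x)) * h t)"

lemma integrable_fourier_inv:
  assumes "integrable lborel h"
  shows "integrable lborel (\<lambda>t. iexp (- (t * x)) * h t)"
  by (rule Bochner_Integration.integrable_bound[OF integrable_norm[OF assms]])
    (use assms in \<open>auto simp: norm_mult\<close>)

lemma continuous_fourier_inv:
  assumes "integrable lborel h"
  shows "continuous_on UNIV (fourier_inv h)"
proof (rule continuous_on_sequentiallyI)
  fix u :: "nat \<Rightarrow> real" and a assume "u \<longlonglongrightarrow> a"
  have "(\<lambda>n. CLINT t|lborel. iexp (- (t * u n)) * h t) \<longlonglongrightarrow> (CLINT t|lborel. iexp (- (t * a)) * h t)"
    by (rule integral_dominated_convergence[where w="\<lambda>t. norm (h t)"])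
      (use assms \<open>u \<longlonglongrightarrow> a\<close> in \<open>auto simp: norm_mult intro!: tendsto_intros AE_I2\<close>)
  then show "(\<lambda>n. fourier_inv h (u n)) \<longlonglongrightarrow> fourier_inv h a"
    unfolding fourier_inv_def by (intro tendsto_intros)
qed

lemma integral_iexp_interval:
  assumes "a \<le> b" "t \<noteq> 0"
  shows "(CLINT x|lborel. indicator {a..b} x *\<^sub>R iexp (- (t * x)))
      = (iexp (- (t * a)) - iexp (- (t * b))) / (\<i> * t)"
proof -
  have "((\<lambda>x. iexp (-(t * x))) has_integral
      (- iexp (-(t * b)) / (\<i> * t) - (- iexp (-(t * a)) / (\<i> * t)))) {a..b}"
  proof (rule fundamental_theorem_of_calculus[OF \<open>a \<le> b\<close>])
    fix x
    have "((\<lambda>z. - exp (- (\<i> * t * z)) / (\<i> * t)) has_field_derivative exp (- (\<i> * t * complex_of_real x)))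
        (at (complex_of_real x))"
      using assms by (auto intro!: derivative_eq_intros simp: field_simps)
    from has_vector_derivative_real_field[OF this]
    show "((\<lambda>x. - iexp (-(t * x)) / (\<i> * t)) has_vector_derivative iexp (-(t * x))) (at x within {a..b})"
      by (simp add: mult.assoc)
  qed
  moreover have "set_integrable lborel {a..b} (\<lambda>x. iexp (-(t * x)))"
    unfolding set_integrable_def by (intro borel_integrable_compact) (auto intro!: continuous_intros)
  ultimately show ?thesis
    using set_borel_integral_eq_integral(2)[of "{a..b}" "\<lambda>x. iexp (-(t * x))"]
    by (auto simp: set_lebesgue_integral_def integral_unique diff_divide_distrib)
qed

lemma fourier_inv_interval:
  assumes h: "integrable lborel h" and "a \<le> b"
  shows "(CLINT x|lborel. indicator {a..b} x *\<^sub>R fourier_inv h x)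
      = (1 / (2 * pi)) * (CLINT t|lborel. (iexp (- (t * a)) - iexp (- (t * b))) / (\<i> * t) * h t)"
proof -
  let ?f = "\<lambda>x t. indicator {a..b} x *\<^sub>R (iexp (- (t * x)) * h t)"
  have [measurable]: "h \<in> borel_measurable lborel" using h by auto
  have I: "integrable (lborel \<Otimes>\<^sub>M lborel) (\<lambda>(x, t). ?f x t)"
  proof (rule lborel_pair.Fubini_integrable)
    have "(\<lambda>x. LINT t|lborel. norm (?f x t)) = (\<lambda>x. indicator {a..b} x * (LINT t|lborel. norm (h t)))"
      by (auto simp: norm_mult indicator_def)
    then show "integrable lborel (\<lambda>x. LINT t|lborel. norm ((\<lambda>(x, t). ?f x t) (x, t)))"
      by (auto intro!: integrable_real_indicator simp: emeasure_lborel_Icc_eq)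
    show "AE x in lborel. integrable lborel (\<lambda>t. (\<lambda>(x, t). ?f x t) (x, t))"
      using integrable_fourier_inv[OF h] by (auto intro!: AE_I2)
  qed measurable
  have "(CLINT x|lborel. indicator {a..b} x *\<^sub>R (CLINT t|lborel. iexp (- (t * x)) * h t))
     = (CLINT x|lborel. CLINT t|lborel. ?f x t)"
    by (intro Bochner_Integration.integral_cong) auto
  also have "\<dots> = (CLINT t|lborel. CLINT x|lborel. ?f x t)"
    using lborel_pair.Fubini_integral[OF I] by simp
  also have "\<dots> = (CLINT t|lborel. (iexp (- (t * a)) - iexp (- (t * b))) / (\<i> * t) * h t)"
  proof (rule integral_cong_AE)
    have "AE t in lborel. t \<noteq> (0::real)" by (rule AE_lborel_singleton)
    then show "AE t in lborel. (CLINT x|lborel. ?f x t) =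
        (iexp (- (t * a)) - iexp (- (t * b))) / (\<i> * t) * h t"
    proof eventually_elim
      case (elim t)
      have "(CLINT x|lborel. ?f x t) = (CLINT x|lborel. indicator {a..b} x *\<^sub>R iexp (- (t * x)) * h t)"
        by simp
      also have "\<dots> = (CLINT x|lborel. indicator {a..b} x *\<^sub>R iexp (- (t * x))) * h t"
        by (rule Bochner_Integration.integral_mult_left_zero)
      finally show ?case using integral_iexp_interval[OF \<open>a \<le> b\<close> elim] by simp
    qed
  qed measurable
  finally have *: "(CLINT x|lborel. indicator {a..b} x *\<^sub>R (CLINT t|lborel. iexp (- (t * x)) * h t)) = \<dots>" .
  have "(CLINT x|lborel. indicator {a..b} x *\<^sub>R fourier_inv h x)
      = (CLINT x|lborel. (1 / (2 * pi)) * (indicator {a..b} x *\<^sub>R (CLINT t|lborel. iexp (- (t * x)) * h t)))"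
    unfolding fourier_inv_def by (simp only: mult_scaleR_right)
  also have "\<dots> = (1 / (2 * pi)) * (CLINT x|lborel. indicator {a..b} x *\<^sub>R (CLINT t|lborel. iexp (- (t * x)) * h t))"
    by (rule Bochner_Integration.integral_mult_right_zero)
  finally show ?thesis unfolding * .
qed

lemma (in real_distribution) measure_Ioc_char_integrable:
  assumes h: "integrable lborel (char M)" and "a \<le> b" "measure M {a} = 0" "measure M {b} = 0"
  shows "measure M {a<..b} = (LINT x|lborel. indicator {a..b} x * Re (fourier_inv (char M) x))"
proof -
  let ?F = "\<lambda>t. (iexp (- (t * a)) - iexp (- (t * b))) / (\<i> * complex_of_real t) * char M t"
  have B: "norm (?F t) \<le> (b - a) * norm (char M t)" for t
  proof (cases "t = 0")
    case False
    have "norm ((iexp (- (t * a)) - iexp (- (t * b))) / (\<i> * complex_of_real t)) \<le> b - a"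
      using Levy_Inversion_aux2[of "-b" "-a" t] assms False by (simp add: algebra_simps)
    then show ?thesis unfolding norm_mult by (rule mult_right_mono) auto
  qed (use assms in auto)
  have [measurable]: "char M \<in> borel_measurable borel" using h by auto
  have "(\<lambda>n. CLINT t|lborel. indicator {- real n<..<real n} t *\<^sub>R ?F t) \<longlonglongrightarrow> (CLINT t|lborel. ?F t)"
  proof (rule integral_dominated_convergence[where w="\<lambda>t. (b - a) * norm (char M t)"])
    show "integrable lborel (\<lambda>t. (b - a) * norm (char M t))" using h by auto
    show "AE t in lborel. (\<lambda>n. indicator {- real n<..<real n} t *\<^sub>R ?F t) \<longlonglongrightarrow> ?F t"
    proof (rule AE_I2)
      fix t :: real
      have "eventually (\<lambda>n. indicator {- real n<..<real n} t *\<^sub>R ?F t = ?F t) sequentially"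
        using eventually_gt_at_top[of "nat \<lceil>\<bar>t\<bar>\<rceil>"]
        by eventually_elim (auto simp: indicator_def abs_less_iff, linarith+)
      then show "(\<lambda>n. indicator {- real n<..<real n} t *\<^sub>R ?F t) \<longlonglongrightarrow> ?F t"
        by (rule tendsto_eventually)
    qed
    show "AE t in lborel. norm (indicator {- real n<..<real n} t *\<^sub>R ?F t) \<le> (b - a) * norm (char M t)" for n
      using B order.trans[OF norm_ge_zero B] by (auto simp: indicator_def intro!: AE_I2)
  qed measurable
  moreover have "(CLBINT t=-real n..real n. ?F t) = (CLINT t|lborel. indicator {- real n<..<real n} t *\<^sub>R ?F t)" for n :: nat
    by (simp add: interval_lebesgue_integral_def set_lebesgue_integral_def)
  ultimately have "(\<lambda>n. 1 / (2 * pi) * (CLBINT t=-real n..real n. ?F t)) \<longlonglongrightarrow> 1 / (2 * pi) * (CLINT t|lborel. ?F t)"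
    by (auto intro!: tendsto_intros)
  then have "complex_of_real (measure M {a<..b}) = 1 / (2 * pi) * (CLINT t|lborel. ?F t)"
    by (rule LIMSEQ_unique[OF Levy_Inversion[OF assms(2,3,4), unfolded of_int_minus of_int_of_nat_eq]])
  also have "\<dots> = (CLINT x|lborel. indicator {a..b} x *\<^sub>R fourier_inv (char M) x)"
    by (rule fourier_inv_interval[OF h \<open>a \<le> b\<close>, symmetric])
  finally have "measure M {a<..b} = Re (CLINT x|lborel. indicator {a..b} x *\<^sub>R fourier_inv (char M) x)"
    by (metis Re_complex_of_real)
  moreover have "integrable lborel (\<lambda>x. indicator {a..b} x *\<^sub>R fourier_inv (char M) x)"
    using borel_integrable_compact[of "{a..b}" "fourier_inv (char M)"]
      continuous_on_subset[OF continuous_fourier_inv[OF h]]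
    by (simp add: set_integrable_def)
  ultimately show ?thesis by (simp add: integral_Re[symmetric] del: integral_Re)
qed

text \<open>A law with an integrable characteristic function has the inverse Fourier transform of that
  function as a density. The inversion formula for intervals is applied at points that are not atoms; such
  points are dense, and the resulting bound on the mass of short intervals excludes atoms
  altogether.\<close>

theorem (in real_distribution) char_integrable_density:
  assumes h: "integrable lborel (char M)"
  defines "g \<equiv> \<lambda>x. Re (fourier_inv (char M) x)"
  shows "0 \<le> g x" and "M = density lborel (\<lambda>x. ennreal (g x))"
proof -
  have cont: "continuous_on UNIV g"
    unfolding g_def using continuous_fourier_inv[OF h] by (intro continuous_intros)
  then have [measurable]: "g \<in> borel_measurable borel"
    by (rule borel_measurable_continuous_onI)
  have gint: "integrable lborel (\<lambda>x. indicator {a..b} x * g x)" for a b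
    using borel_integrable_compact[of "{a..b}" g] continuous_on_subset[OF cont]
    by (simp add: set_integrable_def)
  have cint: "integrable lborel (\<lambda>x. indicator {a..b} x * c)" for a b c :: real
    by (intro integrable_mult_left integrable_real_indicator) (auto simp: emeasure_lborel_Icc_eq)
  define K where "K = (1 / (2 * pi)) * (LINT t|lborel. norm (char M t))"
  have K: "g x \<le> K" for x
  proof -
    have "g x \<le> norm (fourier_inv (char M) x)" unfolding g_def by (rule complex_Re_le_cmod)
    also have "\<dots> = (1 / (2 * pi)) * norm (CLINT t|lborel. iexp (- (t * x)) * char M t)"
      by (simp add: fourier_inv_def norm_mult norm_divide)
    also have "\<dots> \<le> (1 / (2 * pi)) * (LINT t|lborel. norm (iexp (- (t * x)) * char M t))"
      by (intro mult_left_mono integral_norm_bound) auto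
    finally show ?thesis by (simp add: K_def norm_mult)
  qed
  have "0 \<le> K" unfolding K_def by (intro mult_nonneg_nonneg integral_nonneg) auto
  \<comment> \<open>Atoms are countable, so every interval contains a point that is not one.\<close>
  have ex: "\<exists>y. a < y \<and> y < b \<and> measure M {y} = 0" if "a < b" for a b :: real
  proof -
    have "uncountable {a<..<b}" using that by (simp add: uncountable_open_interval)
    then have "\<not> {a<..<b} \<subseteq> {x. 0 < measure M {x}}" 
      using countable_atoms countable_subset by blast
    then show ?thesis by (auto simp: zero_less_measure_iff)
  qed
  have Ioc: "measure M {a<..b} = (LINT x|lborel. indicator {a..b} x * g x)"
    if "a \<le> b" "measure M {a} = 0" "measure M {b} = 0" for a b
    using measure_Ioc_char_integrable[OF h that] by (simp add: g_def)
  have atom: "measure M {x} = 0" for x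
  proof (rule ccontr)
    assume "measure M {x} \<noteq> 0"
    then have p: "measure M {x} > 0" using measure_nonneg[of M "{x}"] by linarith
    define e where "e = measure M {x} / (2 * (K + 1))"
    have "0 < e" using p \<open>0 \<le> K\<close> by (simp add: e_def)
    obtain a b where ab: "x - e / 2 < a" "a < x" "measure M {a} = 0" "x < b" "b < x + e / 2" "measure M {b} = 0"
      using ex[of "x - e / 2" x] ex[of x "x + e / 2"] \<open>0 < e\<close> by auto
    have "measure M {x} \<le> measure M {a<..b}"
      using ab by (intro finite_measure_mono) auto
    also have "\<dots> = (LINT x|lborel. indicator {a..b} x * g x)" using ab by (intro Ioc) auto
    also have "\<dots> \<le> (LINT x|lborel. indicator {a..b} x * K)"
      by (intro integral_mono gint cint mult_left_mono K) auto
    also have "\<dots> = (b - a) * K" using ab by simp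
    also have "\<dots> \<le> e * (K + 1)" using ab \<open>0 \<le> K\<close> \<open>0 < e\<close> by (intro mult_mono) auto
    also have "\<dots> = measure M {x} / 2" using \<open>0 \<le> K\<close> by (simp add: e_def field_simps)
    finally show False using p by simp
  qed
  have nonneg: "0 \<le> g x" for x
  proof (rule ccontr)
    assume "\<not> 0 \<le> g x"
    then have "g x < g x / 2" by auto
    moreover have "(g \<longlongrightarrow> g x) (nhds x)"
      using cont by (simp add: continuous_on_eq_continuous_at isCont_def tendsto_at_iff_tendsto_nhds)
    ultimately have "eventually (\<lambda>y. g y < g x / 2) (nhds x)"
      by (intro order_tendstoD(2))
    then obtain d where d: "d > 0" "\<And>y. dist y x < d \<Longrightarrow> g y < g x / 2"
      unfolding eventually_nhds_metric by auto
    have "measure M {x<..x+d/2} = (LINT y|lborel. indicator {x..x+d/2} y * g y)"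
      using d by (intro Ioc atom) auto
    also have "\<dots> \<le> (LINT y|lborel. indicator {x..x+d/2} y * (g x / 2))"
      using d by (intro integral_mono gint cint) (auto simp: indicator_def dist_real_def intro!: less_imp_le)
    also have "\<dots> = d / 2 * (g x / 2)" using d by simp
    also have "\<dots> < 0" using \<open>\<not> 0 \<le> g x\<close> d by (simp add: mult_pos_neg)
    finally show False by (simp add: not_le[symmetric])
  qed
  show "0 \<le> g x" by (rule nonneg)
  let ?D = "density lborel (\<lambda>x. ennreal (g x))"
  have eq: "emeasure M {a<..a + real n} = emeasure ?D {a<..a + real n}" for a n
  proof -
    have "emeasure M {a<..a+real n} = ennreal (LINT x|lborel. indicator {a..a+real n} x * g x)"
      unfolding emeasure_eq_measure by (subst Ioc) (auto intro: atom)
    also have "\<dots> = (\<integral>\<^sup>+x. ennreal (indicator {a..a+real n} x * g x) \<partial>lborel)"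
      by (rule nn_integral_eq_integral[symmetric, OF gint]) (auto simp: nonneg)
    also have "\<dots> = (\<integral>\<^sup>+x. ennreal (g x) * indicator {a<..a+real n} x \<partial>lborel)"
    proof (rule nn_integral_cong_AE)
      show "AE x in lborel. ennreal (indicator {a..a+real n} x * g x) = ennreal (g x) * indicator {a<..a+real n} x"
        using AE_lborel_singleton[of a] by eventually_elim (auto simp: indicator_def)
    qed
    finally show ?thesis by (simp add: emeasure_density)
  qed
  have U: "{a<..} = (\<Union>n. {a<..a + real n})" for a :: real
    by (auto simp: set_eq_iff) (metis add.commute diff_le_eq real_arch_simple)
  have inc: "incseq (\<lambda>n. {a<..a + real n})" for a :: real by (auto simp: incseq_def)
  show "M = ?D"
  proof (rule measure_eqI_lessThan)
    show "emeasure M {x<..} = emeasure ?D {x<..}" for x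
      unfolding U using SUP_emeasure_incseq[OF _ inc[of x], of M] SUP_emeasure_incseq[OF _ inc[of x], of ?D] eq[of x]
      by (auto simp: image_subset_iff)
    show "emeasure M {x<..} < \<infinity>" for x by (simp add: less_top[symmetric])
  qed auto
qed


text \<open>The same for a law with a nonnegative integrable weight, after normalisation of its total
  mass.\<close>

lemma (in real_distribution) weighted_inversion:
  fixes k :: "real \<Rightarrow> real"
  assumes k: "integrable M k" "\<And>y. 0 \<le> k y" "0 < (LINT y|M. k y)"
  defines "H \<equiv> \<lambda>t. CLINT y|M. of_real (k y) * iexp (t * y)"
  assumes H: "integrable lborel H"
  shows "0 \<le> Re (fourier_inv H x)"
    and "density M (\<lambda>y. ennreal (k y)) = density lborel (\<lambda>x. ennreal (Re (fourier_inv H x)))"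
proof -
  define m where "m = (LINT y|M. k y)"
  have m: "0 < m" using k by (simp add: m_def)
  have [measurable]: "k \<in> borel_measurable borel" using k(1) by auto
  have [measurable]: "fourier_inv H \<in> borel_measurable borel"
    using continuous_fourier_inv[OF H] by (rule borel_measurable_continuous_onI)
  define N where "N = density M (\<lambda>y. ennreal (k y / m))"
  have "(\<integral>\<^sup>+y. ennreal (k y / m) \<partial>M) = ennreal (LINT y|M. k y / m)"
    using k m by (intro nn_integral_eq_integral) auto
  also have "\<dots> = 1" using m by (simp add: m_def)
  finally have "prob_space N"
    unfolding N_def by (intro prob_spaceI) (simp add: emeasure_density)
  then interpret N: real_distribution N
    by (auto simp: real_distribution_def real_distribution_axioms_def N_def)
  have char: "char N = (\<lambda>t. H t / m)"
  proof
    fix t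
    have "char N t = (CLINT y|M. (k y / m) *\<^sub>R iexp (t * y))"
      unfolding char_def N_def using k m by (subst integral_density) auto
    also have "\<dots> = (CLINT y|M. of_real (k y) * iexp (t * y) / m)"
      by (simp add: scaleR_conv_of_real)
    finally show "char N t = H t / m" by (simp add: H_def)
  qed
  have inv: "fourier_inv (char N) x = fourier_inv H x / m" for x
    unfolding fourier_inv_def char by simp
  have ci: "integrable lborel (char N)" unfolding char using H by simp
  note * = N.char_integrable_density[OF ci, unfolded inv]
  show nn: "0 \<le> Re (fourier_inv H x)" for x
    using *(1)[of x] m by (simp add: zero_le_divide_iff)
  have "density M (\<lambda>y. ennreal (k y)) = density N (\<lambda>_. ennreal m)"
    unfolding N_def using m k(2)
    by (subst density_density_eq) (auto intro!: density_cong simp: ennreal_mult[symmetric])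
  also have "\<dots> = density lborel (\<lambda>x. ennreal (Re (fourier_inv H x)))"
    using m nn by (subst *(2), subst density_density_eq)
      (auto intro!: density_cong simp: ennreal_mult[symmetric])
  finally show "density M (\<lambda>y. ennreal (k y)) = density lborel (\<lambda>x. ennreal (Re (fourier_inv H x)))" .
qed

text \<open>Turns almost everywhere equality of two densities into equality on an open set.\<close>

lemma continuous_on_eq_of_AE_eq:
  fixes f g :: "real \<Rightarrow> real"
  assumes "open S" "continuous_on S f" "continuous_on S g"
    and AE: "AE x in lborel. x \<in> S \<longrightarrow> f x = g x" and x: "x \<in> S"
  shows "f x = g x"
proof (rule ccontr)
  assume "f x \<noteq> g x"
  let ?U = "{y \<in> S. f y - g y \<noteq> 0}"
  have "?U = S \<inter> (\<lambda>y. f y - g y) -` (- {0})" by auto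
  then have "open ?U"
    using assms by (auto intro!: continuous_open_preimage continuous_intros)
  moreover have "x \<in> ?U" using x \<open>f x \<noteq> g x\<close> by auto
  ultimately obtain e where e: "e > 0" "ball x e \<subseteq> ?U"
    by (meson openE)
  have "AE y in lborel. y \<notin> ball x e"
    using AE by eventually_elim (use e in auto)
  then have "emeasure lborel (ball x e) = 0"
    by (subst (asm) AE_iff_measurable[where N = "ball x e"]) auto
  moreover have "ball x e = {x - e<..<x + e}" by (auto simp: dist_real_def)
  ultimately show False using e by simp
qed

section \<open>Laplace exponents in the right half-plane\<close>

lemma one_plus_power_le_exp:
  fixes y :: real
  assumes "0 \<le> y" "1 \<le> k"
  shows "1 + y ^ k / fact k \<le> exp y"
proof -
  have "(\<Sum>n\<in>{0,k}. inverse (fact n) *\<^sub>R y ^ n) \<le> (\<Sum>n. inverse (fact n) *\<^sub>R y ^ n)"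
    using assms summable_exp_generic[of y] by (intro sum_le_suminf) auto
  then show ?thesis using assms by (simp add: exp_def field_simps)
qed

text \<open>Compares moment kernels with the kernel of the Laplace exponent; both sides vanish at \<open>0\<close>.\<close>

lemma power_exp_neg_le:
  fixes y :: real
  assumes "0 \<le> y" "1 \<le> k"
  shows "y ^ k * exp (- y) \<le> fact k * (1 - exp (- y))"
proof -
  have "y ^ k \<le> fact k * (exp y - 1)"
    using one_plus_power_le_exp[OF assms] by (simp add: field_simps)
  then have "y ^ k * exp (- y) \<le> fact k * (exp y - 1) * exp (- y)"
    by (rule mult_right_mono) auto
  then show ?thesis by (simp add: algebra_simps flip: exp_add)
qed

lemma exp_neg_le_power:
  fixes y :: real
  assumes "0 < y"
  shows "exp (- y) \<le> fact n / y ^ n"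
proof -
  have "y ^ n / fact n \<le> exp y"
  proof (cases "n = 0")
    case False
    then show ?thesis using one_plus_power_le_exp[of y n] assms by simp
  qed (use assms in auto)
  then show ?thesis using assms by (simp add: exp_minus field_simps)
qed

lemma norm_one_minus_exp_le:
  fixes v :: complex
  assumes "0 \<le> Re v"
  shows "norm (1 - exp (- v)) \<le> norm v"
proof -
  have "norm (exp (- v) - (\<Sum>i\<le>0. exp 0 * (- v - 0) ^ i / fact i)) \<le> 1 * norm (- v - 0) ^ Suc 0 / fact 0"
  proof (rule complex_Taylor[where S = "{z. Re z \<le> 0}" and f = "\<lambda>k. exp" and n = 0])
    show "convex {z. Re z \<le> 0}" by (rule convex_halfspace_Re_le)
  qed (use assms in \<open>auto intro: DERIV_exp has_field_derivative_at_within\<close>)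
  then show ?thesis by (simp add: norm_minus_commute)
qed

text \<open>A perturbation of size \<open>1/2\<close> in the exponent keeps the real part of a positive exponential
  positive, at the cost of a constant factor.\<close>

lemma Re_exp_neg_ge:
  fixes z :: complex
  assumes "norm z \<le> 1 / 2" "0 \<le> a"
  shows "exp (- a) / 4 \<le> Re (exp (- (of_real a + z)))"
proof -
  have r: "\<bar>Re z\<bar> \<le> 1 / 2" "\<bar>Im z\<bar> \<le> 1 / 2"
    using assms abs_Re_le_cmod[of z] abs_Im_le_cmod[of z] by linarith+
  have "1 / 2 \<le> exp (- Re z)" using exp_ge_add_one_self[of "- Re z"] r by linarith
  moreover have "1 / 2 \<le> cos (Im z)"
  proof -
    have "cos (1/2 :: real) \<le> cos \<bar>Im z\<bar>"
      using r pi_gt3 by (intro cos_monotone_0_pi_le) auto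
    moreover have "(1/2 :: real) \<le> cos (1/2)"
      using cos_monotone_0_pi_le[of "1/2" "pi/3"] pi_gt3 by (simp add: cos_60)
    ultimately show ?thesis by simp
  qed
  ultimately have "1 / 2 * (1 / 2) \<le> exp (- Re z) * cos (Im z)" by (intro mult_mono) auto
  then have "exp (- a) * (1 / 2 * (1 / 2)) \<le> exp (- a) * (exp (- Re z) * cos (Im z))"
    by (rule mult_left_mono) auto
  also have "\<dots> = Re (exp (- (of_real a + z)))"
  proof -
    have "- (of_real a + z) = of_real (- a) + (- z)" by simp
    then have "exp (- (of_real a + z)) = of_real (exp (- a)) * exp (- z)"
      by (simp only: exp_add exp_of_real)
    then show ?thesis by (simp add: Re_exp)
  qed
  finally show ?thesis by simp
qed


text \<open>Differentiation under the integral sign. The constant \<open>\<kappa>\<close> is \<open>0\<close> for the Laplace transform of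
  a finite measure and \<open>1\<close> for the Laplace exponent of a Levy measure, where only the difference
  is integrable. The remainder is bounded by \<open>\<bar>h\<bar>\<^sup>2 s\<^sup>2 exp (- s Re z / 2)\<close>, so no limit
  theorem for integrals is needed.\<close>

lemma laplace_has_field_derivative:
  fixes \<mu> :: "real measure" and \<kappa> :: complex
  assumes s: "sets \<mu> = sets borel" and pos: "AE s in \<mu>. 0 \<le> s"
    and int0: "\<And>z. 0 < Re z \<Longrightarrow> integrable \<mu> (\<lambda>s. \<kappa> - exp (- (z * of_real s)))"
    and int1: "\<And>a. 0 < a \<Longrightarrow> integrable \<mu> (\<lambda>s. s * exp (- (a * s)))"
    and int2: "\<And>a. 0 < a \<Longrightarrow> integrable \<mu> (\<lambda>s. s\<^sup>2 * exp (- (a * s)))"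
    and z: "0 < Re z"
  shows "((\<lambda>z. CLINT s|\<mu>. \<kappa> - exp (- (z * of_real s))) has_field_derivative
      (CLINT s|\<mu>. of_real s * exp (- (z * of_real s)))) (at z)"
proof -
  note [measurable_cong] = s
  let ?F = "\<lambda>z. CLINT s|\<mu>. \<kappa> - exp (- (z * of_real s))"
  let ?D = "CLINT s|\<mu>. of_real s * exp (- (z * of_real s))"
  define B where "B = (LINT s|\<mu>. s\<^sup>2 * exp (- (Re z / 2 * s)))"
  have intD: "integrable \<mu> (\<lambda>s. of_real s * exp (- (z * of_real s)))"
    by (rule Bochner_Integration.integrable_bound[OF int1[OF z]])
      (auto simp: norm_mult)
  have bound: "norm (?F (z + h) - ?F z - h * ?D) \<le> (norm h)\<^sup>2 * B" if h: "norm h < Re z / 2" for h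
  proof -
    have rh: "\<bar>Re h\<bar> \<le> Re z / 2" using abs_Re_le_cmod[of h] h by linarith
    then have zh: "0 < Re (z + h)" using z by (auto simp: abs_le_iff)
    let ?q = "\<lambda>s. (\<kappa> - exp (- ((z + h) * of_real s))) - (\<kappa> - exp (- (z * of_real s))) - h * (of_real s * exp (- (z * of_real s)))"
    have inth: "integrable \<mu> (\<lambda>s. h * (of_real s * exp (- (z * of_real s))))"
      using intD by simp
    note intq = Bochner_Integration.integrable_diff[OF
        Bochner_Integration.integrable_diff[OF int0[OF zh] int0[OF z]] inth]
    have eq: "?F (z + h) - ?F z - h * ?D = (CLINT s|\<mu>. ?q s)"
      using int0[OF z] int0[OF zh] intD
      by (simp only: Bochner_Integration.integral_diff Bochner_Integration.integrable_diff
          integrable_mult_right Bochner_Integration.integral_mult_right)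
    have "norm (?F (z + h) - ?F z - h * ?D) \<le> (LINT s|\<mu>. norm (?q s))"
      unfolding eq by (rule integral_norm_bound)
    also have "\<dots> \<le> (LINT s|\<mu>. (norm h)\<^sup>2 * (s\<^sup>2 * exp (- (Re z / 2 * s))))"
    proof (rule integral_mono_AE)
      show "integrable \<mu> (\<lambda>s. norm (?q s))"
        by (rule integrable_norm[OF intq])
      show "integrable \<mu> (\<lambda>s. (norm h)\<^sup>2 * (s\<^sup>2 * exp (- (Re z / 2 * s))))"
        using int2[of "Re z / 2"] z by auto
      show "AE s in \<mu>. norm (?q s) \<le> (norm h)\<^sup>2 * (s\<^sup>2 * exp (- (Re z / 2 * s)))"
        using pos
      proof eventually_elim
        case (elim s)
        have "?q s = - exp (- (z * s)) * (exp (- (h * s)) - (1 + - (h * s)))"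
          by (simp add: algebra_simps exp_add[symmetric])
        then have "norm (?q s) = exp (- (Re z * s)) * norm (exp (- (h * s)) - (1 + - (h * s)))"
          by (simp add: norm_mult)
        also have "\<dots> \<le> exp (- (Re z * s)) * (exp (\<bar>Re h\<bar> * s) * (norm h * s)\<^sup>2)"
          using Taylor_exp[of "- (h * s)" 1] elim
          by (intro mult_left_mono) (auto simp: norm_mult abs_mult power2_eq_square)
        also have "\<dots> = exp (- (Re z * s) + \<bar>Re h\<bar> * s) * (norm h * s)\<^sup>2"
          by (simp only: exp_add mult.assoc)
        also have "\<dots> \<le> exp (- (Re z / 2 * s)) * (norm h * s)\<^sup>2"
        proof -
          have "\<bar>Re h\<bar> * s \<le> Re z / 2 * s" using rh elim by (rule mult_right_mono)
          then show ?thesis by (intro mult_right_mono) (auto simp: field_simps)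
        qed
        finally show ?case by (simp add: power_mult_distrib mult_ac)
      qed
    qed
    finally show ?thesis by (simp add: B_def)
  qed
  have "(\<lambda>h. (?F (z + h) - ?F z) / h - ?D) \<midarrow>0\<rightarrow> 0"
  proof (rule Lim_null_comparison)
    show "\<forall>\<^sub>F h in at 0. norm ((?F (z + h) - ?F z) / h - ?D) \<le> norm h * B"
      unfolding eventually_at
    proof (intro exI[of _ "Re z / 2"] conjI ballI impI)
      fix h :: complex assume h: "h \<noteq> 0 \<and> dist h 0 < Re z / 2"
      have "norm ((?F (z + h) - ?F z) / h - ?D) = norm ((?F (z + h) - ?F z - h * ?D) / h)"
        using h by (simp add: diff_divide_distrib)
      also have "\<dots> \<le> (norm h)\<^sup>2 * B / norm h"
        unfolding norm_divide using bound[of h] h by (intro divide_right_mono) auto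
      also have "\<dots> = norm h * B" using h by (simp add: power2_eq_square)
      finally show "norm ((?F (z + h) - ?F z) / h - ?D) \<le> norm h * B" .
    qed (use z in auto)
    show "((\<lambda>h::complex. norm h * B) \<longlongrightarrow> 0) (at 0)"
      by (auto intro!: tendsto_eq_intros)
  qed
  then show ?thesis unfolding DERIV_def by (rule LIM_zero_cancel)
qed

text \<open>A Levy measure of a subordinator, regarded as a measure on the reals concentrated on
  \<open>(0,\<infinity>)\<close>.\<close>

locale levy_measure =
  fixes \<nu> :: "real measure"
  assumes sets_nu[measurable_cong]: "sets \<nu> = sets borel"
    and pos: "AE s in \<nu>. 0 < s"
    and integrable_min: "integrable \<nu> (\<lambda>s. min 1 s)"
begin

text \<open>The Laplace exponent without drift.\<close>

definition phi :: "real \<Rightarrow> real" where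
  "phi u = (LINT s|\<nu>. 1 - exp (- (u * s)))"

text \<open>Exponentially tilted moments of the Levy measure; up to sign, \<open>mom k\<close> is the \<open>k\<close>-th derivative
  of \<open>phi\<close> for \<open>k \<ge> 1\<close>.\<close>

definition mom :: "nat \<Rightarrow> real \<Rightarrow> real" where
  "mom k u = (LINT s|\<nu>. s ^ k * exp (- (u * s)))"

text \<open>The extension of the Laplace exponent to the right half-plane.\<close>

definition cphi :: "complex \<Rightarrow> complex" where
  "cphi z = (CLINT s|\<nu>. 1 - exp (- (z * of_real s)))"

text \<open>The complex derivative of \<open>cphi\<close> in the right half-plane.\<close>

definition cphi' :: "complex \<Rightarrow> complex" where
  "cphi' z = (CLINT s|\<nu>. of_real s * exp (- (z * of_real s)))"

lemma integrable_phi: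
  assumes "0 \<le> u"
  shows "integrable \<nu> (\<lambda>s. 1 - exp (- (u * s)))"
proof (rule Bochner_Integration.integrable_bound[OF integrable_mult_right[OF integrable_min, of "max 1 u"]])
  show "AE s in \<nu>. norm (1 - exp (- (u * s))) \<le> norm (max 1 u * min 1 s)"
    using pos
  proof eventually_elim
    case (elim s)
    have 1: "1 - exp (- (u * s)) \<le> u * s" using exp_ge_add_one_self[of "- (u * s)"] by linarith
    have 2: "0 \<le> 1 - exp (- (u * s))" using elim assms by simp
    have 3: "u * s \<le> max 1 u * s" using elim by (intro mult_right_mono) auto
    have "1 - exp (- (u * s)) \<le> max 1 u * min 1 s"
    proof (cases "s \<le> 1")
      case False
      have "1 - exp (- (u * s)) \<le> 1" by simp
      then show ?thesis using False by (simp add: min_def le_max_iff_disj)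
    qed (use 1 3 in \<open>simp add: min_def\<close>)
    then show ?case using 2 by simp
  qed
qed measurable

lemma integrable_mom:
  assumes "0 < u" "1 \<le> k"
  shows "integrable \<nu> (\<lambda>s. s ^ k * exp (- (u * s)))"
proof (rule Bochner_Integration.integrable_bound)
  show "integrable \<nu> (\<lambda>s. fact k / u ^ k * (1 - exp (- (u * s))))"
    using assms by (intro integrable_mult_right integrable_phi) auto
  show "AE s in \<nu>. norm (s ^ k * exp (- (u * s))) \<le> norm (fact k / u ^ k * (1 - exp (- (u * s))))"
    using pos
  proof eventually_elim
    case (elim s)
    have "(u * s) ^ k * exp (- (u * s)) \<le> fact k * (1 - exp (- (u * s)))"
      using elim assms by (intro power_exp_neg_le) auto
    then have "s ^ k * exp (- (u * s)) \<le> fact k / u ^ k * (1 - exp (- (u * s)))"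
      using assms by (simp add: field_simps power_mult_distrib)
    moreover have "0 \<le> s ^ k * exp (- (u * s))" using elim by simp
    ultimately show ?case by (simp only: real_norm_def abs_of_nonneg order.trans[of 0])
  qed
qed (use assms in auto)

lemma mom_le:
  assumes "0 < u" "1 \<le> k"
  shows "u ^ k * mom k u \<le> fact k * phi u"
proof -
  have "u ^ k * mom k u = (LINT s|\<nu>. (u * s) ^ k * exp (- (u * s)))"
    by (simp add: mom_def power_mult_distrib mult.assoc)
  also have "\<dots> \<le> (LINT s|\<nu>. fact k * (1 - exp (- (u * s))))"
  proof (rule integral_mono_AE)
    show "integrable \<nu> (\<lambda>s. (u * s) ^ k * exp (- (u * s)))"
      using integrable_mult_right[OF integrable_mom[OF assms], of "u ^ k"]
      by (simp add: power_mult_distrib mult.assoc)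
    show "AE s in \<nu>. (u * s) ^ k * exp (- (u * s)) \<le> fact k * (1 - exp (- (u * s)))"
      using pos by eventually_elim (use assms in \<open>auto intro: power_exp_neg_le\<close>)
  qed (use assms integrable_phi in auto)
  finally show ?thesis by (simp add: phi_def)
qed

lemma phi_nonneg: "0 \<le> u \<Longrightarrow> 0 \<le> phi u"
  unfolding phi_def by (rule integral_nonneg_AE) (use pos in \<open>eventually_elim, auto\<close>)

lemma mom_nonneg: "0 \<le> mom k u"
  unfolding mom_def by (rule integral_nonneg_AE) (use pos in \<open>eventually_elim, auto\<close>)

lemma phi_mono:
  assumes "0 \<le> u" "u \<le> v"
  shows "phi u \<le> phi v"
  unfolding phi_def
proof (rule integral_mono_AE)
  show "AE s in \<nu>. 1 - exp (- (u * s)) \<le> 1 - exp (- (v * s))"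
    using pos by eventually_elim (use assms in \<open>auto intro: mult_right_mono\<close>)
qed (use assms in \<open>auto intro!: integrable_phi\<close>)

lemma phi_mult_le:
  assumes "0 \<le> u" "1 \<le> r"
  shows "phi (r * u) \<le> r * phi u"
proof -
  have "phi (r * u) \<le> (LINT s|\<nu>. r * (1 - exp (- (u * s))))"
    unfolding phi_def
  proof (rule integral_mono_AE)
    show "AE s in \<nu>. 1 - exp (- (r * u * s)) \<le> r * (1 - exp (- (u * s)))"
      using pos
    proof eventually_elim
      case (elim s)
      have "exp ((1 - 1 / r) *\<^sub>R 0 + (1 / r) *\<^sub>R (- (r * u * s)))
          \<le> (1 - 1 / r) * exp 0 + (1 / r) * exp (- (r * u * s))"
        using assms by (intro convex_onD[OF exp_convex]) auto
      then have "exp (- (u * s)) \<le> (1 - 1 / r) + (1 / r) * exp (- (r * u * s))"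
        using assms by (simp add: mult.assoc)
      then have "r * exp (- (u * s)) \<le> r * ((1 - 1 / r) + (1 / r) * exp (- (r * u * s)))"
        using assms by (intro mult_left_mono) auto
      also have "\<dots> = r - 1 + exp (- (r * u * s))" using assms by (simp add: distrib_left right_diff_distrib)
      finally show ?case by (simp add: right_diff_distrib)
    qed
  qed (use assms in \<open>auto intro!: integrable_phi\<close>)
  then show ?thesis by (simp add: phi_def)
qed

lemma integrable_cphi:
  assumes "0 < Re z"
  shows "integrable \<nu> (\<lambda>s. 1 - exp (- (z * of_real s)))"
proof (rule Bochner_Integration.integrable_bound[OF integrable_mult_right[OF integrable_min, of "max 2 (norm z)"]])
  show "AE s in \<nu>. norm (1 - exp (- (z * of_real s))) \<le> norm (max 2 (norm z) * min 1 s)"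
    using pos
  proof eventually_elim
    case (elim s)
    have 1: "norm (1 - exp (- (z * of_real s))) \<le> norm z * s"
      using norm_one_minus_exp_le[of "z * of_real s"] elim assms by (simp add: norm_mult)
    have "norm (1 - exp (- (z * of_real s))) \<le> norm (1::complex) + norm (exp (- (z * of_real s)))"
      by (rule norm_triangle_ineq4)
    then have 2: "norm (1 - exp (- (z * of_real s))) \<le> 2"
      using elim assms by (auto intro: order.trans)
    have 3: "norm z * s \<le> max 2 (norm z) * s" using elim by (intro mult_right_mono) auto
    have "norm (1 - exp (- (z * of_real s))) \<le> max 2 (norm z) * min 1 s"
      using 1 2 3 by (cases "s \<le> 1") (auto simp: min_def)
    then show ?case using elim by (simp add: abs_mult)
  qed
qed measurable

lemma cphi_has_field_derivative:
  assumes "0 < Re z"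
  shows "(cphi has_field_derivative cphi' z) (at z)"
  unfolding cphi_def[abs_def] cphi'_def
proof (rule laplace_has_field_derivative)
  show "integrable \<nu> (\<lambda>s. s * exp (- (a * s)))" if "0 < a" for a
    using integrable_mom[OF that, of 1] by simp
  show "integrable \<nu> (\<lambda>s. s\<^sup>2 * exp (- (a * s)))" if "0 < a" for a
    using integrable_mom[OF that, of 2] by simp
  show "AE s in \<nu>. 0 \<le> s" using pos by eventually_elim simp
qed (use assms sets_nu integrable_cphi in auto)

lemma cphi_of_real: "cphi (of_real u) = of_real (phi u)"
  unfolding cphi_def phi_def integral_complex_of_real[symmetric]
  by (rule Bochner_Integration.integral_cong) (auto simp flip: exp_of_real of_real_mult of_real_minus)

lemma norm_cphi'_le: "norm (cphi' z) \<le> mom 1 (Re z)"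
  unfolding cphi'_def mom_def
proof (rule order.trans[OF integral_norm_bound])
  have "(LINT s|\<nu>. norm (of_real s * exp (- (z * of_real s)))) = (LINT s|\<nu>. s ^ 1 * exp (- (Re z * s)))"
    by (rule integral_cong_AE) (use pos in \<open>auto simp: norm_mult elim!: eventually_mono\<close>)
  then show "(LINT s|\<nu>. norm (of_real s * exp (- (z * of_real s)))) \<le> (LINT s|\<nu>. s ^ 1 * exp (- (Re z * s)))"
    by simp
qed

lemma Re_cphi:
  assumes "0 < u"
  shows "Re (cphi (Complex u \<xi>)) = phi u + (LINT s|\<nu>. (1 - cos (\<xi> * s)) * exp (- (u * s)))"
    and "integrable \<nu> (\<lambda>s. (1 - cos (\<xi> * s)) * exp (- (u * s)))"
proof -
  have i: "integrable \<nu> (\<lambda>s. Re (1 - exp (- (Complex u \<xi> * of_real s))))"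
    using integrable_cphi[of "Complex u \<xi>"] assms by (intro integrable_Re) auto
  have e: "Re (1 - exp (- (Complex u \<xi> * of_real s))) - (1 - exp (- (u * s))) = (1 - cos (\<xi> * s)) * exp (- (u * s))" for s
    by (simp add: Re_exp algebra_simps)
  show "integrable \<nu> (\<lambda>s. (1 - cos (\<xi> * s)) * exp (- (u * s)))"
    using Bochner_Integration.integrable_diff[OF i integrable_phi[of u]] assms unfolding e by simp
  have "Re (cphi (Complex u \<xi>)) = (LINT s|\<nu>. Re (1 - exp (- (Complex u \<xi> * of_real s))))"
    unfolding cphi_def using assms by (intro integral_Re[symmetric] integrable_cphi) auto
  also have "\<dots> - phi u = (LINT s|\<nu>. (1 - cos (\<xi> * s)) * exp (- (u * s)))"
    unfolding phi_def e[symmetric] using assms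
    by (intro Bochner_Integration.integral_diff[symmetric] i integrable_phi) auto
  finally have "Re (cphi (Complex u \<xi>)) - phi u = (LINT s|\<nu>. (1 - cos (\<xi> * s)) * exp (- (u * s)))" .
  then show "Re (cphi (Complex u \<xi>)) = phi u + (LINT s|\<nu>. (1 - cos (\<xi> * s)) * exp (- (u * s)))"
    by simp
qed

end

section \<open>Consequences of the scaling conditions\<close>

lemma one_minus_cos_ge:
  fixes y :: real
  assumes "\<bar>y\<bar> \<le> 1"
  shows "y\<^sup>2 / 4 \<le> 1 - cos y"
proof -
  let ?T = "\<Sum>k\<le>3. (\<i> * y) ^ k / fact k"
  have "\<bar>Re (iexp y - ?T)\<bar> \<le> \<bar>y\<bar> ^ Suc 3 / fact (Suc 3)"
    using abs_Re_le_cmod iexp_approx1 by (rule order.trans)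
  moreover have "?T = 1 + \<i> * y - of_real (y\<^sup>2 / 2) - \<i> * of_real (y ^ 3 / 6)"
    by (simp add: eval_nat_numeral algebra_simps power_mult_distrib fact_numeral) 
  ultimately have "\<bar>cos y - (1 - y\<^sup>2 / 2)\<bar> \<le> y ^ 4 / 24"
    by (simp add: Re_exp fact_numeral power_even_abs)
  moreover have "y ^ 4 \<le> y\<^sup>2"
  proof -
    have "y\<^sup>2 * y\<^sup>2 \<le> 1 * y\<^sup>2"
      using assms by (intro mult_right_mono) (auto simp: abs_square_le_1)
    then show ?thesis by (simp add: power_add[symmetric])
  qed
  ultimately show ?thesis unfolding abs_le_iff by linarith
qed

lemma one_minus_exp_neg_ge:
  fixes y :: real
  assumes "0 \<le> y"
  shows "y / (1 + y) \<le> 1 - exp (- y)"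
proof -
  have "exp (- y) \<le> 1 / (1 + y)"
    using assms exp_ge_add_one_self[of y] by (simp add: exp_minus divide_simps)
  then show ?thesis using assms by (simp add: field_simps)
qed

lemma min_le_one_minus_exp_neg:
  fixes y :: real
  assumes "0 \<le> y"
  shows "min 1 y \<le> 2 * (1 - exp (- y))"
proof -
  have "min 1 y * (1 + y) \<le> 2 * y"
    using assms mult_left_mono[of y 1 y] by (auto simp: min_def algebra_simps)
  then have "min 1 y \<le> 2 * (y / (1 + y))"
    using assms by (simp add: pos_le_divide_eq)
  also have "\<dots> \<le> 2 * (1 - exp (- y))"
    by (rule mult_left_mono[OF one_minus_exp_neg_ge[OF assms]]) simp
  finally show ?thesis .
qed

context levy_measure
begin

text \<open>The second moment of the small jumps at scale \<open>1/u\<close>, in units of that scale.\<close>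

definition trunc :: "real \<Rightarrow> real" where
  "trunc u = (LINT s|\<nu>. indicator {..1/u} s * (u * s)\<^sup>2)"

lemma integrable_trunc:
  assumes "0 < u"
  shows "integrable \<nu> (\<lambda>s. indicator {..1/u} s * (u * s)\<^sup>2)"
proof (rule Bochner_Integration.integrable_bound)
  show "integrable \<nu> (\<lambda>s. exp 1 * u\<^sup>2 * (s ^ 2 * exp (- (u * s))))"
    using assms by (intro integrable_mult_right integrable_mom) auto
  show "AE s in \<nu>. norm (indicator {..1/u} s * (u * s)\<^sup>2) \<le> norm (exp 1 * u\<^sup>2 * (s ^ 2 * exp (- (u * s))))"
  proof (rule AE_I2)
    fix s
    show "norm (indicator {..1/u} s * (u * s)\<^sup>2) \<le> norm (exp 1 * u\<^sup>2 * (s ^ 2 * exp (- (u * s))))"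
    proof (cases "s \<le> 1 / u")
      case True
      then have "u * s \<le> 1" using assms by (simp add: field_simps)
      then have "1 \<le> exp (1 - u * s)" by simp
      then have "(u * s)\<^sup>2 * 1 \<le> (u * s)\<^sup>2 * exp (1 - u * s)"
        by (intro mult_left_mono) auto
      also have "\<dots> = exp 1 * u\<^sup>2 * (s ^ 2 * exp (- (u * s)))"
        by (simp add: exp_diff exp_minus power_mult_distrib divide_inverse mult_ac)
      finally show ?thesis using True by simp
    qed simp
  qed
qed measurable

lemma trunc_le_integral:
  assumes f: "integrable \<nu> f" and u: "0 < u"
    and nonneg: "\<And>s. 0 < s \<Longrightarrow> 0 \<le> f s"
    and le: "\<And>s. 0 < s \<Longrightarrow> u * s \<le> 1 \<Longrightarrow> (u * s)\<^sup>2 \<le> f s"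
  shows "trunc u \<le> (LINT s|\<nu>. f s)"
  unfolding trunc_def
proof (rule integral_mono_AE)
  show "AE s in \<nu>. indicator {..1/u} s * (u * s)\<^sup>2 \<le> f s"
    using pos
  proof eventually_elim
    case (elim s)
    show ?case
      using nonneg[OF elim] le[OF elim] u by (cases "s \<le> 1 / u") (auto simp: field_simps)
  qed
qed (use f integrable_trunc[OF u] in auto)

lemma trunc_le_mom:
  assumes u: "0 < u"
  shows "trunc u \<le> exp 1 * (u * mom 1 u)"
proof -
  have "trunc u \<le> (LINT s|\<nu>. exp 1 * u * (s ^ 1 * exp (- (u * s))))"
  proof (rule trunc_le_integral)
    show "integrable \<nu> (\<lambda>s. exp 1 * u * (s ^ 1 * exp (- (u * s))))"
      using assms by (intro integrable_mult_right integrable_mom) auto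
    fix s :: real assume s: "0 < s" "u * s \<le> 1"
    have "(u * s)\<^sup>2 \<le> u * s * 1"
      unfolding power2_eq_square using s u by (intro mult_left_mono) auto
    also have "\<dots> \<le> u * s * exp (1 - u * s)"
      using s u by (intro mult_left_mono) auto
    also have "\<dots> = exp 1 * u * (s ^ 1 * exp (- (u * s)))"
      by (simp add: exp_diff exp_minus divide_inverse mult_ac)
    finally show "(u * s)\<^sup>2 \<le> exp 1 * u * (s ^ 1 * exp (- (u * s)))" .
  qed (use u in auto)
  then show ?thesis by (simp add: mom_def mult.assoc)
qed

text \<open>For \<open>s \<le> 1/v\<close> the factor \<open>exp (- u s)\<close> is bounded below and \<open>1 - cos (\<xi> s)\<close> is comparable to
  \<open>(\<xi> s)\<^sup>2\<close>.\<close>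

lemma trunc_le_Re_cphi:
  assumes u: "0 < u" and v: "u \<le> v" "\<bar>\<xi>\<bar> \<le> v"
  shows "(\<xi> / v)\<^sup>2 * trunc v \<le> 4 * exp 1 * (Re (cphi (Complex u \<xi>)) - phi u)"
proof (cases "\<xi> = 0")
  case True
  then show ?thesis by (simp add: Re_cphi[OF u])
next
  case False
  have v0: "0 < v" using u v by linarith
  define k where "k = (v / \<xi>)\<^sup>2 * (4 * exp 1)"
  have k: "0 < k" using False v0 by (simp add: k_def)
  have "trunc v \<le> (LINT s|\<nu>. k * ((1 - cos (\<xi> * s)) * exp (- (u * s))))"
  proof (rule trunc_le_integral)
    show "integrable \<nu> (\<lambda>s. k * ((1 - cos (\<xi> * s)) * exp (- (u * s))))"
      by (intro integrable_mult_right Re_cphi(2) u)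
    show "0 \<le> k * ((1 - cos (\<xi> * s)) * exp (- (u * s)))" for s
      using k by (intro mult_nonneg_nonneg) auto
    fix s :: real assume s: "0 < s" "v * s \<le> 1"
    have "\<bar>\<xi>\<bar> * s \<le> v * s" "u * s \<le> v * s" using v s by (simp_all add: mult_right_mono)
    then have "\<bar>\<xi>\<bar> * s \<le> 1" and le1: "u * s \<le> 1" using s by linarith+
    then have le2: "\<bar>\<xi> * s\<bar> \<le> 1" using s by (simp add: abs_mult)
    have "(v * s)\<^sup>2 = (v / \<xi>)\<^sup>2 * 4 * ((\<xi> * s)\<^sup>2 / 4 * 1)"
      using False by (simp add: power_mult_distrib power_divide)
    also have "\<dots> \<le> (v / \<xi>)\<^sup>2 * 4 * ((1 - cos (\<xi> * s)) * exp (1 - u * s))"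
      using le1 one_minus_cos_ge[OF le2] by (intro mult_left_mono mult_mono) auto
    also have "\<dots> = k * ((1 - cos (\<xi> * s)) * exp (- (u * s)))"
      by (simp add: k_def exp_diff exp_minus divide_inverse mult_ac)
    finally show "(v * s)\<^sup>2 \<le> k * ((1 - cos (\<xi> * s)) * exp (- (u * s)))" .
  qed (use v0 in auto)
  also have "\<dots> = k * (Re (cphi (Complex u \<xi>)) - phi u)" by (simp add: Re_cphi[OF u])
  finally have "(\<xi> / v)\<^sup>2 * trunc v \<le> (\<xi> / v)\<^sup>2 * (k * (Re (cphi (Complex u \<xi>)) - phi u))"
    by (rule mult_left_mono) auto
  also have "(\<xi> / v)\<^sup>2 * (k * (Re (cphi (Complex u \<xi>)) - phi u)) = 4 * exp 1 * (Re (cphi (Complex u \<xi>)) - phi u)"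
    using False v0 by (simp add: k_def power_divide)
  finally show ?thesis .
qed

end

text \<open>Weak lower and upper scaling of the Laplace exponent on \<open>(x0,\<infinity>)\<close>.\<close>

locale scaled_levy_measure = levy_measure \<nu> for \<nu> +
  fixes \<alpha> \<beta> c C x0 :: real
  assumes params: "0 < c" "c \<le> 1" "1 \<le> C" "0 \<le> x0" "0 < \<alpha>" "\<beta> < 1"
    and lower: "1 \<le> r \<Longrightarrow> x0 < x \<Longrightarrow> c * r powr \<alpha> * phi x \<le> phi (r * x)"
    and upper: "1 \<le> r \<Longrightarrow> x0 < x \<Longrightarrow> phi (r * x) \<le> C * r powr \<beta> * phi x"
    and phi_pos: "0 < u \<Longrightarrow> 0 < phi u"
begin

text \<open>The key consequence of the scaling conditions. For large \<open>L\<close>, upper scaling with \<open>\<beta> < 1\<close>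
  makes \<open>phi v - phi (L v) / L\<close> at least half of \<open>phi v\<close>. This difference is an
  integral of a kernel of quadratic order at \<open>0\<close>, whose contribution from \<open>s > 1/u\<close> is at most
  \<open>2 phi u\<close>. For \<open>v = R u\<close> with large \<open>R\<close>, lower scaling makes that contribution negligible.
  Working at \<open>R u\<close> rather than at \<open>u\<close> keeps all arguments above \<open>x0\<close>.\<close>

lemma trunc_ge: "\<exists>k>0. \<forall>u>x0. k * phi u \<le> trunc u"
proof -
  \<comment> \<open>\<open>L\<close> solves \<open>C L powr (\<beta> - 1) = 1/2\<close> and \<open>R\<close> solves \<open>c R powr \<alpha> = 8\<close>.\<close>
  define L where "L = (2 * C) powr (1 / (1 - \<beta>))"
  define R where "R = (8 / c) powr (1 / \<alpha>)"
  have L: "1 \<le> L" unfolding L_def using params by (intro ge_one_powr_ge_zero) auto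
  have R: "1 \<le> R" unfolding R_def using params by (intro ge_one_powr_ge_zero) auto
  have "(\<beta> - 1) / (1 - \<beta>) = -1" using params by (simp add: divide_eq_eq)
  then have "L powr (\<beta> - 1) = (2 * C) powr (- 1)"
    unfolding L_def powr_powr by simp
  then have "L powr \<beta> / L = (2 * C) powr (- 1)" using L by (simp add: powr_diff)
  then have LC: "C * L powr \<beta> / L = 1 / 2" using params by (simp add: powr_minus field_simps)
  have RC: "c * R powr \<alpha> = 8" using params by (simp add: R_def powr_powr)
  let ?k = "1 / (4 * L * R\<^sup>2)"
  have "?k * phi u \<le> trunc u" if u: "x0 < u" for u
  proof -
    have u0: "0 < u" using u params by linarith
    define v where "v = R * u"
    have "u \<le> v" using mult_right_mono[of 1 R u] R u0 by (simp add: v_def)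
    with u0 u have v: "u \<le> v" "0 < v" "x0 < v" by linarith+
    have phiv: "8 * phi u \<le> phi v" using lower[OF R u] unfolding RC v_def .
    define h where "h = (\<lambda>s. (1 - exp (- (v * s))) - (1 - exp (- (L * v * s))) / L)"
    have ih: "integrable \<nu> h"
      unfolding h_def using v L by (intro Bochner_Integration.integrable_diff integrable_divide integrable_phi) auto
    have "phi v / 2 = phi v - C * L powr \<beta> * phi v / L" using LC L by (simp add: field_simps)
    also have "\<dots> \<le> phi v - phi (L * v) / L"
      using upper[OF L v(3)] L by (intro diff_left_mono divide_right_mono) auto
    also have "\<dots> = (LINT s|\<nu>. h s)"
      unfolding h_def phi_def using v L
      by (subst Bochner_Integration.integral_diff) (auto intro!: integrable_phi integrable_divide)
    also have "\<dots> \<le> (LINT s|\<nu>. L * R\<^sup>2 * (indicator {..1/u} s * (u * s)\<^sup>2) + 2 * (1 - exp (- (u * s))))"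
    proof (rule integral_mono_AE[OF ih])
      show "integrable \<nu> (\<lambda>s. L * R\<^sup>2 * (indicator {..1/u} s * (u * s)\<^sup>2) + 2 * (1 - exp (- (u * s))))"
        using u0 by (intro Bochner_Integration.integrable_add integrable_mult_right integrable_trunc integrable_phi) auto
      show "AE s in \<nu>. h s \<le> L * R\<^sup>2 * (indicator {..1/u} s * (u * s)\<^sup>2) + 2 * (1 - exp (- (u * s)))"
        using pos
      proof eventually_elim
        case (elim s)
        have nn: "0 \<le> 1 - exp (- (u * s))" "0 \<le> (1 - exp (- (L * v * s))) / L"
          using elim u0 v L by auto
        show ?case
        proof (cases "s \<le> 1 / u")
          case True
          define r where "r = v * s"
          have r: "0 \<le> r" using v elim by (simp add: r_def)
          have Lr: "0 \<le> L * r" using r L by simp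
          have "(L * r - (L * r)\<^sup>2) * (1 + L * r) = L * r - (L * r) ^ 3"
            by (simp add: algebra_simps power2_eq_square power3_eq_cube)
          also have "\<dots> \<le> L * r" using Lr by simp
          finally have "L * r - (L * r)\<^sup>2 \<le> L * r / (1 + L * r)"
            using Lr by (simp add: pos_le_divide_eq)
          also have "\<dots> \<le> 1 - exp (- (L * r))" by (rule one_minus_exp_neg_ge[OF Lr])
          finally have "(L * r - (L * r)\<^sup>2) / L \<le> (1 - exp (- (L * r))) / L"
            using L by (intro divide_right_mono) auto
          moreover have "(L * r - (L * r)\<^sup>2) / L = r - L * r\<^sup>2"
            using L by (simp add: field_simps power2_eq_square)
          moreover have "1 - exp (- r) \<le> r" using exp_ge_add_one_self[of "- r"] by linarith
          ultimately have "h s \<le> L * r\<^sup>2" unfolding h_def r_def by (simp add: mult.assoc)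
          also have "\<dots> = L * R\<^sup>2 * (u * s)\<^sup>2" by (simp add: r_def v_def power_mult_distrib)
          finally have "h s \<le> L * R\<^sup>2 * (indicator {..1/u} s * (u * s)\<^sup>2)" using True by simp
          then show ?thesis by (rule add_increasing2[rotated]) (use nn(1) in simp)
        next
          case False
          then have "1 \<le> u * s" using u0 by (simp add: field_simps)
          then have "1 \<le> 2 * (1 - exp (- (u * s)))"
            using min_le_one_minus_exp_neg[of "u * s"] by (simp add: min_def split: if_splits)
          moreover have "h s \<le> 1" using nn(2) unfolding h_def by (smt (verit) exp_gt_zero)
          ultimately show ?thesis using False by simp
        qed
      qed
    qed
    also have "\<dots> = L * R\<^sup>2 * trunc u + 2 * phi u"
      unfolding trunc_def phi_def
      using integrable_mult_right[OF integrable_trunc[OF u0], of "L * R\<^sup>2"]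
        integrable_mult_right[OF integrable_phi[of u], of 2] u0
      by (simp only: Bochner_Integration.integral_add Bochner_Integration.integral_mult_right_zero less_imp_le simp_thms)
    finally have "phi v / 2 \<le> L * R\<^sup>2 * trunc u + 2 * phi u" .
    moreover have "phi u \<le> phi v" using v u0 by (intro phi_mono) auto
    ultimately have "phi u \<le> 4 * L * R\<^sup>2 * trunc u" using phiv by linarith
    then show ?thesis using L R by (simp add: field_simps)
  qed
  moreover have "0 < ?k" using L R by simp
  ultimately show ?thesis by blast
qed


lemma mom_ge: "\<exists>k>0. \<forall>u>x0. k * phi u \<le> u * mom 1 u"
proof -
  obtain k where k: "k > 0" "\<And>u. x0 < u \<Longrightarrow> k * phi u \<le> trunc u" using trunc_ge by auto
  have "k / exp 1 * phi u \<le> u * mom 1 u" if "x0 < u" for u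
    using k(2)[OF that] trunc_le_mom[of u] that params by (simp add: field_simps)
  then show ?thesis using k(1) by (intro exI[of _ "k / exp 1"]) auto
qed

lemma mom_pos:
  assumes "x0 < u"
  shows "0 < mom 1 u"
proof -
  have u: "0 < u" using assms params by linarith
  obtain k where "k > 0" "k * phi u \<le> u * mom 1 u" using mom_ge assms by auto
  then have "0 < u * mom 1 u" using phi_pos[OF u] by (meson mult_pos_pos less_le_trans)
  then show ?thesis using u by (simp add: zero_less_mult_iff)
qed

lemma Re_cphi_ge:
  "\<exists>k>0. \<forall>u>x0. \<forall>v\<ge>u. \<forall>\<xi>. \<bar>\<xi>\<bar> \<le> v \<longrightarrow> phi u + k * (\<xi> / v)\<^sup>2 * phi v \<le> Re (cphi (Complex u \<xi>))"
proof -
  obtain k where k: "k > 0" "\<And>u. x0 < u \<Longrightarrow> k * phi u \<le> trunc u" using trunc_ge by auto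
  have "phi u + k / (4 * exp 1) * (\<xi> / v)\<^sup>2 * phi v \<le> Re (cphi (Complex u \<xi>))"
    if "x0 < u" "u \<le> v" "\<bar>\<xi>\<bar> \<le> v" for u v \<xi>
  proof -
    have "(\<xi> / v)\<^sup>2 * (k * phi v) \<le> (\<xi> / v)\<^sup>2 * trunc v"
      using that by (intro mult_left_mono k) auto
    also have "\<dots> \<le> 4 * exp 1 * (Re (cphi (Complex u \<xi>)) - phi u)"
      using that params by (intro trunc_le_Re_cphi) auto
    finally have "(\<xi> / v)\<^sup>2 * (k * phi v) / (4 * exp 1) \<le> Re (cphi (Complex u \<xi>)) - phi u"
      by (simp add: pos_divide_le_eq mult_ac)
    then show ?thesis by (simp add: mult_ac)
  qed
  then show ?thesis using k(1) by (intro exI[of _ "k / (4 * exp 1)"]) auto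
qed

lemma Re_cphi_ge_phi: "0 < u \<Longrightarrow> phi u \<le> Re (cphi (Complex u \<xi>))"
proof -
  assume u: "0 < u"
  have "0 \<le> (LINT s|\<nu>. (1 - cos (\<xi> * s)) * exp (- (u * s)))"
    by (rule Bochner_Integration.integral_nonneg) (auto intro!: mult_nonneg_nonneg)
  then show ?thesis using Re_cphi(1)[OF u] by simp
qed

text \<open>Decay of the tilted characteristic functions: at least like \<open>\<xi>\<^sup>-\<^sup>2\<close>, with a constant that is small
  when \<open>t phi u\<close> is large. The exponent \<open>n\<close> only needs to satisfy \<open>n \<alpha> \<ge> 2\<close>.\<close>

lemma exp_neg_Re_cphi_le:
  "\<exists>K>0. \<exists>n\<ge>1. \<forall>u>x0. \<forall>t>0. \<forall>\<xi>. \<xi> \<noteq> 0 \<longrightarrow>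
     exp (- (t * (Re (cphi (Complex u \<xi>)) - phi u)))
       \<le> K * (1 / (t * phi u) + 1 / (t * phi u) ^ n) / (\<xi> / u)\<^sup>2"
proof -
  obtain k where k: "k > 0" "\<And>u v \<xi>. x0 < u \<Longrightarrow> u \<le> v \<Longrightarrow> \<bar>\<xi>\<bar> \<le> v \<Longrightarrow>
      phi u + k * (\<xi> / v)\<^sup>2 * phi v \<le> Re (cphi (Complex u \<xi>))" using Re_cphi_ge by auto
  define n where "n = nat \<lceil>2 / \<alpha>\<rceil>"
  have n: "1 \<le> n" "2 \<le> real n * \<alpha>"
  proof -
    have "2 / \<alpha> \<le> real n" unfolding n_def by linarith
    moreover have "0 < 2 / \<alpha>" using params by simp
    ultimately have "0 < real n" by linarith
    then show "1 \<le> n" by simp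
    show "2 \<le> real n * \<alpha>" using \<open>2 / \<alpha> \<le> real n\<close> params by (simp add: pos_divide_le_eq)
  qed
  define K where "K = 1 / k + fact n / (k * c) ^ n"
  have K: "0 < K" "1 / k \<le> K" "fact n / (k * c) ^ n \<le> K" unfolding K_def using k(1) params by (auto intro!: add_pos_pos)
  have "exp (- (t * (Re (cphi (Complex u \<xi>)) - phi u))) \<le> K * (1 / (t * phi u) + 1 / (t * phi u) ^ n) / (\<xi> / u)\<^sup>2"
    if u: "x0 < u" and t: "0 < t" and xi: "\<xi> \<noteq> 0" for u t \<xi>
  proof -
    have u0: "0 < u" using u params by linarith
    define N where "N = t * phi u"
    have N: "0 < N" using t phi_pos[OF u0] by (simp add: N_def)
    define \<rho> where "\<rho> = \<bar>\<xi>\<bar> / u"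
    have \<rho>: "0 < \<rho>" "(\<xi> / u)\<^sup>2 = \<rho>\<^sup>2" "\<bar>\<xi>\<bar> = \<rho> * u" using u0 xi by (auto simp: \<rho>_def power_divide)
    show ?thesis
    proof (cases "\<bar>\<xi>\<bar> \<le> u")
      case True
      have "phi u + k * (\<xi> / u)\<^sup>2 * phi u \<le> Re (cphi (Complex u \<xi>))" using k(2)[OF u order.refl True] .
      then have "t * (k * (\<xi> / u)\<^sup>2 * phi u) \<le> t * (Re (cphi (Complex u \<xi>)) - phi u)"
        using t by (intro mult_left_mono) auto
      then have "exp (- (t * (Re (cphi (Complex u \<xi>)) - phi u))) \<le> exp (- (k * N * \<rho>\<^sup>2))"
        by (simp add: N_def \<rho>(2) mult_ac)
      also have "\<dots> \<le> fact 1 / (k * N * \<rho>\<^sup>2) ^ 1"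
        using k(1) N \<rho>(1) by (intro exp_neg_le_power) auto
      also have "\<dots> = 1 / k * (1 / N) / \<rho>\<^sup>2" by simp
      also have "\<dots> \<le> K * (1 / N + 1 / N ^ n) / \<rho>\<^sup>2"
        using K N by (intro divide_right_mono mult_mono) auto
      finally show ?thesis by (simp add: N_def \<rho>(2))
    next
      case False
      then have r1: "1 \<le> \<rho>" using u0 by (simp add: \<rho>_def)
      have "phi u + k * (\<xi> / \<bar>\<xi>\<bar>)\<^sup>2 * phi \<bar>\<xi>\<bar> \<le> Re (cphi (Complex u \<xi>))"
        using False by (intro k(2)[OF u]) auto
      then have "phi u + k * phi \<bar>\<xi>\<bar> \<le> Re (cphi (Complex u \<xi>))"
        using xi by (simp add: power_divide)
      moreover have "k * (c * \<rho> powr \<alpha> * phi u) \<le> k * phi \<bar>\<xi>\<bar>"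
        unfolding \<rho>(3) using lower[OF r1 u] k(1) by (intro mult_left_mono) auto
      ultimately have "t * (k * (c * \<rho> powr \<alpha> * phi u)) \<le> t * (Re (cphi (Complex u \<xi>)) - phi u)"
        using t by (intro mult_left_mono) auto
      then have "exp (- (t * (Re (cphi (Complex u \<xi>)) - phi u))) \<le> exp (- (k * c * N * \<rho> powr \<alpha>))"
        by (simp add: N_def mult_ac)
      also have "\<dots> \<le> fact n / (k * c * N * \<rho> powr \<alpha>) ^ n"
        using k(1) N \<rho>(1) params by (intro exp_neg_le_power) auto
      also have "\<dots> = fact n / (k * c) ^ n * (1 / N ^ n) / \<rho> powr (real n * \<alpha>)"
        using \<rho>(1) by (simp add: power_mult_distrib powr_power mult.commute)
      also have "\<dots> \<le> fact n / (k * c) ^ n * (1 / N ^ n) / \<rho>\<^sup>2"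
      proof (rule divide_left_mono)
        have "\<rho> powr 2 \<le> \<rho> powr (real n * \<alpha>)" using r1 n by (intro powr_mono) auto
        then show "\<rho>\<^sup>2 \<le> \<rho> powr (real n * \<alpha>)" using \<rho>(1) by simp
      qed (use \<rho>(1) k(1) params N in auto)
      also have "\<dots> \<le> K * (1 / N + 1 / N ^ n) / \<rho>\<^sup>2"
        using K N k(1) params by (intro divide_right_mono mult_mono) auto
      finally show ?thesis by (simp add: N_def \<rho>(2))
    qed
  qed
  then show ?thesis using K(1) n(1) by blast
qed

end

section \<open>Densities of the marginal laws\<close>

context levy_measure
begin

text \<open>The Laplace transform of the law at time \<open>t\<close> on the vertical line through \<open>u\<close>, with the sign of
  the imaginary part chosen so that it is the Fourier transform of the tilted law.\<close>

definition laplace_line :: "real \<Rightarrow> real \<Rightarrow> real \<Rightarrow> complex" where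
  "laplace_line t u \<xi> = exp (- (t * cphi (Complex u (- \<xi>))))"

text \<open>The same for minus the derivative of the Laplace transform, that is, for the law weighted by
  \<open>y\<close>.\<close>

definition laplace_line_deriv :: "real \<Rightarrow> real \<Rightarrow> real \<Rightarrow> complex" where
  "laplace_line_deriv t u \<xi> = t * cphi' (Complex u (- \<xi>)) * laplace_line t u \<xi>"

text \<open>The density at time \<open>t\<close>, computed on the vertical line through \<open>u\<close>; for the law of
  a subordinator it does not depend on \<open>u > x0\<close>.\<close>

definition dens :: "real \<Rightarrow> real \<Rightarrow> real \<Rightarrow> real" where
  "dens t u y = exp (u * y) * Re (fourier_inv (laplace_line t u) y)"

end

text \<open>The law \<open>\<mu>\<close> at time \<open>t\<close> of a subordinator without drift whose Levy measure is \<open>\<nu>\<close>, described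
  by its Laplace transform.\<close>

locale levy_law = levy_measure \<nu> + real_distribution \<mu> for \<nu> \<mu> +
  fixes t :: real
  assumes t_pos: "0 < t"
    and nonneg: "AE y in \<mu>. 0 \<le> y"
    and laplace: "\<And>u. 0 < u \<Longrightarrow> (LINT y|\<mu>. exp (- (u * y))) = exp (- (t * phi u))"
begin

lemma integrable_law_mom:
  assumes "0 < u"
  shows "integrable \<mu> (\<lambda>y. y ^ k * exp (- (u * y)))"
proof (rule integrable_const_bound)
  show "AE y in \<mu>. norm (y ^ k * exp (- (u * y))) \<le> fact k / u ^ k"
    using nonneg
  proof eventually_elim
    case (elim y)
    have "(u * y) ^ k * exp (- (u * y)) \<le> fact k"
    proof (cases "k = 0")
      case False
      then have "(u * y) ^ k * exp (- (u * y)) \<le> fact k * (1 - exp (- (u * y)))"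
        using elim assms by (intro power_exp_neg_le) auto
      also have "\<dots> \<le> fact k * 1" by (rule mult_left_mono) auto
      finally show ?thesis by simp
    qed (use elim assms in auto)
    then show ?case using elim assms by (simp add: field_simps power_mult_distrib)
  qed
qed measurable

lemma integrable_law_exp:
  assumes "0 < Re z"
  shows "integrable \<mu> (\<lambda>y. exp (- (z * of_real y)))"
proof (rule integrable_const_bound)
  show "AE y in \<mu>. norm (exp (- (z * of_real y))) \<le> 1"
    using nonneg by eventually_elim (use assms in auto)
qed measurable

lemma law_has_field_derivative:
  assumes "0 < Re z"
  shows "((\<lambda>z. - (CLINT y|\<mu>. exp (- (z * of_real y)))) has_field_derivative
      (CLINT y|\<mu>. of_real y * exp (- (z * of_real y)))) (at z)"
proof -
  have "((\<lambda>z. CLINT y|\<mu>. 0 - exp (- (z * of_real y))) has_field_derivative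
      (CLINT y|\<mu>. of_real y * exp (- (z * of_real y)))) (at z)"
  proof (rule laplace_has_field_derivative)
    show "integrable \<mu> (\<lambda>y. y * exp (- (a * y)))" if "0 < a" for a
      using integrable_law_mom[OF that, of 1] by simp
    show "integrable \<mu> (\<lambda>y. y\<^sup>2 * exp (- (a * y)))" if "0 < a" for a
      using integrable_law_mom[OF that, of 2] by simp
  qed (use assms nonneg integrable_law_exp in auto)
  then show ?thesis by simp
qed

lemma exp_cphi_has_field_derivative:
  assumes "0 < Re z"
  shows "((\<lambda>z. - exp (- (t * cphi z))) has_field_derivative (t * cphi' z * exp (- (t * cphi z)))) (at z)"
  using DERIV_minus[OF DERIV_fun_exp[OF DERIV_minus[OF DERIV_cmult[OF cphi_has_field_derivative[OF assms], of "complex_of_real t"]]]]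
  by (simp add: mult.commute)

text \<open>Both sides are holomorphic in the right half-plane and agree on the positive real axis.\<close>

lemma complex_laplace:
  assumes "0 < Re z"
  shows "(CLINT y|\<mu>. exp (- (z * of_real y))) = exp (- (t * cphi z))"
proof -
  let ?S = "{z. 0 < Re z}"
  let ?f = "\<lambda>z. - (CLINT y|\<mu>. exp (- (z * of_real y))) - - exp (- (t * cphi z))"
  have "?f z = 0"
  proof (rule analytic_continuation[where S = ?S and U = "of_real ` {0<..}" and \<xi> = 1 and w = z])
    show "?f holomorphic_on ?S"
      using law_has_field_derivative exp_cphi_has_field_derivative
      by (intro holomorphic_on_diff) (auto simp: holomorphic_on_open open_halfspace_Re_gt)
    show "connected ?S" by (intro convex_connected convex_halfspace_Re_gt)
    have "(1::real) islimpt {0<..}"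
      by (rule open_imp_islimpt) auto
    show "(1::complex) islimpt (of_real ` {0<..})"
      unfolding islimpt_approachable
    proof (intro allI impI)
      fix e :: real assume e: "0 < e"
      show "\<exists>x'\<in>complex_of_real ` {0<..}. x' \<noteq> 1 \<and> dist x' 1 < e"
      proof (rule bexI[of _ "complex_of_real (1 + e / 2)"])
        have "dist (complex_of_real (1 + e / 2)) (complex_of_real 1) < e"
          unfolding dist_of_real using e by (simp add: dist_real_def)
        moreover have "complex_of_real (1 + e / 2) \<noteq> complex_of_real 1"
          unfolding of_real_eq_iff using e by simp
        ultimately show "complex_of_real (1 + e / 2) \<noteq> 1 \<and> dist (complex_of_real (1 + e / 2)) 1 < e"
          by simp
        show "complex_of_real (1 + e / 2) \<in> complex_of_real ` {0<..}"
          using e by (intro imageI) simp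
      qed
    qed
    fix w :: complex assume "w \<in> of_real ` {0<..}"
    then obtain u where u: "w = of_real u" "0 < u" by auto
    have "(CLINT y|\<mu>. exp (- (w * of_real y))) = (CLINT y|\<mu>. of_real (exp (- (u * y))))"
      unfolding u by (simp flip: exp_of_real)
    also have "\<dots> = of_real (exp (- (t * phi u)))" using laplace[OF u(2)] by simp
    also have "\<dots> = exp (- (t * cphi w))" unfolding u cphi_of_real by (simp flip: exp_of_real)
    finally show "?f w = 0" by simp
  qed (use assms in \<open>auto simp: open_halfspace_Re_gt\<close>)
  then show ?thesis by simp
qed

lemma complex_laplace_deriv:
  assumes "0 < Re z"
  shows "(CLINT y|\<mu>. of_real y * exp (- (z * of_real y))) = t * cphi' z * exp (- (t * cphi z))"
proof (rule DERIV_unique[OF law_has_field_derivative[OF assms]])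
  show "((\<lambda>z. - (CLINT y|\<mu>. exp (- (z * of_real y)))) has_field_derivative
      (t * cphi' z * exp (- (t * cphi z)))) (at z)"
    by (rule has_field_derivative_transform_within_open[OF exp_cphi_has_field_derivative[OF assms],
          where S = "{z. 0 < Re z}"])
      (use assms complex_laplace in \<open>auto simp: open_halfspace_Re_gt\<close>)
qed

lemma iexp_mult_exp: "of_real (exp (- (u * y))) * iexp (\<xi> * y) = exp (- (Complex u (- \<xi>) * of_real y))"
proof -
  have "complex_of_real (- (u * y)) + \<i> * of_real (\<xi> * y) = - (Complex u (- \<xi>) * of_real y)"
    by (simp add: complex_eq_iff)
  then show ?thesis by (simp only: exp_of_real[symmetric] exp_add[symmetric])
qed

lemma laplace_line_eq:
  assumes "0 < u"
  shows "laplace_line t u \<xi> = (CLINT y|\<mu>. of_real (exp (- (u * y))) * iexp (\<xi> * y))"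
  using complex_laplace[of "Complex u (- \<xi>)"] assms unfolding iexp_mult_exp laplace_line_def by simp

lemma laplace_line_deriv_eq:
  assumes "0 < u"
  shows "laplace_line_deriv t u \<xi> = (CLINT y|\<mu>. of_real (max 0 y * exp (- (u * y))) * iexp (\<xi> * y))"
proof -
  have "laplace_line_deriv t u \<xi> = (CLINT y|\<mu>. of_real y * exp (- (Complex u (- \<xi>) * of_real y)))"
    using complex_laplace_deriv[of "Complex u (- \<xi>)"] assms unfolding laplace_line_deriv_def laplace_line_def by simp
  also have "\<dots> = (CLINT y|\<mu>. of_real (max 0 y * exp (- (u * y))) * iexp (\<xi> * y))"
  proof (rule integral_cong_AE)
    show "AE y in \<mu>. of_real y * exp (- (Complex u (- \<xi>) * of_real y)) =
        of_real (max 0 y * exp (- (u * y))) * iexp (\<xi> * y)"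
      using nonneg by eventually_elim (simp add: iexp_mult_exp[symmetric] mult.assoc)
  qed measurable
  finally show ?thesis .
qed

lemma laplace_line_measurable[measurable]:
  assumes "0 < u"
  shows "laplace_line t u \<in> borel_measurable borel" "laplace_line_deriv t u \<in> borel_measurable borel"
proof -
  show "laplace_line t u \<in> borel_measurable borel" unfolding laplace_line_eq[OF assms, abs_def] by measurable
  show "laplace_line_deriv t u \<in> borel_measurable borel" unfolding laplace_line_deriv_eq[OF assms, abs_def] by measurable
qed

lemma norm_laplace_line: "norm (laplace_line t u \<xi>) = exp (- (t * Re (cphi (Complex u (- \<xi>)))))"
  by (simp add: laplace_line_def)

lemma norm_laplace_line_deriv: "norm (laplace_line_deriv t u \<xi>) = t * norm (cphi' (Complex u (- \<xi>))) * exp (- (t * Re (cphi (Complex u (- \<xi>)))))"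
  using t_pos by (simp add: laplace_line_deriv_def norm_laplace_line norm_mult)

end

locale scaled_levy_law = scaled_levy_measure \<nu> \<alpha> \<beta> c C x0 + levy_law \<nu> \<mu> t
  for \<nu> \<alpha> \<beta> c C x0 \<mu> t
begin

lemma integrable_laplace_line:
  assumes u: "x0 < u"
  shows "integrable lborel (laplace_line t u)"
proof -
  have u0: "0 < u" using u params by linarith
  note [measurable] = laplace_line_measurable[OF u0]
  obtain K n where K: "0 < K" "\<And>\<xi>. \<xi> \<noteq> 0 \<Longrightarrow> exp (- (t * (Re (cphi (Complex u \<xi>)) - phi u)))
       \<le> K * (1 / (t * phi u) + 1 / (t * phi u) ^ n) / (\<xi> / u)\<^sup>2"
    using exp_neg_Re_cphi_le u t_pos by metis
  define B where "B = K * (1 / (t * phi u) + 1 / (t * phi u) ^ n) * u\<^sup>2"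
  have B: "0 \<le> B" unfolding B_def using K(1) t_pos phi_pos[OF u0] by simp
  have bound: "norm (laplace_line t u \<xi>) \<le> (1 + B) * inverse (1 + \<xi>\<^sup>2)" for \<xi>
  proof -
    let ?e = "norm (laplace_line t u \<xi>)"
    have "t * phi u \<le> t * Re (cphi (Complex u (- \<xi>)))"
      using Re_cphi_ge_phi[OF u0] t_pos by simp
    moreover have "0 \<le> t * phi u" using t_pos phi_pos[OF u0] by simp
    ultimately have e1: "?e \<le> 1" by (simp add: norm_laplace_line)
    have "?e * \<xi>\<^sup>2 \<le> B"
    proof (cases "\<xi> = 0")
      case False
      have "?e \<le> exp (- (t * (Re (cphi (Complex u (- \<xi>))) - phi u)))"
        using \<open>0 \<le> t * phi u\<close> by (simp add: norm_laplace_line right_diff_distrib)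
      also have "\<dots> \<le> B / \<xi>\<^sup>2"
        using K(2)[of "- \<xi>"] False by (simp add: B_def power_divide)
      finally show ?thesis using False by (simp add: field_simps)
    qed (use B in auto)
    with e1 have "?e * (1 + \<xi>\<^sup>2) \<le> 1 + B" by (simp add: distrib_left)
    then have "?e \<le> (1 + B) / (1 + \<xi>\<^sup>2)"
      by (subst pos_le_divide_eq) (auto intro: add_pos_nonneg)
    then show ?thesis by (simp add: divide_inverse)
  qed
  have "integrable lborel (\<lambda>\<xi>::real. (1 + B) * inverse (1 + \<xi>\<^sup>2))"
    using integrable_inverse_1_plus_square by (simp add: set_integrable_def)
  then show ?thesis
  proof (rule Bochner_Integration.integrable_bound)
    show "AE \<xi> in lborel. norm (laplace_line t u \<xi>) \<le> norm ((1 + B) * inverse (1 + \<xi>\<^sup>2))"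
      using bound abs_ge_self order.trans unfolding real_norm_def by (intro AE_I2) blast
  qed measurable
qed

lemma integrable_laplace_line_deriv:
  assumes u: "x0 < u"
  shows "integrable lborel (laplace_line_deriv t u)"
proof -
  have u0: "0 < u" using u params by linarith
  note [measurable] = laplace_line_measurable[OF u0]
  show ?thesis
  proof (rule Bochner_Integration.integrable_bound)
    show "integrable lborel (\<lambda>\<xi>. t * mom 1 u * norm (laplace_line t u \<xi>))"
      using integrable_laplace_line[OF u] by (intro integrable_mult_right integrable_norm)
    show "AE \<xi> in lborel. norm (laplace_line_deriv t u \<xi>) \<le> norm (t * mom 1 u * norm (laplace_line t u \<xi>))"
    proof (rule AE_I2)
      fix \<xi>
      have "norm (laplace_line_deriv t u \<xi>) \<le> t * mom 1 u * norm (laplace_line t u \<xi>)"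
        unfolding norm_laplace_line_deriv norm_laplace_line using norm_cphi'_le[of "Complex u (- \<xi>)"] t_pos
        by (intro mult_right_mono mult_left_mono) auto
      then show "norm (laplace_line_deriv t u \<xi>) \<le> norm (t * mom 1 u * norm (laplace_line t u \<xi>))"
        using t_pos mom_nonneg[of 1 u] by (simp add: abs_mult)
    qed
  qed measurable
qed

lemma dens:
  assumes u: "x0 < u"
  shows continuous_dens: "continuous_on UNIV (dens t u)"
    and dens_nonneg: "0 \<le> dens t u y"
    and law_eq_density: "\<mu> = density lborel (\<lambda>y. ennreal (dens t u y))"
proof -
  have u0: "0 < u" using u params by linarith
  let ?k = "\<lambda>y. exp (- (u * y))"
  have k: "integrable \<mu> ?k" using integrable_law_mom[OF u0, of 0] by simp
  have kp: "0 < (LINT y|\<mu>. ?k y)" using laplace[OF u0] by simp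
  have H: "integrable lborel (\<lambda>\<xi>. CLINT y|\<mu>. of_real (?k y) * iexp (\<xi> * y))"
    using integrable_laplace_line[OF u] unfolding laplace_line_eq[OF u0, abs_def] .
  note w = weighted_inversion[OF k _ kp H, folded laplace_line_eq[OF u0, abs_def]]
  show cont: "continuous_on UNIV (dens t u)"
    unfolding dens_def[abs_def] using continuous_fourier_inv[OF integrable_laplace_line[OF u]]
    by (intro continuous_intros)
  then have [measurable]: "dens t u \<in> borel_measurable borel" by (rule borel_measurable_continuous_onI)
  have [measurable]: "fourier_inv (laplace_line t u) \<in> borel_measurable borel"
    using continuous_fourier_inv[OF integrable_laplace_line[OF u]] by (rule borel_measurable_continuous_onI)
  have nn: "0 \<le> Re (fourier_inv (laplace_line t u) y)" for y using w(1) by simp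
  then show "0 \<le> dens t u y" by (simp add: dens_def)
  have "\<mu> = density (density \<mu> (\<lambda>y. ennreal (?k y))) (\<lambda>y. ennreal (exp (u * y)))"
    by (subst density_density_eq) (auto simp: ennreal_mult[symmetric] exp_add[symmetric] density_1)
  also have "\<dots> = density (density lborel (\<lambda>x. ennreal (Re (fourier_inv (laplace_line t u) x)))) (\<lambda>y. ennreal (exp (u * y)))"
    using w(2) by simp
  also have "\<dots> = density lborel (\<lambda>y. ennreal (dens t u y))"
    using nn by (subst density_density_eq) (auto simp: ennreal_mult[symmetric] dens_def mult.commute intro!: density_cong)
  finally show "\<mu> = density lborel (\<lambda>y. ennreal (dens t u y))" .
qed

text \<open>The second representation of the density. The law weighted by \<open>y exp (- u y)\<close> has two continuous
  densities on \<open>(0,\<infinity>)\<close>, one from the first representation and one from inversion of its own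
  characteristic function.\<close>

lemma dens_mult:
  assumes u: "x0 < u" and y: "0 < y"
  shows "y * exp (- (u * y)) * dens t u y = Re (fourier_inv (laplace_line_deriv t u) y)"
proof -
  have u0: "0 < u" using u params by linarith
  let ?k = "\<lambda>y. max 0 y * exp (- (u * y))"
  have k: "integrable \<mu> ?k"
    by (rule Bochner_Integration.integrable_bound[OF integrable_law_mom[OF u0, of 1]]) (auto simp: max_def)
  have "complex_of_real (LINT y|\<mu>. ?k y) = laplace_line_deriv t u 0"
    unfolding laplace_line_deriv_eq[OF u0] by (simp add: integral_complex_of_real[symmetric] del: integral_complex_of_real of_real_mult)
  also have "\<dots> = of_real (t * mom 1 u * exp (- (t * phi u)))"
  proof -
    have "Complex u 0 = of_real u" by (simp add: complex_eq_iff)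
    moreover have "cphi' (of_real u) = of_real (mom 1 u)"
      unfolding cphi'_def mom_def integral_complex_of_real[symmetric]
      by (rule Bochner_Integration.integral_cong) (simp_all only: power_one_right of_real_mult[symmetric] of_real_minus[symmetric] exp_of_real)
    ultimately show ?thesis by (simp add: laplace_line_deriv_def laplace_line_def cphi_of_real flip: exp_of_real)
  qed
  finally have "(LINT y|\<mu>. ?k y) = t * mom 1 u * exp (- (t * phi u))" by (simp only: of_real_eq_iff)
  moreover have "0 < mom 1 u" by (rule mom_pos[OF u])
  ultimately have kp: "0 < (LINT y|\<mu>. ?k y)" using t_pos by simp
  have H: "integrable lborel (\<lambda>\<xi>. CLINT y|\<mu>. of_real (?k y) * iexp (\<xi> * y))"
    using integrable_laplace_line_deriv[OF u] unfolding laplace_line_deriv_eq[OF u0, abs_def] .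
  note w = weighted_inversion[OF k _ kp H, folded laplace_line_deriv_eq[OF u0, abs_def]]
  have c2: "continuous_on UNIV (\<lambda>y. Re (fourier_inv (laplace_line_deriv t u) y))"
    using continuous_fourier_inv[OF integrable_laplace_line_deriv[OF u]] by (intro continuous_intros)
  then have [measurable]: "(\<lambda>y. Re (fourier_inv (laplace_line_deriv t u) y)) \<in> borel_measurable borel"
    by (rule borel_measurable_continuous_onI)
  have [measurable]: "dens t u \<in> borel_measurable borel"
    using continuous_dens[OF u] by (rule borel_measurable_continuous_onI)
  have "density lborel (\<lambda>y. ennreal (Re (fourier_inv (laplace_line_deriv t u) y))) = density \<mu> (\<lambda>y. ennreal (?k y))"
    using w(2) by simp
  also have "\<dots> = density lborel (\<lambda>y. ennreal (dens t u y) * ennreal (?k y))"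
    by (subst law_eq_density[OF u], subst density_density_eq) auto
  finally have "AE y in lborel. ennreal (Re (fourier_inv (laplace_line_deriv t u) y)) = ennreal (dens t u y) * ennreal (?k y)"
    by (intro sigma_finite_measure.density_unique[OF sigma_finite_lborel]) auto
  then have AE: "AE y in lborel. y \<in> {0<..} \<longrightarrow> y * exp (- (u * y)) * dens t u y = Re (fourier_inv (laplace_line_deriv t u) y)"
  proof eventually_elim
    case (elim y)
    have "0 \<le> Re (fourier_inv (laplace_line_deriv t u) y)" using w(1) by simp
    then show ?case using elim dens_nonneg[OF u, of y]
      by (auto simp: ennreal_mult[symmetric] max_def mult_ac)
  qed
  show ?thesis
  proof (rule continuous_on_eq_of_AE_eq[OF _ _ _ AE])
    show "continuous_on {0<..} (\<lambda>y. y * exp (- (u * y)) * dens t u y)"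
      using continuous_on_subset[OF continuous_dens[OF u]] by (intro continuous_intros) auto
    show "continuous_on {0<..} (\<lambda>y. Re (fourier_inv (laplace_line_deriv t u) y))"
      using continuous_on_subset[OF c2] by auto
  qed (use y in auto)
qed

end

section \<open>Integration over time and frequency\<close>

lemma nn_integral_powr_tail:
  fixes a \<delta> :: real
  assumes "0 < a" "0 < \<delta>"
  shows "(\<integral>\<^sup>+x. ennreal ((\<bar>x\<bar> / a) powr (- (1 + \<delta>))) * indicator {x. a \<le> \<bar>x\<bar>} x \<partial>lborel) = ennreal (2 * a / \<delta>)"
proof -
  let ?f = "\<lambda>x. (\<bar>x\<bar> / a) powr (- (1 + \<delta>))"
  have "(\<integral>\<^sup>+x. ennreal (?f x) * indicator {a..} x \<partial>lborel) = ennreal (0 - (- (a / \<delta>) * (a / a) powr (- \<delta>)))"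
  proof (rule nn_integral_FTC_atLeast[where F = "\<lambda>x. - (a / \<delta>) * (x / a) powr (- \<delta>)"])
    show "DERIV (\<lambda>x. - (a / \<delta>) * (x / a) powr (- \<delta>)) x :> ?f x" if "a \<le> x" for x
      using assms that by (auto intro!: derivative_eq_intros simp: powr_diff powr_minus powr_add divide_simps)
    have "filterlim (\<lambda>x. x / a) at_top at_top"
      using assms by real_asymp
    then have "((\<lambda>x. (x / a) powr (- \<delta>)) \<longlongrightarrow> 0) at_top"
      using assms by (intro tendsto_neg_powr) auto
    from tendsto_mult_left[OF this, of "- (a / \<delta>)"]
    show "((\<lambda>x. - (a / \<delta>) * (x / a) powr (- \<delta>)) \<longlongrightarrow> 0) at_top" by simp
  qed auto
  then have 1: "(\<integral>\<^sup>+x. ennreal (?f x) * indicator {a..} x \<partial>lborel) = ennreal (a / \<delta>)"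
    using assms by simp
  have 2: "(\<integral>\<^sup>+x. ennreal (?f x) * indicator {..-a} x \<partial>lborel) = ennreal (a / \<delta>)"
    unfolding 1[symmetric]
    by (subst nn_integral_real_affine[where c = "-1" and t = 0])
      (auto intro!: nn_integral_cong simp: indicator_def)
  have "(\<integral>\<^sup>+x. ennreal (?f x) * indicator {x. a \<le> \<bar>x\<bar>} x \<partial>lborel)
      = (\<integral>\<^sup>+x. ennreal (?f x) * indicator {a..} x + ennreal (?f x) * indicator {..-a} x \<partial>lborel)"
    using assms by (intro nn_integral_cong) (auto simp: indicator_def)
  also have "\<dots> = (\<integral>\<^sup>+x. ennreal (?f x) * indicator {a..} x \<partial>lborel) + (\<integral>\<^sup>+x. ennreal (?f x) * indicator {..-a} x \<partial>lborel)"
    by (rule nn_integral_add) measurable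
  also have "\<dots> = ennreal (a / \<delta>) + ennreal (a / \<delta>)" unfolding 1 2 ..
  also have "\<dots> = ennreal (2 * a / \<delta>)"
    using assms by (subst ennreal_plus[symmetric]) auto
  finally show ?thesis .
qed

lemma nn_integral_times_exp:
  fixes b :: real
  assumes "0 < b"
  shows "(\<integral>\<^sup>+t. ennreal (t * exp (- (t * b))) * indicator {0<..} t \<partial>lborel) = ennreal (1 / b\<^sup>2)"
proof -
  have "(\<integral>\<^sup>+t. ennreal (t * exp (- (t * b))) * indicator {0<..} t \<partial>lborel)
      = (\<integral>\<^sup>+t. ennreal (t * exp (- (t * b))) * indicator {0..} t \<partial>lborel)"
    by (intro nn_integral_cong) (auto simp: indicator_def)
  also have "\<dots> = ennreal (0 - (- (0 / b + 1 / b\<^sup>2) * exp (- (0 * b))))"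
  proof (rule nn_integral_FTC_atLeast[where F = "\<lambda>t. - (t / b + 1 / b\<^sup>2) * exp (- (t * b))"])
    show "DERIV (\<lambda>t. - (t / b + 1 / b\<^sup>2) * exp (- (t * b))) t :> t * exp (- (t * b))" for t
      using assms by (auto intro!: derivative_eq_intros simp: field_simps power2_eq_square)
    show "((\<lambda>t. - (t / b + 1 / b\<^sup>2) * exp (- (t * b))) \<longlongrightarrow> 0) at_top"
      using assms by real_asymp
  qed auto
  finally show ?thesis by simp
qed

context levy_measure
begin

lemma continuous_on_cphi: "continuous_on UNIV (\<lambda>\<xi>. cphi (Complex u \<xi>))"
  and continuous_on_cphi': "continuous_on UNIV (\<lambda>\<xi>. cphi' (Complex u \<xi>))"
  if u: "0 < u"
proof -
  let ?S = "{z. 0 < Re z}"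
  have hol: "cphi holomorphic_on ?S"
    using cphi_has_field_derivative by (auto simp: holomorphic_on_open open_halfspace_Re_gt)
  have "deriv cphi holomorphic_on ?S"
    by (rule holomorphic_deriv[OF hol open_halfspace_Re_gt])
  then have c': "continuous_on ?S cphi'"
    by (rule continuous_on_eq[OF holomorphic_on_imp_continuous_on])
      (use cphi_has_field_derivative in \<open>auto intro: DERIV_imp_deriv\<close>)
  have line: "continuous_on UNIV (Complex u)" "range (Complex u) \<subseteq> ?S"
    using u by (auto simp: Complex_eq[abs_def] intro!: continuous_intros)
  show "continuous_on UNIV (\<lambda>\<xi>. cphi (Complex u \<xi>))"
    by (rule continuous_on_compose2[OF holomorphic_on_imp_continuous_on[OF hol] line])
  show "continuous_on UNIV (\<lambda>\<xi>. cphi' (Complex u \<xi>))"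
    by (rule continuous_on_compose2[OF c' line])
qed

lemma borel_measurable_cphi_line:
  assumes u: "0 < u"
  shows "(\<lambda>\<xi>. cphi (Complex u (- \<xi>))) \<in> borel_measurable borel"
    and "(\<lambda>\<xi>. cphi' (Complex u (- \<xi>))) \<in> borel_measurable borel"
proof -
  have "continuous_on UNIV (\<lambda>\<xi>. cphi (Complex u (- \<xi>)))"
    by (rule continuous_on_compose2[OF continuous_on_cphi[OF u]]) (auto intro!: continuous_intros)
  then show "(\<lambda>\<xi>. cphi (Complex u (- \<xi>))) \<in> borel_measurable borel"
    by (rule borel_measurable_continuous_onI)
  have "continuous_on UNIV (\<lambda>\<xi>. cphi' (Complex u (- \<xi>)))"
    by (rule continuous_on_compose2[OF continuous_on_cphi'[OF u]]) (auto intro!: continuous_intros)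
  then show "(\<lambda>\<xi>. cphi' (Complex u (- \<xi>))) \<in> borel_measurable borel"
    by (rule borel_measurable_continuous_onI)
qed

end

context scaled_levy_law
begin

lemma dens_le:
  assumes x: "0 < x" "x0 < 1 / x"
  shows "ennreal (x * dens t (1/x) x) \<le>
    ennreal (exp 1 / (2 * pi)) * (\<integral>\<^sup>+\<xi>. ennreal (norm (cphi' (Complex (1/x) (- \<xi>))) *
        (t * exp (- (t * Re (cphi (Complex (1/x) (- \<xi>))))))) \<partial>lborel)"
proof -
  let ?u = "1 / x"
  have "x * exp (- 1) * dens t ?u x = Re (fourier_inv (laplace_line_deriv t ?u) x)"
    using dens_mult[OF x(2,1)] x by simp
  then have "x * dens t ?u x = exp 1 * Re (fourier_inv (laplace_line_deriv t ?u) x)"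
    by (simp add: exp_minus field_simps)
  also have "\<dots> \<le> exp 1 * norm (fourier_inv (laplace_line_deriv t ?u) x)"
    by (intro mult_left_mono complex_Re_le_cmod) auto
  also have "\<dots> = exp 1 / (2 * pi) * norm (CLINT \<xi>|lborel. iexp (- (\<xi> * x)) * laplace_line_deriv t ?u \<xi>)"
    by (simp add: fourier_inv_def norm_mult norm_divide)
  finally have "ennreal (x * dens t ?u x) \<le>
      ennreal (exp 1 / (2 * pi)) * ennreal (norm (CLINT \<xi>|lborel. iexp (- (\<xi> * x)) * laplace_line_deriv t ?u \<xi>))"
    by (simp add: ennreal_mult[symmetric] ennreal_leI)
  also have "\<dots> \<le> ennreal (exp 1 / (2 * pi)) * (\<integral>\<^sup>+\<xi>. ennreal (norm (iexp (- (\<xi> * x)) * laplace_line_deriv t ?u \<xi>)) \<partial>lborel)"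
    by (intro mult_left_mono integral_norm_bound_ennreal integrable_fourier_inv integrable_laplace_line_deriv x) auto
  also have "(\<integral>\<^sup>+\<xi>. ennreal (norm (iexp (- (\<xi> * x)) * laplace_line_deriv t ?u \<xi>)) \<partial>lborel)
      = (\<integral>\<^sup>+\<xi>. ennreal (norm (cphi' (Complex (1/x) (- \<xi>))) * (t * exp (- (t * Re (cphi (Complex (1/x) (- \<xi>))))))) \<partial>lborel)"
    by (intro nn_integral_cong) (simp add: norm_mult norm_laplace_line_deriv mult_ac)
  finally show ?thesis .
qed

end

context scaled_levy_measure
begin

text \<open>Integration over time first: the time integral of \<open>t exp (- t b)\<close> is \<open>1 / b\<^sup>2\<close>.\<close>

lemma nn_integral_time:
  assumes u: "0 < u"
  shows "(\<integral>\<^sup>+t. (\<integral>\<^sup>+\<xi>. ennreal (norm (cphi' (Complex u (- \<xi>))) *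
        (t * exp (- (t * Re (cphi (Complex u (- \<xi>))))))) \<partial>lborel) * indicator {0<..} t \<partial>lborel)
    = (\<integral>\<^sup>+\<xi>. ennreal (norm (cphi' (Complex u (- \<xi>))) / (Re (cphi (Complex u (- \<xi>))))\<^sup>2) \<partial>lborel)"
proof -
  note [measurable] = borel_measurable_cphi_line[OF u]
  let ?a = "\<lambda>\<xi>. norm (cphi' (Complex u (- \<xi>)))" and ?b = "\<lambda>\<xi>. Re (cphi (Complex u (- \<xi>)))"
  have "(\<integral>\<^sup>+t. (\<integral>\<^sup>+\<xi>. ennreal (?a \<xi> * (t * exp (- (t * ?b \<xi>)))) \<partial>lborel) * indicator {0<..} t \<partial>lborel)
    = (\<integral>\<^sup>+t. (\<integral>\<^sup>+\<xi>. ennreal (?a \<xi> * (t * exp (- (t * ?b \<xi>)))) * indicator {0<..} t \<partial>lborel) \<partial>lborel)"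
    by (intro nn_integral_cong nn_integral_multc[symmetric]) measurable
  also have "\<dots> = (\<integral>\<^sup>+\<xi>. (\<integral>\<^sup>+t. ennreal (?a \<xi> * (t * exp (- (t * ?b \<xi>)))) * indicator {0<..} t \<partial>lborel) \<partial>lborel)"
    by (rule lborel_pair.Fubini') measurable
  also have "\<dots> = (\<integral>\<^sup>+\<xi>. ennreal (?a \<xi> / (?b \<xi>)\<^sup>2) \<partial>lborel)"
  proof (rule nn_integral_cong)
    fix \<xi>
    have b: "0 < ?b \<xi>" using Re_cphi_ge_phi[OF u] phi_pos[OF u] by (rule less_le_trans[rotated])
    have "(\<integral>\<^sup>+t. ennreal (?a \<xi> * (t * exp (- (t * ?b \<xi>)))) * indicator {0<..} t \<partial>lborel)
      = (\<integral>\<^sup>+t. ennreal (?a \<xi>) * (ennreal (t * exp (- (t * ?b \<xi>))) * indicator {0<..} t) \<partial>lborel)"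
      by (intro nn_integral_cong) (simp add: ennreal_mult' mult.assoc)
    also have "\<dots> = ennreal (?a \<xi>) * ennreal (1 / (?b \<xi>)\<^sup>2)"
      by (subst nn_integral_cmult) (auto simp: nn_integral_times_exp[OF b])
    finally show "(\<integral>\<^sup>+t. ennreal (?a \<xi> * (t * exp (- (t * ?b \<xi>)))) * indicator {0<..} t \<partial>lborel)
      = ennreal (?a \<xi> / (?b \<xi>)\<^sup>2)" by (simp add: ennreal_mult[symmetric])
  qed
  finally show ?thesis .
qed

text \<open>The bound assumed for the derivative on \<open>\<bar>\<xi>\<bar> \<ge> u\<close> is what makes the frequency integral converge
  at infinity; on \<open>\<bar>\<xi>\<bar> < u\<close> the integrand is at most \<open>1 / (u phi u)\<close>.\<close>

lemma nn_integral_frequency: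
  assumes D: "0 < D" "0 < \<delta>"
    and bnd: "\<And>u \<xi>. x0 < u \<Longrightarrow> u \<le> \<bar>\<xi>\<bar> \<Longrightarrow>
      norm (cphi' (Complex u \<xi>)) * (u * phi u) \<le> D * (phi \<bar>\<xi>\<bar>)\<^sup>2 * (\<bar>\<xi>\<bar> / u) powr (- (1 + \<delta>))"
  shows "\<exists>K>0. \<forall>u>x0. (\<integral>\<^sup>+\<xi>. ennreal (norm (cphi' (Complex u (- \<xi>))) / (Re (cphi (Complex u (- \<xi>))))\<^sup>2) \<partial>lborel)
      \<le> ennreal (K / phi u)"
proof -
  obtain k where k: "k > 0" "\<And>u v \<xi>. x0 < u \<Longrightarrow> u \<le> v \<Longrightarrow> \<bar>\<xi>\<bar> \<le> v \<Longrightarrow>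
      phi u + k * (\<xi> / v)\<^sup>2 * phi v \<le> Re (cphi (Complex u \<xi>))" using Re_cphi_ge by auto
  define K where "K = 2 + 2 * D / (k\<^sup>2 * \<delta>)"
  have "(\<integral>\<^sup>+\<xi>. ennreal (norm (cphi' (Complex u (- \<xi>))) / (Re (cphi (Complex u (- \<xi>))))\<^sup>2) \<partial>lborel)
      \<le> ennreal (K / phi u)" if u: "x0 < u" for u
  proof -
    have u0: "0 < u" using u params by linarith
    note p = phi_pos[OF u0]
    define q where "q = 1 / (u * phi u)"
    have q: "0 < q" using u0 p by (simp add: q_def)
    let ?g = "\<lambda>\<xi>. ennreal q * indicator {-u..u} \<xi> + ennreal (D / k\<^sup>2 * q) *
        (ennreal ((\<bar>\<xi>\<bar> / u) powr (- (1 + \<delta>))) * indicator {x. u \<le> \<bar>x\<bar>} \<xi>)"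
    have le: "ennreal (norm (cphi' (Complex u (- \<xi>))) / (Re (cphi (Complex u (- \<xi>))))\<^sup>2) \<le> ?g \<xi>" for \<xi>
    proof -
      let ?a = "norm (cphi' (Complex u (- \<xi>)))" and ?b = "Re (cphi (Complex u (- \<xi>)))"
      have b: "phi u \<le> ?b" by (rule Re_cphi_ge_phi[OF u0])
      show ?thesis
      proof (cases "u \<le> \<bar>\<xi>\<bar>")
        case False
        have "u * ?a \<le> phi u"
          using norm_cphi'_le[of "Complex u (- \<xi>)"] mom_le[OF u0, of 1] u0
          by (auto intro: order.trans[OF mult_left_mono])
        then have a: "?a \<le> phi u / u" using u0 by (simp add: field_simps)
        have "?a / ?b\<^sup>2 \<le> (phi u / u) / (phi u)\<^sup>2"
          using a b p u0 by (intro frac_le power_mono) auto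
        also have "\<dots> = q" using p by (simp add: q_def power2_eq_square)
        finally show ?thesis using False by (auto simp: indicator_def intro: ennreal_leI)
      next
        case True
        let ?r = "(\<bar>\<xi>\<bar> / u) powr (- (1 + \<delta>))"
        have xi: "0 < phi \<bar>\<xi>\<bar>" using True u0 by (intro phi_pos) auto
        have "phi u + k * (- \<xi> / \<bar>\<xi>\<bar>)\<^sup>2 * phi \<bar>\<xi>\<bar> \<le> ?b"
          using True by (intro k(2)[OF u]) auto
        moreover have "(- \<xi> / \<bar>\<xi>\<bar>)\<^sup>2 = 1" using True u0 by (auto simp: power_divide)
        ultimately have b': "k * phi \<bar>\<xi>\<bar> \<le> ?b" using p by simp
        have "?a * (u * phi u) \<le> D * (phi \<bar>\<xi>\<bar>)\<^sup>2 * ?r"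
          using bnd[OF u, of "- \<xi>"] True by simp
        then have a: "?a \<le> D * (phi \<bar>\<xi>\<bar>)\<^sup>2 * ?r * q"
          using u0 p by (simp add: q_def field_simps)
        have "?a / ?b\<^sup>2 \<le> (D * (phi \<bar>\<xi>\<bar>)\<^sup>2 * ?r * q) / (k * phi \<bar>\<xi>\<bar>)\<^sup>2"
          using a b' k(1) xi D q by (intro frac_le power_mono) auto
        also have "\<dots> = D / k\<^sup>2 * q * ?r" using xi by (simp add: power_mult_distrib)
        finally have "ennreal (?a / ?b\<^sup>2) \<le> ennreal (D / k\<^sup>2 * q) * ennreal ?r"
          using D q k(1) by (subst ennreal_mult[symmetric]) (auto intro: ennreal_leI)
        then show ?thesis using True by (auto intro: add_increasing)
      qed
    qed
    have "(\<integral>\<^sup>+\<xi>. ennreal (norm (cphi' (Complex u (- \<xi>))) / (Re (cphi (Complex u (- \<xi>))))\<^sup>2) \<partial>lborel)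
        \<le> (\<integral>\<^sup>+\<xi>. ?g \<xi> \<partial>lborel)"
      by (rule nn_integral_mono) (rule le)
    also have "\<dots> = (\<integral>\<^sup>+\<xi>. ennreal q * indicator {-u..u} \<xi> \<partial>lborel) + ennreal (D / k\<^sup>2 * q) *
        (\<integral>\<^sup>+\<xi>. ennreal ((\<bar>\<xi>\<bar> / u) powr (- (1 + \<delta>))) * indicator {x. u \<le> \<bar>x\<bar>} \<xi> \<partial>lborel)"
      by (subst nn_integral_add) (measurable, subst nn_integral_cmult, auto)
    also have "\<dots> = ennreal q * ennreal (2 * u) + ennreal (D / k\<^sup>2 * q) * ennreal (2 * u / \<delta>)"
      unfolding nn_integral_powr_tail[OF u0 D(2)] using u0 by (subst nn_integral_cmult_indicator) auto
    also have "\<dots> = ennreal (q * (2 * u) + D / k\<^sup>2 * q * (2 * u / \<delta>))"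
      using q u0 D by (simp add: ennreal_mult[symmetric])
    also have "q * (2 * u) + D / k\<^sup>2 * q * (2 * u / \<delta>) = K / phi u"
      using u0 p D k(1) by (simp add: q_def K_def field_simps)
    finally show ?thesis .
  qed
  moreover have "0 < K" using D k(1) by (simp add: K_def add_pos_pos)
  ultimately show ?thesis by blast
qed

end

section \<open>A lower bound of the densities at saddle-point times\<close>

context levy_measure
begin

lemma integrable_of_real_mom:
  assumes "0 < u" "1 \<le> k"
  shows "integrable \<nu> (\<lambda>s. of_real (s ^ k * exp (- (u * s))) :: complex)"
  using integrable_mom[OF assms] by (rule integrable_of_real)

text \<open>Expansion of the Laplace exponent around the point \<open>w\<close> of the real axis.\<close>

lemma cphi_taylor:
  assumes w: "0 < w"
  shows "norm (cphi (Complex w (- \<xi>)) - phi w + \<i> * \<xi> * mom 1 w - \<xi>\<^sup>2 / 2 * mom 2 w)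
    \<le> \<bar>\<xi>\<bar> ^ 3 / 6 * mom 3 w"
proof -
  let ?q = "\<lambda>s. (1 - exp (- (Complex w (- \<xi>) * of_real s))) - of_real (1 - exp (- (w * s)))
      + \<i> * \<xi> * of_real (s ^ 1 * exp (- (w * s))) - of_real (\<xi>\<^sup>2 / 2) * of_real (s ^ 2 * exp (- (w * s)))"
  have i0: "integrable \<nu> (\<lambda>s. (1 - exp (- (Complex w (- \<xi>) * of_real s))) - of_real (1 - exp (- (w * s))))"
    using w by (intro Bochner_Integration.integrable_diff integrable_cphi integrable_of_real integrable_phi) auto
  have i1: "integrable \<nu> (\<lambda>s. \<i> * \<xi> * of_real (s ^ 1 * exp (- (w * s))))"
    by (intro integrable_mult_right integrable_of_real_mom w) simp
  have i2: "integrable \<nu> (\<lambda>s. complex_of_real (\<xi>\<^sup>2 / 2) * of_real (s ^ 2 * exp (- (w * s))))"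
    by (intro integrable_mult_right integrable_of_real_mom w) simp
  have iq: "integrable \<nu> ?q"
    by (rule Bochner_Integration.integrable_diff[OF Bochner_Integration.integrable_add[OF i0 i1] i2])
  have "(CLINT s|\<nu>. ?q s) = (CLINT s|\<nu>. (1 - exp (- (Complex w (- \<xi>) * of_real s))) - of_real (1 - exp (- (w * s))))
      + (CLINT s|\<nu>. \<i> * \<xi> * of_real (s ^ 1 * exp (- (w * s))))
      - (CLINT s|\<nu>. complex_of_real (\<xi>\<^sup>2 / 2) * of_real (s ^ 2 * exp (- (w * s))))"
    unfolding Bochner_Integration.integral_diff[OF Bochner_Integration.integrable_add[OF i0 i1] i2]
      Bochner_Integration.integral_add[OF i0 i1] ..
  also have "(CLINT s|\<nu>. (1 - exp (- (Complex w (- \<xi>) * of_real s))) - of_real (1 - exp (- (w * s)))) = cphi (Complex w (- \<xi>)) - phi w"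
    unfolding cphi_def phi_def integral_complex_of_real[symmetric] using w
    by (intro Bochner_Integration.integral_diff integrable_cphi integrable_of_real integrable_phi) auto
  also have "(CLINT s|\<nu>. \<i> * \<xi> * of_real (s ^ 1 * exp (- (w * s)))) = \<i> * \<xi> * mom 1 w"
    unfolding mom_def integral_complex_of_real[symmetric] by (rule Bochner_Integration.integral_mult_right_zero)
  also have "(CLINT s|\<nu>. complex_of_real (\<xi>\<^sup>2 / 2) * of_real (s ^ 2 * exp (- (w * s)))) = \<xi>\<^sup>2 / 2 * mom 2 w"
    unfolding of_real_mult[of "\<xi>\<^sup>2 / 2" "mom 2 w"] unfolding mom_def integral_complex_of_real[symmetric] by (rule Bochner_Integration.integral_mult_right_zero)
  finally have "norm (cphi (Complex w (- \<xi>)) - phi w + \<i> * \<xi> * mom 1 w - \<xi>\<^sup>2 / 2 * mom 2 w) \<le> (LINT s|\<nu>. norm (?q s))"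
    using integral_norm_bound[of \<nu> ?q] by simp
  also have "\<dots> \<le> (LINT s|\<nu>. \<bar>\<xi>\<bar> ^ 3 / 6 * (s ^ 3 * exp (- (w * s))))"
  proof (rule integral_mono_AE)
    show "integrable \<nu> (\<lambda>s. norm (?q s))" by (rule integrable_norm[OF iq])
    show "integrable \<nu> (\<lambda>s. \<bar>\<xi>\<bar> ^ 3 / 6 * (s ^ 3 * exp (- (w * s))))"
      by (intro integrable_mult_right integrable_mom w) simp
    show "AE s in \<nu>. norm (?q s) \<le> \<bar>\<xi>\<bar> ^ 3 / 6 * (s ^ 3 * exp (- (w * s)))"
      using pos
    proof eventually_elim
      case (elim s)
      let ?T = "\<Sum>k\<le>2. (\<i> * complex_of_real (\<xi> * s)) ^ k / fact k"
      have "- (Complex w (- \<xi>) * of_real s) = of_real (- (w * s)) + \<i> * of_real (\<xi> * s)"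
        by (simp add: complex_eq_iff)
      then have eE: "exp (- (Complex w (- \<xi>) * of_real s)) = of_real (exp (- (w * s))) * iexp (\<xi> * s)"
        by (simp only: exp_add exp_of_real)
      have eT: "?T = 1 + \<i> * (\<xi> * s) - of_real ((\<xi> * s)\<^sup>2 / 2)"
        by (simp add: eval_nat_numeral power_mult_distrib algebra_simps)
      have "?q s = - of_real (exp (- (w * s))) * (iexp (\<xi> * s) - ?T)"
        unfolding eE eT by (simp add: algebra_simps power_mult_distrib)
      then have "norm (?q s) = exp (- (w * s)) * norm (iexp (\<xi> * s) - ?T)"
        by (simp only: norm_mult norm_minus_cancel norm_of_real abs_exp_cancel)
      also have "\<dots> \<le> exp (- (w * s)) * (\<bar>\<xi> * s\<bar> ^ Suc 2 / fact (Suc 2))"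
        by (intro mult_left_mono iexp_approx1) auto
      also have "\<dots> = \<bar>\<xi>\<bar> ^ 3 / 6 * (s ^ 3 * exp (- (w * s)))"
        using elim by (simp add: abs_mult power_mult_distrib fact_numeral eval_nat_numeral)
      finally show ?case .
    qed
  qed
  also have "\<dots> = \<bar>\<xi>\<bar> ^ 3 / 6 * mom 3 w"
    unfolding mom_def by (rule Bochner_Integration.integral_mult_right_zero)
  finally show ?thesis .
qed

end

lemma tail_inverse_square:
  fixes a :: real
  assumes "0 < a"
  shows "has_bochner_integral lborel (\<lambda>x. indicator {x. a \<le> \<bar>x\<bar>} x * (a\<^sup>2 / x\<^sup>2)) (2 * a)"
proof (rule has_bochner_integral_nn_integral)
  have "(\<integral>\<^sup>+x. ennreal (indicator {x. a \<le> \<bar>x\<bar>} x * (a\<^sup>2 / x\<^sup>2)) \<partial>lborel)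
     = (\<integral>\<^sup>+x. ennreal ((\<bar>x\<bar> / a) powr (- (1 + 1))) * indicator {x. a \<le> \<bar>x\<bar>} x \<partial>lborel)"
  proof (rule nn_integral_cong)
    fix x :: real
    show "ennreal (indicator {x. a \<le> \<bar>x\<bar>} x * (a\<^sup>2 / x\<^sup>2)) = ennreal ((\<bar>x\<bar> / a) powr (- (1 + 1))) * indicator {x. a \<le> \<bar>x\<bar>} x"
    proof (cases "a \<le> \<bar>x\<bar>")
      case True
      then have "0 < \<bar>x\<bar> / a" using assms by simp
      then have "(\<bar>x\<bar> / a) powr (- (1 + 1)) = a\<^sup>2 / x\<^sup>2"
        using powr_numeral[of "\<bar>x\<bar> / a" "num.Bit0 num.One"] by (simp add: powr_minus power_divide)
      then show ?thesis using True by simp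
    qed simp
  qed
  also have "\<dots> = ennreal (2 * a)" using nn_integral_powr_tail[OF assms, of 1] by simp
  finally show "(\<integral>\<^sup>+x. ennreal (indicator {x. a \<le> \<bar>x\<bar>} x * (a\<^sup>2 / x\<^sup>2)) \<partial>lborel) = ennreal (2 * a)" .
qed (use assms in auto)

context scaled_levy_measure
begin

text \<open>The saddle-point estimate. Here \<open>x / mom 1 (M0 / x)\<close> is the time at which the law tilted by
  \<open>M0 / x\<close> has mean \<open>x\<close>. With \<open>\<rho> = \<bar>\<xi>\<bar> / w\<close> and \<open>N = t0 phi w\<close>, the frequencies with
  \<open>\<rho> \<le> R / sqrt N\<close> contribute a nonnegative amount, those with \<open>\<rho> \<le> 1 / sqrt N\<close> at least a
  multiple of \<open>w / sqrt N\<close>, and the others at most a multiple of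
  \<open>w / (R sqrt N)\<close>. The constant \<open>R\<close> is chosen first, to make the tail small; \<open>M0\<close> and \<open>\<epsilon>\<close>
  then control the cubic Taylor remainder and the drift of the mean.\<close>

lemma dens_ge:
  "\<exists>M0\<ge>1. \<exists>\<epsilon>>0. \<exists>\<kappa>>0. \<forall>x t. 0 < x \<longrightarrow> x0 < 1 / x \<longrightarrow> x / mom 1 (M0 / x) \<le> t \<longrightarrow>
     t \<le> (1 + \<epsilon>) * (x / mom 1 (M0 / x)) \<longrightarrow> integrable lborel (laplace_line t (M0 / x)) \<longrightarrow> \<kappa> / x \<le> dens t (M0 / x) x"
proof -
  obtain k where k: "0 < k" "\<And>u. x0 < u \<Longrightarrow> k * phi u \<le> u * mom 1 u" using mom_ge by auto
  obtain K n where K: "0 < K" "1 \<le> n" "\<And>u t \<xi>. x0 < u \<Longrightarrow> 0 < t \<Longrightarrow> \<xi> \<noteq> 0 \<Longrightarrow>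
      exp (- (t * (Re (cphi (Complex u \<xi>)) - phi u))) \<le> K * (1 / (t * phi u) + 1 / (t * phi u) ^ n) / (\<xi> / u)\<^sup>2"
    using exp_neg_Re_cphi_le by metis
  define R where "R = max 1 (16 * exp 2 * K)"
  define M0 where "M0 = (8 * R ^ 3)\<^sup>2"
  define S where "S = sqrt (M0 / k)"
  define \<epsilon> where "\<epsilon> = min 1 (1 / (4 * R * S))"
  define \<kappa> where "\<kappa> = exp (- (2 * (M0 / k))) / (2 * pi) * (M0 / (4 * exp 2 * S))"
  have R: "1 \<le> R" "16 * exp 2 * K \<le> R" by (auto simp: R_def)
  have R3: "1 \<le> 8 * R ^ 3" using one_le_power[OF R(1), of 3] by linarith
  have M0: "1 \<le> M0" using one_le_power[OF R3, of 2] by (simp add: M0_def)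
  have S: "0 < S" using M0 k(1) by (simp add: S_def)
  have eps: "0 < \<epsilon>" "\<epsilon> \<le> 1" "\<epsilon> \<le> 1 / (4 * R * S)" using R S by (auto simp: \<epsilon>_def)
  have kap: "0 < \<kappa>" using M0 S k(1) by (simp add: \<kappa>_def)
  have "\<kappa> / x \<le> dens t (M0 / x) x"
    if x: "0 < x" "x0 < 1 / x" and t1: "x / mom 1 (M0 / x) \<le> t"
      and t2: "t \<le> (1 + \<epsilon>) * (x / mom 1 (M0 / x))" and int: "integrable lborel (laplace_line t (M0 / x))" for x t
  proof -
    define w where "w = M0 / x"
    define t0 where "t0 = x / mom 1 w"
    define N where "N = t0 * phi w"
    define r where "r = sqrt N"
    have "1 / x \<le> w" using M0 x by (simp add: w_def divide_right_mono)
    then have w: "x0 < w" "0 < w" "w * x = M0" using x M0 by (auto simp: w_def)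
    note p = phi_pos[OF w(2)]
    have m: "0 < mom 1 w" by (rule mom_pos[OF w(1)])
    have t0: "0 < t0" "t0 * mom 1 w = x" using m x by (auto simp: t0_def)
    have t: "t0 \<le> t" "t \<le> (1 + \<epsilon>) * t0" using t1 t2 by (auto simp: t0_def w_def)
    have "t \<le> 2 * t0" using mult_right_mono[of "1 + \<epsilon>" 2 t0] t(2) eps t0 by linarith
    have "t0 * (w * mom 1 w) = w * (t0 * mom 1 w)" by (rule mult.left_commute)
    then have tw: "t0 * (w * mom 1 w) = M0" unfolding t0(2) w(3) .
    have "M0 \<le> N"
    proof -
      have "M0 = t0 * (w * mom 1 w)" by (rule tw[symmetric])
      also have "\<dots> \<le> t0 * phi w" using mom_le[OF w(2), of 1] t0 by (intro mult_left_mono) auto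
      finally show ?thesis by (simp add: N_def)
    qed
    have "N \<le> M0 / k"
    proof -
      have "k * N = t0 * (k * phi w)" by (simp add: N_def)
      also have "\<dots> \<le> t0 * (w * mom 1 w)" using k(2)[OF w(1)] t0 by (intro mult_left_mono) auto
      also have "\<dots> = M0" by (rule tw)
      finally show ?thesis using k(1) by (simp add: field_simps)
    qed
    have N: "1 \<le> N" using M0 \<open>M0 \<le> N\<close> by linarith
    have r: "8 * R ^ 3 \<le> r" "r \<le> S" "0 < r" "r\<^sup>2 = N" "1 \<le> r"
    proof -
      have "8 * R ^ 3 = sqrt M0" unfolding M0_def real_sqrt_abs using R3 by simp
      then show "8 * R ^ 3 \<le> r" using \<open>M0 \<le> N\<close> by (simp add: r_def)
      show "r \<le> S" using \<open>N \<le> M0 / k\<close> by (simp add: r_def S_def)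
      show "0 < r" "r\<^sup>2 = N" "1 \<le> r" using N by (auto simp: r_def)
    qed
    define E where "E = (\<lambda>\<xi>. t * (cphi (Complex w (- \<xi>)) - phi w) + \<i> * \<xi> * x)"
    define a where "a = (\<lambda>\<xi>. t * \<xi>\<^sup>2 / 2 * mom 2 w)"
    have a: "0 \<le> a \<xi>" "a \<xi> \<le> 2 * N * (\<xi> / w)\<^sup>2" for \<xi>
    proof -
      show "0 \<le> a \<xi>" using t t0 mom_nonneg by (simp add: a_def)
      have "a \<xi> = t / 2 * (w\<^sup>2 * mom 2 w) * (\<xi> / w)\<^sup>2" using w by (simp add: a_def power_divide)
      also have "\<dots> \<le> (2 * t0) / 2 * (2 * phi w) * (\<xi> / w)\<^sup>2"
      proof (rule mult_right_mono[OF mult_mono])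
        show "w\<^sup>2 * mom 2 w \<le> 2 * phi w" using mom_le[OF w(2), of 2] by (simp add: fact_numeral)
      qed (use \<open>t \<le> 2 * t0\<close> t0 mom_nonneg[of 2 w] in auto)
      finally show "a \<xi> \<le> 2 * N * (\<xi> / w)\<^sup>2" by (simp add: N_def mult_ac)
    qed
    \<comment> \<open>Around \<open>\<xi> = 0\<close> the exponent is nearly the nonnegative real number \<open>a \<xi>\<close>.\<close>
    have centre: "norm (E \<xi> - a \<xi>) \<le> 1 / 2" if xi: "\<bar>\<xi>\<bar> \<le> R * w / r" for \<xi>
    proof -
      define \<rho> where "\<rho> = \<bar>\<xi>\<bar> / w"
      have rho: "0 \<le> \<rho>" "\<bar>\<xi>\<bar> = \<rho> * w" using w by (auto simp: \<rho>_def)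
      have rho_le: "\<rho> * r \<le> R" using xi w r(3) by (simp add: \<rho>_def field_simps)
      have "E \<xi> - a \<xi> = t * (cphi (Complex w (- \<xi>)) - phi w + \<i> * \<xi> * mom 1 w - \<xi>\<^sup>2 / 2 * mom 2 w)
          + \<i> * \<xi> * of_real (x - t * mom 1 w)"
        by (simp add: E_def a_def algebra_simps)
      then have "norm (E \<xi> - a \<xi>) \<le> norm (t * (cphi (Complex w (- \<xi>)) - phi w + \<i> * \<xi> * mom 1 w - \<xi>\<^sup>2 / 2 * mom 2 w))
          + norm (\<i> * \<xi> * of_real (x - t * mom 1 w))"
        by (simp only: norm_triangle_ineq)
      also have "\<dots> = t * norm (cphi (Complex w (- \<xi>)) - phi w + \<i> * \<xi> * mom 1 w - \<xi>\<^sup>2 / 2 * mom 2 w)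
          + \<bar>\<xi>\<bar> * \<bar>x - t * mom 1 w\<bar>"
        using t t0 by (simp add: norm_mult del: of_real_diff of_real_mult)
      also have "\<dots> \<le> (2 * t0) * (\<bar>\<xi>\<bar> ^ 3 / 6 * mom 3 w) + \<bar>\<xi>\<bar> * (\<epsilon> * x)"
      proof (intro add_mono mult_mono)
        show "t \<le> 2 * t0" by fact
        show "norm (cphi (Complex w (- \<xi>)) - phi w + \<i> * \<xi> * mom 1 w - \<xi>\<^sup>2 / 2 * mom 2 w) \<le> \<bar>\<xi>\<bar> ^ 3 / 6 * mom 3 w"
          by (rule cphi_taylor[OF w(2)])
        have "t0 * mom 1 w \<le> t * mom 1 w" using t m by simp
        moreover have "t * mom 1 w \<le> (1 + \<epsilon>) * t0 * mom 1 w" using t(2) m by (intro mult_right_mono) auto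
        then have "t * mom 1 w \<le> (1 + \<epsilon>) * x" using t0(2) by (simp add: mult.assoc)
        ultimately show "\<bar>x - t * mom 1 w\<bar> \<le> \<epsilon> * x" using t0(2) by (simp add: abs_le_iff distrib_right)
      qed (use t0 in auto)
      also have "(2 * t0) * (\<bar>\<xi>\<bar> ^ 3 / 6 * mom 3 w) = t0 / 3 * \<rho> ^ 3 * (w ^ 3 * mom 3 w)"
        unfolding rho(2) by (simp add: power_mult_distrib)
      also have "\<dots> \<le> t0 / 3 * \<rho> ^ 3 * (6 * phi w)"
        using mom_le[OF w(2), of 3] t0 rho by (intro mult_left_mono) (auto simp: fact_numeral)
      also have "\<dots> = 2 * (\<rho> * r) ^ 3 / r"
        using r(3) by (simp add: N_def[symmetric] r(4)[symmetric] power_mult_distrib power2_eq_square power3_eq_cube)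
      also have "\<dots> \<le> 2 * R ^ 3 / r"
        using rho_le rho(1) r(3) by (intro divide_right_mono mult_left_mono power_mono) auto
      also have "\<dots> \<le> 1 / 4" using r(1,3) by (simp add: field_simps)
      also have "\<bar>\<xi>\<bar> * (\<epsilon> * x) = \<epsilon> * (\<rho> * M0)" unfolding rho(2) w(3)[symmetric] by simp
      also have "\<dots> \<le> \<epsilon> * (R * S)"
      proof (rule mult_left_mono)
        have "\<rho> * M0 \<le> \<rho> * (r * r)"
          using \<open>M0 \<le> N\<close> rho(1) r(4) by (intro mult_left_mono) (auto simp: power2_eq_square)
        also have "\<dots> = (\<rho> * r) * r" by simp
        also have "\<dots> \<le> R * S" using rho_le r R by (intro mult_mono) auto
        finally show "\<rho> * M0 \<le> R * S" .
      qed (use eps in auto)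
      also have "\<dots> \<le> 1 / (4 * R * S) * (R * S)" using eps R S by (intro mult_right_mono) auto
      also have "\<dots> = 1 / 4" using R S by simp
      finally show ?thesis by simp
    qed
    define b where "b = R * w / r"
    have b: "0 < b" using R w r by (simp add: b_def)
    have tail: "norm (exp (- E \<xi>)) \<le> 2 * K / R\<^sup>2 * (b\<^sup>2 / \<xi>\<^sup>2)" if "\<xi> \<noteq> 0" for \<xi>
    proof -
      have tN: "N \<le> t * phi w" using t p by (simp add: N_def)
      have le: "1 / (t * phi w) ^ j \<le> 1 / N" if "1 \<le> j" for j
      proof (rule divide_left_mono)
        have "N \<le> (t * phi w) ^ 1" using tN by simp
        also have "\<dots> \<le> (t * phi w) ^ j" using tN N that by (intro power_increasing) auto
        finally show "N \<le> (t * phi w) ^ j" .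
        show "0 < (t * phi w) ^ j * N" using N t t0 p by (intro mult_pos_pos zero_less_power) auto
      qed auto
      have "norm (exp (- E \<xi>)) = exp (- (t * (Re (cphi (Complex w (- \<xi>))) - phi w)))"
        by (simp add: E_def)
      also have "\<dots> \<le> K * (1 / (t * phi w) ^ 1 + 1 / (t * phi w) ^ n) / (\<xi> / w)\<^sup>2"
        using K(3)[OF w(1), of t "- \<xi>"] that t t0 by simp
      also have "\<dots> \<le> K * (1 / N + 1 / N) / (\<xi> / w)\<^sup>2"
        using le[of 1] le[OF K(2)] K(1) by (intro divide_right_mono mult_left_mono add_mono) auto
      also have "\<dots> = 2 * K / R\<^sup>2 * (b\<^sup>2 / \<xi>\<^sup>2)"
        using R w r(3) by (simp add: b_def r(4)[symmetric] power_divide power_mult_distrib field_simps)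
      finally show ?thesis .
    qed
    let ?L = "\<lambda>\<xi>. indicator {- (w / r)..w / r} \<xi> * (exp (- 2) / 4) - 2 * K / R\<^sup>2 * (indicator {x. b \<le> \<bar>x\<bar>} \<xi> * (b\<^sup>2 / \<xi>\<^sup>2))"
    \<comment> \<open>An explicit integrable minorant: a box at the centre minus an inverse square tail.\<close>
    have lower: "?L \<xi> \<le> Re (exp (- E \<xi>))" for \<xi>
    proof (cases "\<bar>\<xi>\<bar> \<le> b")
      case True
      have "exp (- a \<xi>) / 4 \<le> Re (exp (- (of_real (a \<xi>) + (E \<xi> - a \<xi>))))"
        using centre[of \<xi>] True a(1) by (intro Re_exp_neg_ge) (auto simp: b_def)
      then have 1: "exp (- a \<xi>) / 4 \<le> Re (exp (- E \<xi>))" by simp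
      have 2: "indicator {- (w / r)..w / r} \<xi> * (exp (- 2) / 4) \<le> exp (- a \<xi>) / 4"
      proof (cases "\<bar>\<xi>\<bar> \<le> w / r")
        case True
        have "a \<xi> \<le> 2 * (r * (\<bar>\<xi>\<bar> / w))\<^sup>2" using a(2)[of \<xi>] by (simp add: r(4)[symmetric] power_mult_distrib power_divide)
        also have "\<dots> \<le> 2 * 1\<^sup>2"
          using True w r(3) by (intro mult_left_mono power_mono) (auto simp: field_simps)
        finally show ?thesis by (simp add: indicator_def)
      qed (auto simp: indicator_def abs_le_iff)
      have 3: "0 \<le> 2 * K / R\<^sup>2 * (indicator {x. b \<le> \<bar>x\<bar>} \<xi> * (b\<^sup>2 / \<xi>\<^sup>2))"
        using K(1) by simp
      show ?thesis using 1 2 3 by linarith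
    next
      case False
      then have "\<xi> \<noteq> 0" using b by auto
      have "w / r \<le> b" using R w r by (simp add: b_def field_simps)
      then have "?L \<xi> = - (2 * K / R\<^sup>2 * (b\<^sup>2 / \<xi>\<^sup>2))" using False by (auto simp: indicator_def)
      also have "\<dots> \<le> - norm (exp (- E \<xi>))" using tail[OF \<open>\<xi> \<noteq> 0\<close>] by simp
      also have "\<dots> \<le> Re (exp (- E \<xi>))" using abs_Re_le_cmod[of "exp (- E \<xi>)"] by linarith
      finally show ?thesis .
    qed
    have EH: "exp (- E \<xi>) = exp (t * phi w) * (iexp (- (\<xi> * x)) * laplace_line t w \<xi>)" for \<xi>
      by (simp add: E_def laplace_line_def exp_of_real[symmetric] exp_add[symmetric] algebra_simps)
    have iE: "integrable lborel (\<lambda>\<xi>. exp (- E \<xi>))"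
      unfolding EH using int by (intro integrable_mult_right integrable_fourier_inv) (simp add: w_def)
    have hL1: "has_bochner_integral lborel (\<lambda>\<xi>. indicator {- (w / r)..w / r} \<xi> * (exp (- 2) / 4)) (2 * (w / r) * (exp (- 2) / 4))"
    proof (rule has_bochner_integral_mult_left)
      have "has_bochner_integral lborel (indicator {- (w / r)..w / r}) (measure lborel {- (w / r)..w / r})"
        by (rule has_bochner_integral_real_indicator) (auto simp: emeasure_lborel_Icc_eq)
      then show "has_bochner_integral lborel (indicator {- (w / r)..w / r}) (2 * (w / r))"
        using w r by simp
    qed
    have hL: "has_bochner_integral lborel ?L (2 * (w / r) * (exp (- 2) / 4) - 2 * K / R\<^sup>2 * (2 * b))"
      by (intro has_bochner_integral_diff hL1 has_bochner_integral_mult_right tail_inverse_square b)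
    have "w / (4 * exp 2 * r) \<le> 2 * (w / r) * (exp (- 2) / 4) - 2 * K / R\<^sup>2 * (2 * b)"
    proof -
      have "2 * K / R\<^sup>2 * (2 * b) = 4 * K / R * (w / r)" using R by (simp add: b_def power2_eq_square)
      also have "\<dots> \<le> exp (- 2) / 4 * (w / r)"
      proof (rule mult_right_mono)
        have "4 * K * (4 * exp 2) \<le> R" using R(2) by (simp add: mult_ac)
        then show "4 * K / R \<le> exp (- 2) / 4" using R(1) by (simp add: exp_minus field_simps)
      qed (use w r in auto)
      finally show ?thesis using r by (simp add: exp_minus field_simps)
    qed
    also have "\<dots> = (LINT \<xi>|lborel. ?L \<xi>)" using hL by (simp add: has_bochner_integral_iff)
    also have "\<dots> \<le> (LINT \<xi>|lborel. Re (exp (- E \<xi>)))"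
      using hL iE lower by (intro integral_mono) (auto simp: has_bochner_integral_iff)
    also have "\<dots> = Re (CLINT \<xi>|lborel. exp (- E \<xi>))" by (rule integral_Re[OF iE])
    also have "(CLINT \<xi>|lborel. exp (- E \<xi>)) = exp (t * phi w) * (CLINT \<xi>|lborel. iexp (- (\<xi> * x)) * laplace_line t w \<xi>)"
      unfolding EH by (rule Bochner_Integration.integral_mult_right_zero)
    also have "\<dots> = exp (t * phi w) * (2 * pi * fourier_inv (laplace_line t w) x)" by (simp add: fourier_inv_def)
    also have "Re \<dots> = 2 * pi * exp (t * phi w) * Re (fourier_inv (laplace_line t w) x)" by simp
    finally have main: "w / (4 * exp 2 * r) \<le> 2 * pi * exp (t * phi w) * Re (fourier_inv (laplace_line t w) x)" .
    have "\<kappa> / x = exp (- (2 * (M0 / k))) / (2 * pi) * (w / (4 * exp 2 * S))"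
      by (simp add: \<kappa>_def w_def)
    also have "\<dots> \<le> exp (- (t * phi w)) / (2 * pi) * (w / (4 * exp 2 * r))"
    proof (intro mult_mono divide_right_mono divide_left_mono)
      have "t * phi w \<le> 2 * t0 * phi w" using \<open>t \<le> 2 * t0\<close> p by (intro mult_right_mono) auto
      also have "\<dots> \<le> 2 * (M0 / k)" using \<open>N \<le> M0 / k\<close> by (simp add: N_def)
      finally show "exp (- (2 * (M0 / k))) \<le> exp (- (t * phi w))" by simp
    qed (use w r S in auto)
    also have "\<dots> \<le> exp (- (t * phi w)) / (2 * pi) * (2 * pi * exp (t * phi w) * Re (fourier_inv (laplace_line t w) x))"
      by (intro mult_left_mono main) auto
    also have "\<dots> = Re (fourier_inv (laplace_line t w) x)" by (simp add: exp_minus)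
    also have "\<dots> \<le> dens t w x"
    proof -
      have "0 \<le> Re (fourier_inv (laplace_line t w) x)"
      proof (rule ccontr)
        assume "\<not> 0 \<le> Re (fourier_inv (laplace_line t w) x)"
        then have "2 * pi * exp (t * phi w) * Re (fourier_inv (laplace_line t w) x) < 0" by (simp add: mult_pos_neg)
        moreover have "0 < w / (4 * exp 2 * r)" using w r by simp
        ultimately show False using main by linarith
      qed
      moreover have "1 \<le> exp (w * x)" using w M0 by simp
      ultimately show ?thesis unfolding dens_def by (simp add: mult_le_cancel_right1)
    qed
    finally show ?thesis by (simp add: w_def)
  qed
  then show ?thesis using M0 eps(1) kap by blast
qed

end

section \<open>Decay of the derivative of the Laplace exponent\<close>

context levy_measure
begin

text \<open>Shifting the integration variable by the half-period \<open>h = pi / \<bar>\<xi>\<bar>\<close> changes the sign of the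
  oscillating factor, so that twice the integral is bounded by the integral of \<open>\<bar>G s - G (h + s)\<bar>\<close>.
  Since the density decreases, \<open>G (h + s) \<le> G s + W (h + s)\<close>, and the integrals of \<open>G s\<close>
  and \<open>G (h + s)\<close> cancel; what remains is an integral of \<open>min s h\<close> against the Levy
  measure.\<close>

lemma norm_cphi'_le_of_antimono_density:
  assumes f[measurable]: "f \<in> borel_measurable borel" and nn: "\<And>s. 0 < s \<Longrightarrow> 0 \<le> f s"
    and anti: "antimono_on {0<..} f"
    and nu: "\<nu> = density lborel (\<lambda>s. ennreal (f s) * indicator {0<..} s)"
    and u: "0 < u" and xi: "\<xi> \<noteq> 0"
  shows "norm (cphi' (Complex u \<xi>)) \<le> 2 * pi * phi \<bar>\<xi>\<bar> / \<bar>\<xi>\<bar>"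
proof -
  define F where "F = (\<lambda>s. indicator {0<..} s * f s)"
  have F0: "0 \<le> F s" for s using nn by (auto simp: F_def indicator_def)
  have [measurable]: "F \<in> borel_measurable borel" unfolding F_def by measurable
  have nuF: "\<nu> = density lborel (\<lambda>s. ennreal (F s))"
    unfolding nu by (intro density_cong) (auto simp: F_def indicator_def)
  define h where "h = pi / \<bar>\<xi>\<bar>"
  have h: "0 < h" using xi by (simp add: h_def)
  define G where "G = (\<lambda>s. F s * (s * exp (- (u * s))))"
  define W where "W = (\<lambda>s. F s * (min s h * exp (- (u * s))))"
  have G0: "0 \<le> G s" for s by (auto simp: G_def F_def indicator_def intro!: mult_nonneg_nonneg nn)
  have W0: "0 \<le> W s" for s using h by (auto simp: W_def F_def indicator_def intro!: mult_nonneg_nonneg nn)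
  have [measurable]: "G \<in> borel_measurable borel" "W \<in> borel_measurable borel"
    unfolding G_def W_def by measurable
  have dens_int: "integrable \<nu> g \<longleftrightarrow> integrable lborel (\<lambda>s. F s * g s)"
    if [measurable]: "g \<in> borel_measurable borel" for g :: "real \<Rightarrow> real"
    unfolding nuF using F0 by (subst integrable_density) auto
  have iG: "integrable lborel G"
    using integrable_mom[OF u order.refl] by (simp add: dens_int G_def)
  have iW: "integrable lborel W"
  proof (rule Bochner_Integration.integrable_bound[OF iG])
    show "AE s in lborel. norm (W s) \<le> norm (G s)"
    proof (rule AE_I2)
      fix s
      have "W s \<le> G s" by (auto simp: W_def G_def F_def indicator_def intro!: mult_left_mono mult_right_mono nn)
      then show "norm (W s) \<le> norm (G s)" using W0[of s] G0[of s] by simp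
    qed
  qed measurable
  have shift: "integrable lborel (\<lambda>s. G (h + s))" "integrable lborel (\<lambda>s. W (h + s))"
    "(LINT s|lborel. G (h + s)) = (LINT s|lborel. G s)" "(LINT s|lborel. W (h + s)) = (LINT s|lborel. W s)"
    using lborel_integrable_real_affine[OF iG, of 1 h] lborel_integrable_real_affine[OF iW, of 1 h]
      lborel_integral_real_affine[of 1 G h] lborel_integral_real_affine[of 1 W h] by auto
  have iGe: "integrable lborel (\<lambda>s. of_real (G s) * iexp (- (\<xi> * s)))"
    by (rule Bochner_Integration.integrable_bound[OF iG]) (auto simp: norm_mult)
  have iGhe: "integrable lborel (\<lambda>s. of_real (G (h + s)) * iexp (- (\<xi> * s)))"
    by (rule Bochner_Integration.integrable_bound[OF shift(1)]) (auto simp: norm_mult)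
  have "cphi' (Complex u \<xi>) = (CLINT s|lborel. F s *\<^sub>R (of_real s * exp (- (Complex u \<xi> * of_real s))))"
    unfolding cphi'_def unfolding nuF using F0 by (subst integral_density) auto
  also have "\<dots> = (CLINT s|lborel. of_real (G s) * iexp (- (\<xi> * s)))"
  proof (rule Bochner_Integration.integral_cong[OF refl])
    fix s
    have "- (Complex u \<xi> * of_real s) = of_real (- (u * s)) + \<i> * of_real (- (\<xi> * s))"
      by (simp add: complex_eq_iff)
    then have "exp (- (Complex u \<xi> * of_real s)) = of_real (exp (- (u * s))) * iexp (- (\<xi> * s))"
      by (simp only: exp_add exp_of_real)
    then show "F s *\<^sub>R (of_real s * exp (- (Complex u \<xi> * of_real s))) = of_real (G s) * iexp (- (\<xi> * s))"
      by (simp add: G_def scaleR_conv_of_real mult.assoc)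
  qed
  finally have J: "cphi' (Complex u \<xi>) = (CLINT s|lborel. of_real (G s) * iexp (- (\<xi> * s)))" .
  \<comment> \<open>A shift by \<open>h\<close> is half a period of the oscillating factor.\<close>
  have half: "iexp (- (\<xi> * (h + s))) = - iexp (- (\<xi> * s))" for s
  proof -
    have "\<xi> * h = pi \<or> \<xi> * h = - pi" using xi by (auto simp: h_def abs_if)
    moreover have "iexp (- pi) = -1" "iexp (- (- pi)) = -1"
      by (simp_all add: exp_minus)
    ultimately have "iexp (- (\<xi> * h)) = -1" by metis
    moreover have "iexp (- (\<xi> * (h + s))) = iexp (- (\<xi> * h)) * iexp (- (\<xi> * s))"
      by (simp add: exp_add[symmetric] algebra_simps)
    ultimately show ?thesis by simp
  qed
  have "cphi' (Complex u \<xi>) = (CLINT s|lborel. of_real (G (h + s)) * iexp (- (\<xi> * (h + s))))"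
    unfolding J using lborel_integral_real_affine[of 1 "\<lambda>s. of_real (G s) * iexp (- (\<xi> * s))" h] by simp
  then have J2: "cphi' (Complex u \<xi>) = - (CLINT s|lborel. of_real (G (h + s)) * iexp (- (\<xi> * s)))"
    unfolding half by simp
  have "2 * cphi' (Complex u \<xi>) = (CLINT s|lborel. of_real (G s) * iexp (- (\<xi> * s)))
      - (CLINT s|lborel. of_real (G (h + s)) * iexp (- (\<xi> * s)))"
    using J J2 by simp
  also have "\<dots> = (CLINT s|lborel. of_real (G s) * iexp (- (\<xi> * s)) - of_real (G (h + s)) * iexp (- (\<xi> * s)))"
    by (rule Bochner_Integration.integral_diff[symmetric, OF iGe iGhe])
  finally have "norm (2 * cphi' (Complex u \<xi>)) \<le>
      (LINT s|lborel. norm (of_real (G s) * iexp (- (\<xi> * s)) - of_real (G (h + s)) * iexp (- (\<xi> * s))))"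
    by (simp only: integral_norm_bound)
  also have "\<dots> \<le> (LINT s|lborel. G s - G (h + s) + 2 * W (h + s))"
  proof (rule integral_mono)
    show "integrable lborel (\<lambda>s. norm (of_real (G s) * iexp (- (\<xi> * s)) - of_real (G (h + s)) * iexp (- (\<xi> * s))))"
      by (rule integrable_norm[OF Bochner_Integration.integrable_diff[OF iGe iGhe]])
    show "integrable lborel (\<lambda>s. G s - G (h + s) + 2 * W (h + s))"
      using iG shift by auto
    fix s
    have "norm (of_real (G s) * iexp (- (\<xi> * s)) - of_real (G (h + s)) * iexp (- (\<xi> * s))) = \<bar>G s - G (h + s)\<bar>"
      by (simp only: left_diff_distrib[symmetric] of_real_diff[symmetric] norm_mult norm_of_real norm_exp_i_times mult_1_right)
    also have "\<dots> \<le> G s - G (h + s) + 2 * W (h + s)"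
    proof -
      have "G (h + s) \<le> G s + W (h + s)"
      proof (cases "0 < s")
        case True
        have "F (h + s) \<le> F s"
          using monotone_onD[OF anti, of s "h + s"] True h by (simp add: F_def)
        then have "F (h + s) * exp (- (u * (h + s))) \<le> F s * exp (- (u * s))"
          using F0 u h by (intro mult_mono) (auto simp: algebra_simps)
        then have "s * (F (h + s) * exp (- (u * (h + s)))) \<le> s * (F s * exp (- (u * s)))"
          using True by (intro mult_left_mono) auto
        then show ?thesis using True by (simp add: G_def W_def algebra_simps)
      next
        case False
        then have "G s = 0" "G (h + s) \<le> W (h + s)"
          by (auto simp: G_def W_def F_def)
        then show ?thesis by simp
      qed
      then show ?thesis using W0[of "h + s"] by (auto simp: abs_if)
    qed
    finally show "norm (of_real (G s) * iexp (- (\<xi> * s)) - of_real (G (h + s)) * iexp (- (\<xi> * s)))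
        \<le> G s - G (h + s) + 2 * W (h + s)" .
  qed
  also have "\<dots> = 2 * (LINT s|lborel. W s)"
    using iG shift by simp
  finally have "norm (cphi' (Complex u \<xi>)) \<le> (LINT s|lborel. W s)"
    by (simp add: norm_mult)
  also have "\<dots> \<le> (LINT s|lborel. F s * (2 * h * (1 - exp (- (1 / h * s)))))"
  proof (rule integral_mono[OF iW])
    show "integrable lborel (\<lambda>s. F s * (2 * h * (1 - exp (- (1 / h * s)))))"
      using integrable_mult_right[OF integrable_phi[of "1 / h"], of "2 * h"] h
      by (subst dens_int[of "\<lambda>s. 2 * h * (1 - exp (- (1 / h * s)))", symmetric]) auto
    fix s
    show "W s \<le> F s * (2 * h * (1 - exp (- (1 / h * s))))"
    proof (cases "0 < s")
      case True
      have "min s h * exp (- (u * s)) \<le> min s h * 1"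
        using True h u by (intro mult_left_mono) auto
      also have "\<dots> = h * min 1 (1 / h * s)" using h by (auto simp: min_def field_simps)
      also have "\<dots> \<le> h * (2 * (1 - exp (- (1 / h * s))))"
        using True h by (intro mult_left_mono min_le_one_minus_exp_neg) auto
      finally show ?thesis unfolding W_def using F0 by (intro mult_left_mono) (auto simp: mult_ac)
    qed (simp add: W_def F_def)
  qed
  also have "\<dots> = (LINT s|\<nu>. 2 * h * (1 - exp (- (1 / h * s))))"
    unfolding nuF using F0 by (subst integral_density) auto
  also have "\<dots> = 2 * h * phi (1 / h)"
    unfolding phi_def by (rule Bochner_Integration.integral_mult_right_zero)
  also have "\<dots> \<le> 2 * h * phi \<bar>\<xi>\<bar>"
  proof -
    have "1 / h \<le> \<bar>\<xi>\<bar>" using mult_left_mono[of 1 pi "\<bar>\<xi>\<bar>"] pi_gt3 by (simp add: h_def divide_le_eq)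
    then show ?thesis using h by (intro mult_left_mono phi_mono) auto
  qed
  also have "\<dots> = 2 * pi * phi \<bar>\<xi>\<bar> / \<bar>\<xi>\<bar>" by (simp add: h_def)
  finally show ?thesis .
qed

text \<open>A nondecreasing density is only compatible with finite mass near infinity if it vanishes.\<close>

lemma mono_density_eq_0:
  assumes f[measurable]: "f \<in> borel_measurable borel" and nn: "\<And>s. 0 < s \<Longrightarrow> 0 \<le> f s"
    and mono: "mono_on {0<..} f"
    and nu: "\<nu> = density lborel (\<lambda>s. ennreal (f s) * indicator {0<..} s)"
    and s: "0 < s"
  shows "f s = 0"
proof (rule ccontr)
  assume "f s \<noteq> 0"
  then have fs: "0 < f s" using nn[OF s] by simp
  define d where "d = max 1 s"
  have "emeasure lborel {d..} = \<infinity>"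
  proof -
    have "ennreal (real n) \<le> emeasure lborel {d..}" for n
    proof -
      have "emeasure lborel {d..d + real n} \<le> emeasure lborel {d..}" by (rule emeasure_mono) auto
      then show ?thesis by simp
    qed
    then have "\<not> emeasure lborel {d..} < \<infinity>"
      by (metis ennreal_less_iff ennreal_of_nat_eq_real_of_nat infinity_ennreal_def less_top not_le ennreal_Ex_less_of_nat)
    then show ?thesis by (simp add: less_top[symmetric])
  qed
  then have "\<infinity> = ennreal (f s) * emeasure lborel {d..}" using fs by (simp add: ennreal_mult_top)
  also have "\<dots> = (\<integral>\<^sup>+x. ennreal (f s) * indicator {d..} x \<partial>lborel)"
    by (rule nn_integral_cmult_indicator[symmetric]) simp
  also have "\<dots> \<le> (\<integral>\<^sup>+x. (ennreal (f x) * indicator {0<..} x) * ennreal (min 1 x) \<partial>lborel)"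
  proof (rule nn_integral_mono)
    fix x :: real
    show "ennreal (f s) * indicator {d..} x \<le> (ennreal (f x) * indicator {0<..} x) * ennreal (min 1 x)"
    proof (cases "d \<le> x")
      case True
      then have "f s \<le> f x" using s by (intro monotone_onD[OF mono]) (auto simp: d_def)
      then show ?thesis using True by (auto simp: d_def min_def intro: ennreal_leI)
    qed simp
  qed
  also have "\<dots> = (\<integral>\<^sup>+x. ennreal (min 1 x) \<partial>\<nu>)"
    unfolding nu by (subst nn_integral_density) auto
  also have "\<dots> = ennreal (LINT x|\<nu>. min 1 x)"
    using pos by (intro nn_integral_eq_integral integrable_min) (auto elim!: eventually_mono)
  finally show False by (simp add: top_unique)
qed

end

context scaled_levy_measure
begin

text \<open>The estimate of the derivative of the Laplace exponent on which the upper bound rests, written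
  without divisions by \<open>phi\<close>.\<close>

definition deriv_decay :: "real \<Rightarrow> real \<Rightarrow> bool" where
  "deriv_decay D \<delta> \<longleftrightarrow> 0 < D \<and> 0 < \<delta> \<and> (\<forall>u \<xi>. x0 < u \<longrightarrow> u \<le> \<bar>\<xi>\<bar> \<longrightarrow>
      norm (cphi' (Complex u \<xi>)) * (u * phi u) \<le> D * (phi \<bar>\<xi>\<bar>)\<^sup>2 * (\<bar>\<xi>\<bar> / u) powr (- (1 + \<delta>)))"

lemma phi_abs_ge:
  assumes "x0 < u" "u \<le> \<bar>\<xi>\<bar>"
  shows "phi u \<le> phi \<bar>\<xi>\<bar> / c * (\<bar>\<xi>\<bar> / u) powr (- \<alpha>)"
proof -
  have u: "0 < u" using assms params by linarith
  have "c * (\<bar>\<xi>\<bar> / u) powr \<alpha> * phi u \<le> phi (\<bar>\<xi>\<bar> / u * u)"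
    using assms u by (intro lower) auto
  then show ?thesis using u assms params by (simp add: powr_minus field_simps)
qed

lemma deriv_decay_of_half_less:
  assumes "1 / 2 < \<alpha>"
  shows "\<exists>D \<delta>. deriv_decay D \<delta>"
proof -
  have "deriv_decay (1 / c\<^sup>2) (2 * \<alpha> - 1)"
    unfolding deriv_decay_def
  proof (intro conjI allI impI)
    fix u \<xi> assume u: "x0 < u" and xi: "u \<le> \<bar>\<xi>\<bar>"
    have u0: "0 < u" using u params by linarith
    have "u * norm (cphi' (Complex u \<xi>)) \<le> u * mom 1 u"
      using norm_cphi'_le[of "Complex u \<xi>"] u0 by (intro mult_left_mono) auto
    also have "\<dots> \<le> phi u" using mom_le[OF u0, of 1] by simp
    finally have "norm (cphi' (Complex u \<xi>)) * (u * phi u) \<le> phi u * phi u"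
      using phi_nonneg[of u] u0 mult_right_mono by (fastforce simp: mult_ac)
    also have "\<dots> \<le> (phi \<bar>\<xi>\<bar> / c * (\<bar>\<xi>\<bar> / u) powr (- \<alpha>)) * (phi \<bar>\<xi>\<bar> / c * (\<bar>\<xi>\<bar> / u) powr (- \<alpha>))"
      using phi_abs_ge[OF u xi] phi_nonneg[of u] u0 by (intro mult_mono) auto
    also have "\<dots> = 1 / c\<^sup>2 * (phi \<bar>\<xi>\<bar>)\<^sup>2 * ((\<bar>\<xi>\<bar> / u) powr (- \<alpha>) * (\<bar>\<xi>\<bar> / u) powr (- \<alpha>))"
      by (simp add: power2_eq_square)
    also have "(\<bar>\<xi>\<bar> / u) powr (- \<alpha>) * (\<bar>\<xi>\<bar> / u) powr (- \<alpha>) = (\<bar>\<xi>\<bar> / u) powr (- (1 + (2 * \<alpha> - 1)))"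
      unfolding powr_add[symmetric] by simp
    finally show "norm (cphi' (Complex u \<xi>)) * (u * phi u) \<le> 1 / c\<^sup>2 * (phi \<bar>\<xi>\<bar>)\<^sup>2 * (\<bar>\<xi>\<bar> / u) powr (- (1 + (2 * \<alpha> - 1)))" .
  qed (use assms params in auto)
  then show ?thesis by blast
qed

lemma deriv_decay_of_deriv_le:
  assumes le: "\<And>u \<xi>. 0 < u \<Longrightarrow> \<xi> \<noteq> 0 \<Longrightarrow> norm (cphi' (Complex u \<xi>)) \<le> 2 * pi * phi \<bar>\<xi>\<bar> / \<bar>\<xi>\<bar>"
  shows "\<exists>D \<delta>. deriv_decay D \<delta>"
proof -
  have "deriv_decay (2 * pi / c) \<alpha>"
    unfolding deriv_decay_def
  proof (intro conjI allI impI)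
    fix u \<xi> assume u: "x0 < u" and xi: "u \<le> \<bar>\<xi>\<bar>"
    have u0: "0 < u" using u params by linarith
    have p: "0 \<le> phi \<bar>\<xi>\<bar>" by (rule phi_nonneg) simp
    have "norm (cphi' (Complex u \<xi>)) * (u * phi u)
        \<le> (2 * pi * phi \<bar>\<xi>\<bar> / \<bar>\<xi>\<bar>) * (u * (phi \<bar>\<xi>\<bar> / c * (\<bar>\<xi>\<bar> / u) powr (- \<alpha>)))"
      using phi_abs_ge[OF u xi] phi_nonneg[of u] u0 xi p by (intro mult_mono le) auto
    also have "\<dots> = 2 * pi / c * (phi \<bar>\<xi>\<bar>)\<^sup>2 * ((\<bar>\<xi>\<bar> / u) powr (- 1) * (\<bar>\<xi>\<bar> / u) powr (- \<alpha>))"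
      using u0 xi by (simp add: power2_eq_square powr_minus_divide mult_ac)
    also have "(\<bar>\<xi>\<bar> / u) powr (- 1) * (\<bar>\<xi>\<bar> / u) powr (- \<alpha>) = (\<bar>\<xi>\<bar> / u) powr (- (1 + \<alpha>))"
      unfolding powr_add[symmetric] by simp
    finally show "norm (cphi' (Complex u \<xi>)) * (u * phi u) \<le> 2 * pi / c * (phi \<bar>\<xi>\<bar>)\<^sup>2 * (\<bar>\<xi>\<bar> / u) powr (- (1 + \<alpha>))" .
  qed (use params in auto)
  then show ?thesis by blast
qed

end

section \<open>Two-sided bounds of the potential density\<close>

context scaled_levy_measure
begin

text \<open>Here \<open>p t\<close> is the continuous density at time \<open>t\<close>; the integral over \<open>t\<close> is bounded from both sides
  without any measurability of \<open>p\<close> in \<open>t\<close>.\<close>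

lemma green_bounds:
  assumes decay: "\<exists>D \<delta>. deriv_decay D \<delta>"
    and law: "\<And>t. 0 < t \<Longrightarrow> levy_law \<nu> (\<mu> t) t"
    and p: "\<And>t u x. 0 < t \<Longrightarrow> x0 < u \<Longrightarrow> p t x = dens t u x"
  shows "\<exists>C1\<ge>1. \<forall>x>0. x0 < 1 / x \<longrightarrow>
      ennreal (inverse C1 * (1 / (x * phi (1 / x)))) \<le> (\<integral>\<^sup>+t\<in>{0<..}. ennreal (p t x) \<partial>lborel) \<and>
      (\<integral>\<^sup>+t\<in>{0<..}. ennreal (p t x) \<partial>lborel) \<le> ennreal (C1 * (1 / (x * phi (1 / x))))"
proof -
  have slaw: "scaled_levy_law \<nu> \<alpha> \<beta> c C x0 (\<mu> t) t" if "0 < t" for t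
    using law[OF that] by (intro scaled_levy_law.intro) (rule scaled_levy_measure_axioms)
  obtain D \<delta> where D: "deriv_decay D \<delta>" using decay by blast
  have "\<exists>K>0. \<forall>u>x0. (\<integral>\<^sup>+\<xi>. ennreal (norm (cphi' (Complex u (- \<xi>))) / (Re (cphi (Complex u (- \<xi>))))\<^sup>2) \<partial>lborel)
      \<le> ennreal (K / phi u)"
    using D unfolding deriv_decay_def by (intro nn_integral_frequency[of D \<delta>]) auto
  then obtain K where K: "0 < K" "\<And>u. x0 < u \<Longrightarrow>
      (\<integral>\<^sup>+\<xi>. ennreal (norm (cphi' (Complex u (- \<xi>))) / (Re (cphi (Complex u (- \<xi>))))\<^sup>2) \<partial>lborel) \<le> ennreal (K / phi u)"
    by blast
  obtain M0 \<epsilon> \<kappa> where low: "1 \<le> M0" "0 < \<epsilon>" "0 < \<kappa>"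
    "\<And>x t. 0 < x \<Longrightarrow> x0 < 1 / x \<Longrightarrow> x / mom 1 (M0 / x) \<le> t \<Longrightarrow>
       t \<le> (1 + \<epsilon>) * (x / mom 1 (M0 / x)) \<Longrightarrow> integrable lborel (laplace_line t (M0 / x)) \<Longrightarrow> \<kappa> / x \<le> dens t (M0 / x) x"
    using dens_ge by blast
  define C1 where "C1 = max 1 (max (exp 1 / (2 * pi) * K) (1 / (\<epsilon> * \<kappa>)))"
  have C1: "1 \<le> C1" "exp 1 / (2 * pi) * K \<le> C1" "1 / (\<epsilon> * \<kappa>) \<le> C1" by (auto simp: C1_def)
  have "ennreal (inverse C1 * (1 / (x * phi (1 / x)))) \<le> (\<integral>\<^sup>+t\<in>{0<..}. ennreal (p t x) \<partial>lborel)"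
    "(\<integral>\<^sup>+t\<in>{0<..}. ennreal (p t x) \<partial>lborel) \<le> ennreal (C1 * (1 / (x * phi (1 / x))))"
    if x: "0 < x" "x0 < 1 / x" for x
  proof -
    define u where "u = 1 / x"
    have u: "x0 < u" "0 < u" using x by (auto simp: u_def)
    note pu = phi_pos[OF u(2)]
    note [measurable] = borel_measurable_cphi_line[OF u(2)]
    show "(\<integral>\<^sup>+t\<in>{0<..}. ennreal (p t x) \<partial>lborel) \<le> ennreal (C1 * (1 / (x * phi (1 / x))))"
    proof -
      let ?I = "\<lambda>t. (\<integral>\<^sup>+\<xi>. ennreal (norm (cphi' (Complex u (- \<xi>))) * (t * exp (- (t * Re (cphi (Complex u (- \<xi>))))))) \<partial>lborel)"
      have "(\<integral>\<^sup>+t\<in>{0<..}. ennreal (p t x) \<partial>lborel)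
        \<le> (\<integral>\<^sup>+t. ennreal (exp 1 / (2 * pi) / x) * (?I t * indicator {0<..} t) \<partial>lborel)"
      proof (rule nn_integral_mono)
        fix t :: real
        show "ennreal (p t x) * indicator {0<..} t \<le> ennreal (exp 1 / (2 * pi) / x) * (?I t * indicator {0<..} t)"
        proof (cases "0 < t")
          case True
          have "ennreal (p t x) = ennreal (1 / x) * ennreal (x * dens t (1 / x) x)"
            using x p[OF True x(2), of x] by (simp add: ennreal_mult'[symmetric])
          also have "\<dots> \<le> ennreal (1 / x) * (ennreal (exp 1 / (2 * pi)) * ?I t)"
            using scaled_levy_law.dens_le[OF slaw[OF True] x] unfolding u_def by (intro mult_left_mono) auto
          also have "\<dots> = ennreal (1 / x * (exp 1 / (2 * pi))) * ?I t"
            using x by (subst ennreal_mult) (auto simp: mult.assoc)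
          also have "1 / x * (exp 1 / (2 * pi)) = exp 1 / (2 * pi) / x" by simp
          finally show ?thesis using True by simp
        qed simp
      qed
      also have "\<dots> = ennreal (exp 1 / (2 * pi) / x) * (\<integral>\<^sup>+t. ?I t * indicator {0<..} t \<partial>lborel)"
        by (intro nn_integral_cmult) measurable
      also have "\<dots> \<le> ennreal (exp 1 / (2 * pi) / x) * ennreal (K / phi u)"
        unfolding nn_integral_time[OF u(2)] by (intro mult_left_mono K u) auto
      also have "\<dots> = ennreal (exp 1 / (2 * pi) * K * (1 / (x * phi u)))"
        using x K(1) pu by (simp add: ennreal_mult[symmetric] mult_ac)
      also have "\<dots> \<le> ennreal (C1 * (1 / (x * phi u)))"
        using C1(2) x pu by (intro ennreal_leI mult_right_mono) auto
      finally show ?thesis by (simp add: u_def)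
    qed
    show "ennreal (inverse C1 * (1 / (x * phi (1 / x)))) \<le> (\<integral>\<^sup>+t\<in>{0<..}. ennreal (p t x) \<partial>lborel)"
    proof -
      define w where "w = M0 / x"
      define t0 where "t0 = x / mom 1 w"
      have "u \<le> w" using low(1) x by (simp add: w_def u_def divide_right_mono)
      then have w: "x0 < w" "0 < w" using u by auto
      have m: "0 < mom 1 w" by (rule mom_pos[OF w(1)])
      have t0: "0 < t0" using m x by (simp add: t0_def)
      have "1 / phi u \<le> t0"
      proof -
        have "w * mom 1 w \<le> phi w" using mom_le[OF w(2), of 1] by simp
        also have "phi w \<le> M0 * phi u"
          using phi_mult_le[of u M0] u low(1) by (simp add: w_def u_def)
        finally have "mom 1 w \<le> x * phi u" using low(1) x by (simp add: w_def field_simps)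
        then have "1 / (phi u) \<le> x / mom 1 w" using m pu x by (simp add: field_simps)
        then show ?thesis by (simp add: t0_def)
      qed
      have "ennreal (\<kappa> / x) * emeasure lborel {t0..(1 + \<epsilon>) * t0} = (\<integral>\<^sup>+t. ennreal (\<kappa> / x) * indicator {t0..(1 + \<epsilon>) * t0} t \<partial>lborel)"
        by (rule nn_integral_cmult_indicator[symmetric]) simp
      also have "\<dots> \<le> (\<integral>\<^sup>+t\<in>{0<..}. ennreal (p t x) \<partial>lborel)"
      proof (rule nn_integral_mono)
        fix t :: real
        show "ennreal (\<kappa> / x) * indicator {t0..(1 + \<epsilon>) * t0} t \<le> ennreal (p t x) * indicator {0<..} t"
        proof (cases "t \<in> {t0..(1 + \<epsilon>) * t0}")
          case True
          then have t: "0 < t" using t0 by auto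
          have "\<kappa> / x \<le> dens t w x"
            unfolding w_def using True x scaled_levy_law.integrable_laplace_line[OF slaw[OF t] w(1)]
            by (intro low(4)) (auto simp: t0_def w_def)
          then show ?thesis using True t p[OF t w(1)] by (auto intro: ennreal_leI)
        qed simp
      qed
      finally have "ennreal (\<kappa> / x * (\<epsilon> * t0)) \<le> (\<integral>\<^sup>+t\<in>{0<..}. ennreal (p t x) \<partial>lborel)"
        using low t0 x by (simp add: ennreal_mult[symmetric] distrib_right)
      moreover have "inverse C1 * (1 / (x * phi u)) \<le> \<kappa> / x * (\<epsilon> * t0)"
      proof -
        have "inverse C1 \<le> \<epsilon> * \<kappa>" using C1(1,3) low by (simp add: field_simps)
        then have "inverse C1 * (1 / x * (1 / phi u)) \<le> \<epsilon> * \<kappa> * (1 / x * t0)"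
          using \<open>1 / phi u \<le> t0\<close> x pu low by (intro mult_mono) auto
        then show ?thesis by (simp add: mult_ac)
      qed
      ultimately show ?thesis unfolding u_def by (meson ennreal_leI order.trans)
    qed
  qed
  then show ?thesis using C1(1) by blast
qed

end

section \<open>Subordinators\<close>

text \<open>Identifies the continuous version of the transition density, which is unique.\<close>

lemma transition_density_eq:
  assumes X: "T t \<in> borel_measurable M"
    and f: "continuous_on UNIV f" "\<And>x. 0 \<le> f x"
    and distr: "distr M borel (T t) = density lborel (\<lambda>x. ennreal (f x))"
  shows "transition_density M T t = f"
proof -
  have [measurable]: "f \<in> borel_measurable borel" using f(1) by (rule borel_measurable_continuous_onI)
  have dl: "distr M lborel (T t) = distr M borel (T t)" by (rule distr_cong) auto
  have "is_continuous_density M (T t) f"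
    using f X distr unfolding is_continuous_density_def distributed_def dl by auto
  moreover have "g = f" if g: "is_continuous_density M (T t) g" for g
  proof
    fix x
    have gc: "continuous_on UNIV g" "\<And>x. 0 \<le> g x" using g by (auto simp: is_continuous_density_def)
    have [measurable]: "g \<in> borel_measurable borel" using gc(1) by (rule borel_measurable_continuous_onI)
    have "density lborel (\<lambda>x. ennreal (g x)) = density lborel (\<lambda>x. ennreal (f x))"
      using g distr unfolding is_continuous_density_def distributed_def dl by auto
    then have "AE x in lborel. ennreal (g x) = ennreal (f x)"
      by (intro sigma_finite_measure.density_unique[OF sigma_finite_lborel]) auto
    then have "AE x in lborel. x \<in> UNIV \<longrightarrow> g x = f x"
      by eventually_elim (use gc f in auto)
    then show "g x = f x" using gc f by (intro continuous_on_eq_of_AE_eq[of UNIV]) auto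
  qed
  ultimately show ?thesis unfolding transition_density_def by (rule the_equality)
qed

lemma levy_measure_of_subordinator:
  assumes "subordinator_levy_measure \<nu>"
  shows "levy_measure \<nu>"
proof
  show s: "sets \<nu> = sets borel" using assms by (simp add: subordinator_levy_measure_def)
  note [measurable_cong] = s
  have "emeasure \<nu> {..0} = 0" using assms by (simp add: subordinator_levy_measure_def)
  then have "AE x in \<nu>. x \<notin> {..0}" using s by (intro AE_not_in) (auto simp: null_sets_def)
  then show pos: "AE x in \<nu>. 0 < x" by eventually_elim auto
  have "(\<integral>\<^sup>+x. ennreal (norm (min 1 x)) \<partial>\<nu>) = (\<integral>\<^sup>+x\<in>{0<..}. ennreal (min 1 x) \<partial>\<nu>)"
    by (rule nn_integral_cong_AE) (use pos in \<open>eventually_elim, auto\<close>)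
  also have "\<dots> < \<infinity>" using assms by (simp add: subordinator_levy_measure_def)
  finally show "integrable \<nu> (\<lambda>x. min 1 x)" by (intro integrableI_bounded) auto
qed

lemma (in levy_measure) set_integral_phi: "(LINT s:{0<..}|\<nu>. 1 - exp (- (u * s))) = phi u"
  unfolding phi_def set_lebesgue_integral_def
proof (rule integral_cong_AE)
  show "AE s in \<nu>. indicator {0<..} s *\<^sub>R (1 - exp (- (u * s))) = 1 - exp (- (u * s))"
    using pos by eventually_elim simp
qed measurable

text \<open>A zero of the Laplace exponent means that the Levy measure is null.\<close>

lemma (in levy_measure) phi_eq_0_imp:
  assumes "0 < u" "phi u = 0"
  shows "phi v = 0"
proof -
  have "AE s in \<nu>. 1 - exp (- (u * s)) = 0"
  proof (subst integral_nonneg_eq_0_iff_AE[symmetric])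
    show "integrable \<nu> (\<lambda>s. 1 - exp (- (u * s)))" using assms by (intro integrable_phi) auto
    show "AE s in \<nu>. 0 \<le> 1 - exp (- (u * s))" using pos by eventually_elim (use assms in auto)
  qed (use assms in \<open>simp add: phi_def\<close>)
  with pos have "AE s in \<nu>. False" by eventually_elim (use assms in auto)
  then have "AE s in \<nu>. 1 - exp (- (v * s)) = 0" by eventually_elim simp
  then have "(LINT s|\<nu>. 1 - exp (- (v * s))) = (LINT s|\<nu>. 0)"
    by (intro integral_cong_AE) measurable
  then show ?thesis by (simp add: phi_def)
qed

text \<open>A positive drift would force linear growth, against upper scaling with \<open>\<beta> < 1\<close>.\<close>

lemma drift_eq_0:
  fixes \<phi> g :: "real \<Rightarrow> real"
  assumes rep: "\<And>u. 0 < u \<Longrightarrow> \<phi> u = b * u + g u" and nn: "0 \<le> b" "\<And>u. 0 < u \<Longrightarrow> 0 \<le> g u"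
    and up: "\<And>r. 1 \<le> r \<Longrightarrow> \<phi> (r * x) \<le> C * r powr \<beta> * \<phi> x" and "\<beta> < 1" "0 < x"
  shows "b = 0"
proof -
  have "b * x \<le> C * \<phi> x * r powr (\<beta> - 1)" if r: "1 \<le> r" for r
  proof -
    have "r * (b * x) \<le> \<phi> (r * x)" using rep[of "r * x"] nn(2)[of "r * x"] r \<open>0 < x\<close> by (simp add: mult_ac)
    also have "\<dots> \<le> C * r powr \<beta> * \<phi> x" by (rule up[OF r])
    finally have "b * x \<le> C * r powr \<beta> * \<phi> x / r" using r by (simp add: pos_le_divide_eq mult.commute)
    then show ?thesis using r by (simp add: powr_diff mult_ac)
  qed
  then have "eventually (\<lambda>r. b * x \<le> C * \<phi> x * r powr (\<beta> - 1)) at_top"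
    using eventually_ge_at_top[of 1] by (rule eventually_mono[rotated])
  moreover have "((\<lambda>r. C * \<phi> x * r powr (\<beta> - 1)) \<longlongrightarrow> C * \<phi> x * 0) at_top"
    using \<open>\<beta> < 1\<close> by (intro tendsto_mult tendsto_const tendsto_neg_powr filterlim_ident) auto
  ultimately have "b * x \<le> C * \<phi> x * 0"
    by (intro tendsto_lowerbound) auto
  then show ?thesis using nn(1) \<open>0 < x\<close> by (simp add: mult_le_0_iff)
qed

text \<open>For a nondecreasing function with \<open>g (r x) \<le> r g x\<close>, scaling on \<open>(x0,\<infinity>)\<close> implies scaling on
  \<open>(x0/k,\<infinity>)\<close>, with worse constants. This reduces the range \<open>x < A / x0\<close> to the range
  \<open>x0 / k < 1 / x\<close>.\<close>

lemma scaling_extend: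
  fixes g :: "real \<Rightarrow> real"
  assumes "1 \<le> k" "0 \<le> x0" "0 < c" "c \<le> 1" "1 \<le> C" "0 < \<alpha>" "0 < \<beta>"
    and mono: "\<And>x y. 0 \<le> x \<Longrightarrow> x \<le> y \<Longrightarrow> g x \<le> g y" and nonneg: "\<And>x. 0 \<le> x \<Longrightarrow> 0 \<le> g x"
    and sub: "\<And>x r. 0 \<le> x \<Longrightarrow> 1 \<le> r \<Longrightarrow> g (r * x) \<le> r * g x"
    and lower: "\<And>r x. 1 \<le> r \<Longrightarrow> x0 < x \<Longrightarrow> c * r powr \<alpha> * g x \<le> g (r * x)"
    and upper: "\<And>r x. 1 \<le> r \<Longrightarrow> x0 < x \<Longrightarrow> g (r * x) \<le> C * r powr \<beta> * g x"
    and r: "1 \<le> r" and x: "x0 / k < x"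
  shows "c * k powr (- \<alpha>) * r powr \<alpha> * g x \<le> g (r * x)"
    and "g (r * x) \<le> C * k * r powr \<beta> * g x"
proof -
  have "0 \<le> x0 / k" using assms by simp
  with x have x0: "0 < x" by linarith
  have kx: "x0 < k * x" "x \<le> k * x" using x \<open>1 \<le> k\<close> x0 by (auto simp: field_simps)
  have e: "c * k powr (- \<alpha>) * r powr \<alpha> = c * (r / k) powr \<alpha>"
    using assms by (simp add: powr_divide powr_minus field_simps)
  have gx: "0 \<le> g x" using x0 nonneg by simp
  show "c * k powr (- \<alpha>) * r powr \<alpha> * g x \<le> g (r * x)"
  proof (cases "k \<le> r")
    case True
    have "c * (r / k) powr \<alpha> * g x \<le> c * (r / k) powr \<alpha> * g (k * x)"
      using assms x0 kx by (intro mult_left_mono mono) auto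
    also have "\<dots> \<le> g (r / k * (k * x))" using True assms kx by (intro lower) auto
    finally show ?thesis using assms unfolding e by simp
  next
    case False
    have "(r / k) powr \<alpha> \<le> 1" using False assms by (intro powr_le1) auto
    then have "c * (r / k) powr \<alpha> * g x \<le> 1 * 1 * g x"
      using assms gx by (intro mult_right_mono mult_mono) auto
    also have "\<dots> \<le> g (r * x)" using x0 r by (simp add: mono)
    finally show ?thesis unfolding e .
  qed
  show "g (r * x) \<le> C * k * r powr \<beta> * g x"
  proof (cases "k \<le> r")
    case True
    have "g (r * x) = g (r / k * (k * x))" using assms by simp
    also have "\<dots> \<le> C * (r / k) powr \<beta> * g (k * x)" using True assms kx by (intro upper) auto
    also have "\<dots> \<le> C * r powr \<beta> * (k * g x)"
    proof (intro mult_mono)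
      show "(r / k) powr \<beta> \<le> r powr \<beta>" using assms by (intro powr_mono2) (auto simp: divide_le_eq)
      show "g (k * x) \<le> k * g x" using x0 assms by (intro sub) auto
      show "0 \<le> g (k * x)" using x0 kx by (intro nonneg) auto
    qed (use assms in auto)
    finally show ?thesis by (simp add: mult_ac)
  next
    case False
    have "g (r * x) \<le> g (k * x)" using False x0 r by (intro mono mult_right_mono) auto
    also have "\<dots> \<le> k * g x" using x0 assms by (intro sub) auto
    also have "\<dots> = 1 * k * 1 * g x" by simp
    also have "\<dots> \<le> C * k * r powr \<beta> * g x"
      using assms gx by (intro mult_right_mono mult_mono ge_one_powr_ge_zero) auto
    finally show ?thesis .
  qed
qed

text \<open>The alternative between a monotone density and \<open>\<alpha> > 1/2\<close> enters only through
  \<open>deriv_decay\<close>, that is, through the upper bound. That \<open>\<phi>''\<close> does not vanish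
  identically ensures that \<open>\<phi>\<close> is positive on \<open>(0,\<infinity>)\<close>.\<close>

theorem theorem5p8:
  fixes M :: "'a measure" and T :: "real \<Rightarrow> 'a \<Rightarrow> real"
    and \<phi> :: "real \<Rightarrow> real" and b :: real and \<nu> :: "real measure"
    and \<alpha> \<beta> c C x0 :: real
  assumes "subordinator M T"
    and "is_laplace_exponent M T \<phi>"
    and "levy_khintchine_repr \<phi> b \<nu>"
    and "\<exists>u>0. deriv (deriv \<phi>) u \<noteq> 0"
    and "0 < c" "c \<le> 1" "1 \<le> C" "0 \<le> x0"
    and "0 < \<alpha>" "\<alpha> \<le> \<beta>" "\<beta> < 1"
    and "\<phi> \<in> WLSC \<alpha> c x0 \<inter> WUSC \<beta> C x0"
    and "has_monotone_density \<nu> \<or> \<alpha> > 1 / 2"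
  shows "\<forall>A>0. \<exists>C1\<ge>1. \<forall>x>0. (x0 = 0 \<or> x < A / x0) \<longrightarrow>
           ennreal (inverse C1 * (1 / (x * \<phi> (1 / x)))) \<le> green_function M T x \<and>
           green_function M T x \<le> ennreal (C1 * (1 / (x * \<phi> (1 / x))))"
proof (intro allI impI)
  fix A :: real assume A: "0 < A"
  interpret T: subordinator M T by fact
  interpret nu: levy_measure \<nu>
    using assms(3) by (intro levy_measure_of_subordinator) (simp add: levy_khintchine_repr_def)
  have lower: "c * r powr \<alpha> * \<phi> x \<le> \<phi> (r * x)" and upper: "\<phi> (r * x) \<le> C * r powr \<beta> * \<phi> x"
    if "1 \<le> r" "x0 < x" for r x
    using assms(12) that by (auto simp: WLSC_def WUSC_def)
  have rep: "\<phi> u = b * u + nu.phi u" if "0 \<le> u" for u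
    using assms(3) that by (simp add: levy_khintchine_repr_def nu.set_integral_phi)
  have "b = 0"
  proof (rule drift_eq_0[of \<phi> b nu.phi "x0 + 1" C \<beta>])
    show "0 \<le> b" using assms(3) by (simp add: levy_khintchine_repr_def)
  qed (use rep upper assms nu.phi_nonneg in auto)
  with rep have phi: "\<phi> u = nu.phi u" if "0 \<le> u" for u using that by simp
  have phi_pos: "0 < nu.phi u" if u: "0 < u" for u
  proof (rule ccontr)
    assume "\<not> 0 < nu.phi u"
    then have "nu.phi u = 0" using nu.phi_nonneg[of u] u by simp
    then have "nu.phi v = 0" for v by (rule nu.phi_eq_0_imp[OF u])
    then have z: "\<phi> v = 0" if "0 < v" for v using phi that by simp
    have d1: "deriv \<phi> v = 0" if "0 < v" for v
    proof (rule DERIV_imp_deriv)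
      show "(\<phi> has_field_derivative 0) (at v)"
        by (rule has_field_derivative_transform_within_open[OF DERIV_const[of 0], of "{0<..}"]) (use that z in auto)
    qed
    have d2: "deriv (deriv \<phi>) v = 0" if "0 < v" for v
    proof (rule DERIV_imp_deriv)
      show "(deriv \<phi> has_field_derivative 0) (at v)"
        by (rule has_field_derivative_transform_within_open[OF DERIV_const[of 0], of "{0<..}"]) (use that d1 in auto)
    qed
    show False using d2 assms(4) by auto
  qed
  define k where "k = max 1 A"
  have k: "1 \<le> k" "A \<le> k" by (auto simp: k_def)
  have lower': "c * r powr \<alpha> * nu.phi x \<le> nu.phi (r * x)"
    and upper': "nu.phi (r * x) \<le> C * r powr \<beta> * nu.phi x" if "1 \<le> r" "x0 < x" for r x
    using lower[OF that] upper[OF that] that assms(8) by (auto simp: phi)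
  note ext = scaling_extend[OF k(1) assms(8,5,6,7,9) _ nu.phi_mono nu.phi_nonneg nu.phi_mult_le lower' upper']
  interpret sc: scaled_levy_measure \<nu> \<alpha> \<beta> "c * k powr (- \<alpha>)" "C * k" "x0 / k"
  proof
    show "0 < c * k powr (- \<alpha>)" "0 \<le> x0 / k" "0 < \<alpha>" "\<beta> < 1" using assms k by auto
    have "k powr (- \<alpha>) \<le> k powr 0" using k assms by (intro powr_mono) auto
    then have "k powr (- \<alpha>) \<le> 1" using k by simp
    then show "c * k powr (- \<alpha>) \<le> 1" using assms by (intro mult_le_one) auto
    show "1 \<le> C * k" using assms(7) k(1) mult_mono[of 1 C 1 k] by simp
    show "0 < nu.phi u" if "0 < u" for u by (rule phi_pos[OF that])
    show "c * k powr (- \<alpha>) * r powr \<alpha> * nu.phi x \<le> nu.phi (r * x)" if "1 \<le> r" "x0 / k < x" for r x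
      using ext(1)[OF _ _ _ _ _ _ _ _ _ _ that] assms by auto
    show "nu.phi (r * x) \<le> C * k * r powr \<beta> * nu.phi x" if "1 \<le> r" "x0 / k < x" for r x
      using ext(2)[OF _ _ _ _ _ _ _ _ _ _ that] assms by auto
  qed
  have decay: "\<exists>D \<delta>. sc.deriv_decay D \<delta>"
  proof (cases "1 / 2 < \<alpha>")
    case False
    then obtain f where f: "f \<in> borel_measurable borel" "\<And>s. 0 < s \<Longrightarrow> 0 \<le> f s"
        "mono_on {0<..} f \<or> antimono_on {0<..} f"
        "\<nu> = density lborel (\<lambda>s. ennreal (f s) * indicator {0<..} s)"
      using assms(13) by (auto simp: has_monotone_density_def)
    have anti: "antimono_on {0<..} f"
    proof (cases "antimono_on {0<..} f")
      case False
      with f have "f s = 0" if "0 < s" for s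
        using that by (intro nu.mono_density_eq_0) auto
      then show ?thesis by (auto simp: monotone_on_def)
    qed
    show ?thesis
      by (intro sc.deriv_decay_of_deriv_le nu.norm_cphi'_le_of_antimono_density[OF f(1,2) anti f(4)])
  qed (rule sc.deriv_decay_of_half_less)
  have law: "levy_law \<nu> (distr M borel (T t)) t" if t: "0 < t" for t
  proof -
    have [measurable]: "T t \<in> borel_measurable M" using T.random_variable t by simp
    interpret D: real_distribution "distr M borel (T t)"
      by (rule T.real_distribution_distr) simp
    show ?thesis
    proof
      show "AE y in distr M borel (T t). 0 \<le> y"
      proof (subst AE_distr_iff)
        show "AE \<omega> in M. 0 \<le> T t \<omega>"
          using T.start_zero T.nondecreasing_paths
        proof eventually_elim
          case (elim \<omega>)
          then show ?case using monotone_onD[OF elim(2), of 0 t] t by simp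
        qed
      qed auto
      show "(LINT y|distr M borel (T t). exp (- (u * y))) = exp (- (t * nu.phi u))" if "0 < u" for u
      proof -
        have "(LINT y|distr M borel (T t). exp (- (u * y))) = (LINT \<omega>|M. exp (- u * T t \<omega>))"
          by (subst integral_distr) auto
        also have "\<dots> = exp (- t * \<phi> u)" using assms(2) t that by (simp add: is_laplace_exponent_def)
        finally show ?thesis using phi that by simp
      qed
    qed (use t in auto)
  qed
  have dens: "transition_density M T t = nu.dens t u" if t: "0 < t" and u: "x0 / k < u" for t u
  proof -
    interpret L: scaled_levy_law \<nu> \<alpha> \<beta> "c * k powr (- \<alpha>)" "C * k" "x0 / k" "distr M borel (T t)" t
      using law[OF t] by (intro scaled_levy_law.intro) (rule sc.scaled_levy_measure_axioms)
    show ?thesis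
      using T.random_variable[of t] t L.dens[OF u] by (intro transition_density_eq) auto
  qed
  obtain C1 where C1: "1 \<le> C1" "\<And>x. 0 < x \<Longrightarrow> x0 / k < 1 / x \<Longrightarrow>
      ennreal (inverse C1 * (1 / (x * nu.phi (1 / x)))) \<le> green_function M T x \<and>
      green_function M T x \<le> ennreal (C1 * (1 / (x * nu.phi (1 / x))))"
    using sc.green_bounds[OF decay law, of "transition_density M T"] dens
    unfolding green_function_def by auto
  show "\<exists>C1\<ge>1. \<forall>x>0. (x0 = 0 \<or> x < A / x0) \<longrightarrow>
           ennreal (inverse C1 * (1 / (x * \<phi> (1 / x)))) \<le> green_function M T x \<and>
           green_function M T x \<le> ennreal (C1 * (1 / (x * \<phi> (1 / x))))"
  proof (intro exI[of _ C1] conjI[OF C1(1)] allI impI)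
    fix x :: real assume x: "0 < x" "x0 = 0 \<or> x < A / x0"
    have "x0 / k < 1 / x"
    proof (cases "x0 = 0")
      case False
      then have "x * x0 < k" using x assms(8) k by (auto simp: pos_less_divide_eq)
      then show ?thesis using x k by (simp add: field_simps)
    qed (use x in simp)
    from C1(2)[OF x(1) this]
    show "ennreal (inverse C1 * (1 / (x * \<phi> (1 / x)))) \<le> green_function M T x \<and>
      green_function M T x \<le> ennreal (C1 * (1 / (x * \<phi> (1 / x))))"
      using phi[of "1 / x"] x by simp
  qed
qed

end
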